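(* Let $(G_n)$ be a sequence of DAGs. Let $p_n$ be the number of nodes of $G_n$, and let $q_n=\deg(G_n)+2$. Suppose $(\Sigma_n)$ is a sequence of $p_n\times p_n$ positive definite correlation matrices, with $\Sigma_n$ faithful to $G_n$. Suppose further that there are constants $0\le a,b,d,f<1$ such that $$\log p_n=O(n^a),\qquad q_n=O(n^b),\qquad c_{\min}(\Sigma_n,q_n)=\Omega(n^{-d}),\qquad \lambda_{\min}(\Sigma_n,q_n)=\Omega(n^{-f}).$$ If $a+2b+2d+4f<1$, then there exists a sequence of thresholds $\gamma_n$ for which $$\lim_{n\to\infty}\mathbb{P}\big(\hat C_{\gamma_n}(G_n)=C(G_n)\big)=1,$$ where $\hat C_{\gamma_n}(G_n)$ is the output of the Rank PC (RPC) algorithm with threshold $\gamma_n$ for a sample of independent observations $X_1,\dots,X_n$ from a nonparanormal distribution $\mathit{NPN}(\,\cdot\,,\Sigma_n)$ (with arbitrary marginal transformations), and $C(G_n)$ is the CPDAG of $G_n$.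
   Context: **Asymptotic notation.** For positive sequences $(s_n)$, $(t_n)$: $s_n=O(t_n)$ if $s_n\le Mt_n$, and $s_n=\Omega(t_n)$ if $s_n\ge Mt_n$, for a constant $0<M<\infty$. **Nonparanormal distributions.** A correlation matrix is a covariance matrix with all diagonal entries equal to one. For a finite set $V$, a collection $h=(h_v)_{v\in V}$ of strictly increasing (not necessarily continuous) functions $h_v:\mathbb{R}\to\mathbb{R}$ and a positive definite correlation matrix $\Sigma\in\mathbb{R}^{V\times V}$, $\mathit{NPN}(h,\Sigma)$ is the distribution of $(h_v(Z_v))_{v\in V}$, where $(Z_v)_{v\in V}\sim N(0,\Sigma)$. **Graphs.** A DAG is a finite acyclic directed graph $G=(V,E)$. The degree of a node is the number of edges it is incident to, and $\deg(G)$ is the maximum degree. A path from $u$ to $v$ is a sequence of distinct nodes $(v_0,\dots,v_m)$ with $v_0=u$, $v_m=v$ and, for each $k$, $v_{k-1}\to v_k\in E$ or $v_{k-1}\leftarrow v_k\in E$. Distinct nodes $u,v$ are d-separated by $S\subset V\setminus\{u,v\}$ if every path from $u$ to $v$ contains three consecutive nodes $(v_{k-1},v_k,v_{k+1})$ such that either (i) they form a chain $v_{k-1}\to v_k\to v_{k+1}$ or $v_{k-1}\leftarrow v_k\leftarrow v_{k+1}$, or a fork $v_{k-1}\leftarrow v_k\to v_{k+1}$, and $v_k\in S$; or (ii) they form a collider $v_{k-1}\to v_k\leftarrow v_{k+1}$ and neither $v_k$ nor any of its descendants is in $S$. For pairwise disjoint $A',B',S\subset V$, $S$ d-separates $A'$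 and $B'$ if it d-separates every $a\in A'$ from every $b\in B'$. The distribution of $X=(X_v)_{v\in V}$ is faithful to $G$ if for all pairwise disjoint $A',B',S\subset V$: $S$ d-separates $A'$ and $B'$ in $G$ if and only if $X_{A'}$ and $X_{B'}$ are conditionally independent given $X_S$. A positive definite correlation matrix $\Sigma$ is faithful to $G$ if every distribution $\mathit{NPN}(h,\Sigma)$ is faithful to $G$ (conditional independences in $\mathit{NPN}(h,\Sigma)$ coincide with those in $N(0,\Sigma)$). Two DAGs on $V$ are Markov equivalent if they have the same d-separation relations; $[G]$ is the Markov equivalence class of $G$. The CPDAG of $G$ is $C(G)=(V,[E])$ with $[E]=\bigcup_{H\in[G]}E(H)$, where $E(H)$ is the edge set of $H$; the presence of both $(v,w)$ and $(w,v)$ in $[E]$ is interpreted as an undirected edge $v - w$. **Partial correlations.** For a positive definite correlation matrix $\Sigma\in\mathbb{R}^{V\times V}$, distinct $u,v\in V$ and $S\subseteq V\setminus\{u,v\}$, put $\Psi=\Sigma_{I,I}$ with $I=\{u,v\}\cup S$, and $\rho_{uv|S}=-\Psi^{-1}_{uv}/\sqrt{\Psi^{-1}_{uu}\Psi^{-1}_{vv}}$, where $\Psi^{-1}_{uv}$ is the $(u,v)$ entry of $\Psi^{-1}$. Let $c_{\min}(\Sigma)=\min\{|\rho_{uv|S}|: u,v\in V,\ u\ne v,\ S\subseteq V\setminus\{u,v\},\ \rho_{uv|S}\neq0\}$ and let $\lambda_{\min}(\Sigma)$ be the minimal eigenvalue. For an integer $q\ge2$, $$c_{\min}(\Sigma,q)=\min\{c_{\min}(\Sigma_{I,I}):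 I\subseteq V,\ |I|=q\},\qquad \lambda_{\min}(\Sigma,q)=\min\{\lambda_{\min}(\Sigma_{I,I}): I\subseteq V,\ |I|=q\}.$$ Degenerate-case conventions: if $q>|V|$, the condition $|I|=q$ is read as $|I|=|V|$; submatrices with no non-zero partial correlation do not contribute to the first minimum; and $c_{\min}(\Sigma,q):=1$ if there is no non-zero partial correlation at all. **Correlation estimator.** Assume given a rule which, from $n$ independent observations of a bivariate nonparanormal pair with latent correlation $\rho$ (the off-diagonal entry of the correlation matrix parameter), produces an estimator $\hat\rho$ of $\rho$ satisfying, for all $\epsilon>0$, $\mathbb{P}(|\hat\rho-\rho|>\epsilon)<A\exp(-Bn\epsilon^2)$, with fixed constants $0<A,B<\infty$ (not depending on the distribution, $n$ or $\epsilon$). Applying it to every pair of coordinates of the sample gives a symmetric matrix $\hat\Sigma=(\hat\rho_{uv})$, with unit diagonal. Partial correlation estimates $\hat\rho_{uv|S}$ are obtained by substituting $\hat\Sigma$ for $\Sigma$ in the formula for $\rho_{uv|S}$ (with an arbitrary fixed convention where the formula is undefined). **RPC algorithm.** For a threshold $\gamma\in[0,1]$, RPC is the PC algorithm in which the query "are $u$ and $v$ d-separated by $S$?" is answered "yes" if and only if $|\hat\rho_{uv|S}|\le\gamma$. The PC algorithm is as follows. (1) Start with the complete undirected graph on $V$. For $\ell=0,1,2,\dots$: for each ordered pair $(u,v)$ currently adjacent with $|\mathrm{adj}(u)\setminus\{v\}|\ge\ell$, query sets $S\subseteq\mathrm{adj}(u)\setminus\{v\}$ with $|S|=\ell$ (adjacency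 in the current graph) until the answer is "yes", in which case delete the edge $u-v$ and record $S(u,v)=S(v,u)=S$, or until all such sets are exhausted. Stop when $|\mathrm{adj}(u)\setminus\{v\}|<\ell$ for all ordered adjacent pairs $(u,v)$. (2) For every triple with $u-v-w$ in the resulting undirected graph and $u,w$ non-adjacent, orient $u\to v\leftarrow w$ if $v\notin S(u,w)$. (3) Orient further undirected edges by applying repeatedly, until none applies: orient $j-k$ as $j\to k$ if there is $i\to j$ with $i,k$ non-adjacent; orient $i-j$ as $i\to j$ if there is a chain $i\to k\to j$; orient $i-j$ as $i\to j$ if there are $i-k\to j$ and $i-l\to j$ with $k\neq l$ non-adjacent. (Any fixed order of processing and of resolving conflicting orientations may be used.) The resulting partially directed graph is the output, denoted $\hat C_\gamma(G)$. *)

theory Defs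
  imports
    "HOL-Probability.Probability"
    "HOL-Library.Landau_Symbols"
    "Jordan_Normal_Form.Char_Poly"
    "Jordan_Normal_Form.Gauss_Jordan_Elimination"
    "Jordan_Normal_Form.DL_Submatrix"
begin

text \<open>
  The node set of a graph with \<open>p\<close> nodes is \<open>{..<p}\<close>, so that a \<open>p\<close> by \<open>p\<close> matrix is
  indexed by nodes.  An edge set is a set of ordered pairs.  In a partially directed graph
  the presence of both \<open>(u, v)\<close> and \<open>(v, u)\<close> stands for an undirected edge.
\<close>

section \<open>Directed acyclic graphs and d-separation\<close>

definition dag :: "nat \<Rightarrow> (nat \<times> nat) set \<Rightarrow> bool" where
  "dag p E \<longleftrightarrow> E \<subseteq> {..<p} \<times> {..<p} \<and> acyclic E"

definition node_degree :: "(nat \<times> nat) set \<Rightarrow> nat \<Rightarrow> nat" where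
  "node_degree E v = card {e \<in> E. fst e = v \<or> snd e = v}"

definition max_degree :: "nat \<Rightarrow> (nat \<times> nat) set \<Rightarrow> nat" where
  "max_degree p E = Max (node_degree E ` {..<p})"

definition graph_path :: "(nat \<times> nat) set \<Rightarrow> nat \<Rightarrow> nat \<Rightarrow> nat list \<Rightarrow> bool" where
  "graph_path E u v xs \<longleftrightarrow> xs \<noteq> [] \<and> hd xs = u \<and> last xs = v \<and> distinct xs \<and>
     (\<forall>k. Suc k < length xs \<longrightarrow> (xs ! k, xs ! Suc k) \<in> E \<or> (xs ! Suc k, xs ! k) \<in> E)"

definition blocking_triple ::
  "(nat \<times> nat) set \<Rightarrow> nat set \<Rightarrow> nat \<Rightarrow> nat \<Rightarrow> nat \<Rightarrow> bool" where
  "blocking_triple E S x y z \<longleftrightarrow>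
     ((x, y) \<in> E \<and> (y, z) \<in> E \<or> (y, x) \<in> E \<and> (z, y) \<in> E \<or> (y, x) \<in> E \<and> (y, z) \<in> E) \<and> y \<in> S
     \<or> (x, y) \<in> E \<and> (z, y) \<in> E \<and> (\<forall>w. (y, w) \<in> E\<^sup>* \<longrightarrow> w \<notin> S)"

definition d_separated :: "(nat \<times> nat) set \<Rightarrow> nat \<Rightarrow> nat \<Rightarrow> nat set \<Rightarrow> bool" where
  "d_separated E u v S \<longleftrightarrow> (\<forall>xs. graph_path E u v xs \<longrightarrow>
     (\<exists>k. k + 2 < length xs \<and> blocking_triple E S (xs ! k) (xs ! (k + 1)) (xs ! (k + 2))))"

definition d_separated_sets ::
  "(nat \<times> nat) set \<Rightarrow> nat set \<Rightarrow> nat set \<Rightarrow> nat set \<Rightarrow> bool" where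
  "d_separated_sets E A B S \<longleftrightarrow> (\<forall>a\<in>A. \<forall>b\<in>B. d_separated E a b S)"

definition markov_equivalent :: "nat \<Rightarrow> (nat \<times> nat) set \<Rightarrow> (nat \<times> nat) set \<Rightarrow> bool" where
  "markov_equivalent p E H \<longleftrightarrow>
     (\<forall>u<p. \<forall>v<p. \<forall>S. u \<noteq> v \<longrightarrow> S \<subseteq> {..<p} - {u, v} \<longrightarrow>
        (d_separated E u v S \<longleftrightarrow> d_separated H u v S))"

definition cpdag :: "nat \<Rightarrow> (nat \<times> nat) set \<Rightarrow> (nat \<times> nat) set" where
  "cpdag p E = \<Union> {H. dag p H \<and> markov_equivalent p E H}"


section \<open>Nonparanormal distributions and faithfulness\<close>

definition pd_correlation_matrix :: "nat \<Rightarrow> real mat \<Rightarrow> bool" where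
  "pd_correlation_matrix p C \<longleftrightarrow>
     C \<in> carrier_mat p p \<and> transpose_mat C = C \<and> (\<forall>i<p. C $$ (i, i) = 1) \<and>
     (\<forall>x\<in>carrier_vec p. x \<noteq> 0\<^sub>v p \<longrightarrow> scalar_prod x (C *\<^sub>v x) > 0)"

definition normal_dist :: "nat \<Rightarrow> real mat \<Rightarrow> (nat \<Rightarrow> real) measure" where
  "normal_dist p C = density (PiM {..<p} (\<lambda>_. lborel))
     (\<lambda>x. ennreal (exp (- scalar_prod (Matrix.vec p x) (the (mat_inverse C) *\<^sub>v Matrix.vec p x) / 2)
                   / sqrt ((2 * pi) ^ p * Determinant.det C)))"

definition npn :: "nat \<Rightarrow> (nat \<Rightarrow> real \<Rightarrow> real) \<Rightarrow> real mat \<Rightarrow> (nat \<Rightarrow> real) measure" where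
  "npn p h C = distr (normal_dist p C) (PiM {..<p} (\<lambda>_. borel)) (\<lambda>z. \<lambda>v\<in>{..<p}. h v (z v))"

definition strict_marginals :: "nat \<Rightarrow> (nat \<Rightarrow> real \<Rightarrow> real) \<Rightarrow> bool" where
  "strict_marginals p h \<longleftrightarrow> (\<forall>v<p. strict_mono (h v))"

definition coord_algebra :: "(nat \<Rightarrow> real) measure \<Rightarrow> nat set \<Rightarrow> (nat \<Rightarrow> real) measure" where
  "coord_algebra M S = vimage_algebra (space M) (\<lambda>x. restrict x S) (PiM S (\<lambda>_. borel))"

definition cond_indep :: "(nat \<Rightarrow> real) measure \<Rightarrow> nat set \<Rightarrow> nat set \<Rightarrow> nat set \<Rightarrow> bool" where
  "cond_indep M A B S \<longleftrightarrow>
     (\<forall>F \<in> sets (PiM A (\<lambda>_. borel)). \<forall>H \<in> sets (PiM B (\<lambda>_. borel)). AE x in M.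
        real_cond_exp M (coord_algebra M S)
          (\<lambda>y. indicator F (restrict y A) * indicator H (restrict y B)) x =
        real_cond_exp M (coord_algebra M S) (\<lambda>y. indicator F (restrict y A)) x *
        real_cond_exp M (coord_algebra M S) (\<lambda>y. indicator H (restrict y B)) x)"

definition faithful_dist :: "nat \<Rightarrow> (nat \<times> nat) set \<Rightarrow> (nat \<Rightarrow> real) measure \<Rightarrow> bool" where
  "faithful_dist p E M \<longleftrightarrow>
     (\<forall>A B S. A \<subseteq> {..<p} \<and> B \<subseteq> {..<p} \<and> S \<subseteq> {..<p} \<and>
        A \<inter> B = {} \<and> A \<inter> S = {} \<and> B \<inter> S = {} \<longrightarrow>
        (d_separated_sets E A B S \<longleftrightarrow> cond_indep M A B S))"

definition faithful :: "nat \<Rightarrow> (nat \<times> nat) set \<Rightarrow> real mat \<Rightarrow> bool" where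
  "faithful p E C \<longleftrightarrow> (\<forall>h. strict_marginals p h \<longrightarrow> faithful_dist p E (npn p h C))"


section \<open>Partial correlations\<close>

text \<open>
  \<^const>\<open>submatrix\<close> renumbers the rows and columns it keeps; row \<open>u \<in> I\<close> becomes row
  \<open>card {a \<in> I. a < u}\<close>.
\<close>

definition inv_entry :: "real mat \<Rightarrow> nat set \<Rightarrow> nat \<Rightarrow> nat \<Rightarrow> real" where
  "inv_entry C I u v =
     the (mat_inverse (submatrix C I I)) $$ (card {a \<in> I. a < u}, card {a \<in> I. a < v})"

definition pcor :: "real mat \<Rightarrow> nat \<Rightarrow> nat \<Rightarrow> nat set \<Rightarrow> real" where
  "pcor C u v S = (let I = {u, v} \<union> S in
     - inv_entry C I u v / sqrt (inv_entry C I u u * inv_entry C I v v))"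

definition pcor_defined :: "real mat \<Rightarrow> nat \<Rightarrow> nat \<Rightarrow> nat set \<Rightarrow> bool" where
  "pcor_defined C u v S \<longleftrightarrow> (let I = {u, v} \<union> S in
     mat_inverse (submatrix C I I) \<noteq> None \<and> inv_entry C I u u * inv_entry C I v v > 0)"

definition nonzero_pcors :: "real mat \<Rightarrow> real set" where
  "nonzero_pcors C = {\<bar>pcor C u v S\<bar> | u v S. u < dim_row C \<and> v < dim_row C \<and> u \<noteq> v \<and>
     S \<subseteq> {..<dim_row C} - {u, v} \<and> pcor C u v S \<noteq> 0}"

definition c_min :: "real mat \<Rightarrow> real" where
  "c_min C = Min (nonzero_pcors C)"

definition lambda_min :: "real mat \<Rightarrow> real" where
  "lambda_min C = Min {k. eigenvalue C k}"

definition index_sets :: "real mat \<Rightarrow> nat \<Rightarrow> nat set set" where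
  "index_sets C q = {I. I \<subseteq> {..<dim_row C} \<and> card I = min q (dim_row C)}"

definition c_min_order :: "real mat \<Rightarrow> nat \<Rightarrow> real" where
  "c_min_order C q =
     (let J = {I \<in> index_sets C q. nonzero_pcors (submatrix C I I) \<noteq> {}} in
      if J = {} then 1 else Min ((\<lambda>I. c_min (submatrix C I I)) ` J))"

definition lambda_min_order :: "real mat \<Rightarrow> nat \<Rightarrow> real" where
  "lambda_min_order C q = Min ((\<lambda>I. lambda_min (submatrix C I I)) ` index_sets C q)"


section \<open>The PC algorithm\<close>

text \<open>
  The relations below contain every run of the algorithm, for all orders of processing and all
  ways of resolving conflicting orientations.  A query \<open>Q u v S\<close> is the answer to
  ``are \<open>u\<close> and \<open>v\<close> d-separated by \<open>S\<close>?''.  The state of the first phase consists of the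
  current undirected graph, a symmetric set of ordered pairs, and of the recorded separating
  sets, indexed by unordered pairs.
\<close>

type_synonym query = "nat \<Rightarrow> nat \<Rightarrow> nat set \<Rightarrow> bool"
type_synonym skel_state = "(nat \<times> nat) set \<times> (nat set \<Rightarrow> nat set)"

definition adj :: "(nat \<times> nat) set \<Rightarrow> nat \<Rightarrow> nat set" where
  "adj D u = {w. (u, w) \<in> D}"

inductive skel_pair :: "query \<Rightarrow> nat \<Rightarrow> nat \<times> nat \<Rightarrow> skel_state \<Rightarrow> skel_state \<Rightarrow> bool"
  for Q l where
  not_examined: "(u, v) \<notin> D \<or> card (adj D u - {v}) < l \<Longrightarrow>
     skel_pair Q l (u, v) (D, Sep) (D, Sep)"
| exhausted: "\<lbrakk>(u, v) \<in> D; card (adj D u - {v}) \<ge> l;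
     \<forall>S. S \<subseteq> adj D u - {v} \<and> card S = l \<longrightarrow> \<not> Q u v S\<rbrakk> \<Longrightarrow>
     skel_pair Q l (u, v) (D, Sep) (D, Sep)"
| deleted: "\<lbrakk>(u, v) \<in> D; card (adj D u - {v}) \<ge> l;
     S \<subseteq> adj D u - {v}; card S = l; Q u v S\<rbrakk> \<Longrightarrow>
     skel_pair Q l (u, v) (D, Sep) (D - {(u, v), (v, u)}, Sep({u, v} := S))"

inductive skel_level :: "query \<Rightarrow> nat \<Rightarrow> (nat \<times> nat) list \<Rightarrow> skel_state \<Rightarrow> skel_state \<Rightarrow> bool"
  for Q l where
  "skel_level Q l [] st st"
| "\<lbrakk>skel_pair Q l e st st'; skel_level Q l es st' st''\<rbrakk> \<Longrightarrow> skel_level Q l (e # es) st st''"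

inductive skel_from :: "query \<Rightarrow> nat \<Rightarrow> skel_state \<Rightarrow> skel_state \<Rightarrow> bool"
  for Q where
  stop: "\<forall>(u, v)\<in>fst st. card (adj (fst st) u - {v}) < l \<Longrightarrow> skel_from Q l st st"
| continue: "\<lbrakk>\<exists>(u, v)\<in>fst st. card (adj (fst st) u - {v}) \<ge> l;
     distinct es; set es = fst st; skel_level Q l es st st'; skel_from Q (Suc l) st' st''\<rbrakk> \<Longrightarrow>
     skel_from Q l st st''"

definition complete_graph :: "nat \<Rightarrow> (nat \<times> nat) set" where
  "complete_graph p = {(u, v). u < p \<and> v < p \<and> u \<noteq> v}"

definition unshielded_colliders ::
  "(nat \<times> nat) set \<Rightarrow> (nat set \<Rightarrow> nat set) \<Rightarrow> (nat \<times> nat \<times> nat) set" where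
  "unshielded_colliders D Sep =
     {(u, v, w). u < w \<and> (u, v) \<in> D \<and> (v, w) \<in> D \<and> (u, w) \<notin> D \<and> v \<notin> Sep {u, w}}"

text \<open>
  Rule \<open>conflict\<close> applies if one of the two edges is already oriented out of \<open>v\<close>.  Then
  each of the two edges is left unchanged, marked in both directions, or oriented into \<open>v\<close>.
\<close>

inductive orient_collider ::
  "nat \<times> nat \<times> nat \<Rightarrow> (nat \<times> nat) set \<Rightarrow> (nat \<times> nat) set \<Rightarrow> bool" where
  no_conflict: "\<lbrakk>(u, v) \<in> P; (w, v) \<in> P\<rbrakk> \<Longrightarrow> orient_collider (u, v, w) P (P - {(v, u), (v, w)})"
| conflict: "\<lbrakk>(u, v) \<notin> P \<or> (w, v) \<notin> P;
     P1 \<in> {P, insert (u, v) P, insert (u, v) P - {(v, u)}};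
     P2 \<in> {P1, insert (w, v) P1, insert (w, v) P1 - {(v, w)}}\<rbrakk> \<Longrightarrow>
     orient_collider (u, v, w) P P2"

inductive orient_colliders ::
  "(nat \<times> nat \<times> nat) list \<Rightarrow> (nat \<times> nat) set \<Rightarrow> (nat \<times> nat) set \<Rightarrow> bool" where
  "orient_colliders [] P P"
| "\<lbrakk>orient_collider t P P'; orient_colliders ts P' P''\<rbrakk> \<Longrightarrow> orient_colliders (t # ts) P P''"

definition undirected :: "(nat \<times> nat) set \<Rightarrow> nat \<Rightarrow> nat \<Rightarrow> bool" where
  "undirected P i j \<longleftrightarrow> (i, j) \<in> P \<and> (j, i) \<in> P"

definition directed :: "(nat \<times> nat) set \<Rightarrow> nat \<Rightarrow> nat \<Rightarrow> bool" where
  "directed P i j \<longleftrightarrow> (i, j) \<in> P \<and> (j, i) \<notin> P"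

definition nonadjacent :: "(nat \<times> nat) set \<Rightarrow> nat \<Rightarrow> nat \<Rightarrow> bool" where
  "nonadjacent P i j \<longleftrightarrow> (i, j) \<notin> P \<and> (j, i) \<notin> P"

inductive meek_step :: "(nat \<times> nat) set \<Rightarrow> (nat \<times> nat) set \<Rightarrow> bool" where
  rule1: "\<lbrakk>undirected P j k; directed P i j; nonadjacent P i k\<rbrakk> \<Longrightarrow> meek_step P (P - {(k, j)})"
| rule2: "\<lbrakk>undirected P i j; directed P i k; directed P k j\<rbrakk> \<Longrightarrow> meek_step P (P - {(j, i)})"
| rule3: "\<lbrakk>undirected P i j; undirected P i k; directed P k j; undirected P i l; directed P l j;
     k \<noteq> l; nonadjacent P k l\<rbrakk> \<Longrightarrow> meek_step P (P - {(j, i)})"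

definition pc_output :: "nat \<Rightarrow> query \<Rightarrow> (nat \<times> nat) set \<Rightarrow> bool" where
  "pc_output p Q P \<longleftrightarrow> (\<exists>D Sep ts P0.
     skel_from Q 0 (complete_graph p, \<lambda>_. {}) (D, Sep) \<and>
     distinct ts \<and> set ts = unshielded_colliders D Sep \<and> orient_colliders ts D P0 \<and>
     meek_step\<^sup>*\<^sup>* P0 P \<and> (\<nexists>P'. meek_step P P'))"

text \<open>
  A PC procedure on \<open>p\<close> nodes resolves all the choices in some way: for each family of
  answers it returns the output of one run.
\<close>

definition pc_procedure :: "nat \<Rightarrow> (query \<Rightarrow> (nat \<times> nat) set) \<Rightarrow> bool" where
  "pc_procedure p PC \<longleftrightarrow> (\<forall>Q. pc_output p Q (PC Q))"


section \<open>Correlation estimation and the RPC algorithm\<close>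

definition bivariate_npn :: "(nat \<Rightarrow> real \<Rightarrow> real) \<Rightarrow> real \<Rightarrow> (real \<times> real) measure" where
  "bivariate_npn h r =
     distr (npn 2 h (mat 2 2 (\<lambda>(i, j). if i = j then 1 else r))) borel (\<lambda>x. (x 0, x 1))"

definition correlation_estimator ::
  "real \<Rightarrow> real \<Rightarrow> (nat \<Rightarrow> (nat \<Rightarrow> real \<times> real) \<Rightarrow> real) \<Rightarrow> bool" where
  "correlation_estimator A B est \<longleftrightarrow>
     (\<forall>n\<ge>1. est n \<in> borel_measurable (PiM {..<n} (\<lambda>_. borel)) \<and>
       (\<forall>h r \<epsilon>. strict_marginals 2 h \<longrightarrow> \<bar>r\<bar> < 1 \<longrightarrow> \<epsilon> > 0 \<longrightarrow>
          measure (PiM {..<n} (\<lambda>_. bivariate_npn h r))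
            {y \<in> space (PiM {..<n} (\<lambda>_. bivariate_npn h r)). \<bar>est n y - r\<bar> > \<epsilon>}
          < A * exp (- B * real n * \<epsilon>\<^sup>2)))"

text \<open>
  A sample \<open>x\<close> consists of observations \<open>x k\<close> for \<open>k < n\<close>, the coordinates of which are
  \<open>x k v\<close> for \<open>v < p\<close>.  The estimator is applied once to each unordered pair of coordinates.
\<close>

definition corr_estimate ::
  "(nat \<Rightarrow> (nat \<Rightarrow> real \<times> real) \<Rightarrow> real) \<Rightarrow> nat \<Rightarrow> nat \<Rightarrow> (nat \<Rightarrow> nat \<Rightarrow> real) \<Rightarrow> real mat" where
  "corr_estimate est p n x = mat p p (\<lambda>(u, v). if u = v then 1
     else est n (\<lambda>k\<in>{..<n}. (x k (min u v), x k (max u v))))"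

text \<open>The argument \<open>und\<close> is the convention for undefined partial correlations.\<close>

definition pcor_estimate ::
  "(nat \<Rightarrow> nat \<Rightarrow> nat set \<Rightarrow> real) \<Rightarrow> real mat \<Rightarrow> nat \<Rightarrow> nat \<Rightarrow> nat set \<Rightarrow> real" where
  "pcor_estimate und C u v S = (if pcor_defined C u v S then pcor C u v S else und u v S)"

definition rpc_query ::
  "(nat \<Rightarrow> nat \<Rightarrow> nat set \<Rightarrow> real) \<Rightarrow> real \<Rightarrow> real mat \<Rightarrow> query" where
  "rpc_query und \<gamma> C u v S \<longleftrightarrow>
     u < dim_row C \<and> v < dim_row C \<and> u \<noteq> v \<and> S \<subseteq> {..<dim_row C} - {u, v} \<and>
     \<bar>pcor_estimate und C u v S\<bar> \<le> \<gamma>"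

definition rpc ::
  "(query \<Rightarrow> (nat \<times> nat) set) \<Rightarrow> (nat \<Rightarrow> nat \<Rightarrow> nat set \<Rightarrow> real) \<Rightarrow>
   (nat \<Rightarrow> (nat \<Rightarrow> real \<times> real) \<Rightarrow> real) \<Rightarrow> real \<Rightarrow> nat \<Rightarrow> nat \<Rightarrow> (nat \<Rightarrow> nat \<Rightarrow> real) \<Rightarrow>
   (nat \<times> nat) set" where
  "rpc PC und est \<gamma> p n x = PC (rpc_query und \<gamma> (corr_estimate est p n x))"

definition npn_sample ::
  "nat \<Rightarrow> nat \<Rightarrow> (nat \<Rightarrow> real \<Rightarrow> real) \<Rightarrow> real mat \<Rightarrow> (nat \<Rightarrow> nat \<Rightarrow> real) measure" where
  "npn_sample n p h C = PiM {..<n} (\<lambda>_. npn p h C)"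

end

(*
  Faithfulness turns d-separation into the vanishing of a partial correlation, that is, of an entry
  of an inverse matrix.  If all entries of the estimated correlation matrix are within
  eps = c lam^2 / (8 q) of the true ones, where c = min 1 c_min and lam = lambda_min, then on
  every principal submatrix of size at most q the inverses differ by at most c / 4, so that
  comparing with gamma = c / 4 tells the zero partial correlations from the others.  Only such
  submatrices matter: when the queries with at most deg(G) conditioning nodes are answered
  correctly, PC asks no others, because the parents of a node separate it from its nonadjacent
  nondescendants.  A union bound over pairs makes the error probability at most
  p^2 A exp(- B n eps^2), and n eps^2 grows at least like n^(1 - 2b - 2d - 4f).

  The CPDAG: every edge that the orientation rules leave undirected occurs in both directions in
  the Markov equivalence class.  The chain components are chordal, so by a perfect elimination
  order ending in a prescribed edge they can be reoriented without new v-structures or cycles, and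
  DAGs with the same skeleton and v-structures are connected by reversals of covered edges, which
  do not change d-separation.

  Conditional independence of X_u and X_v given X_S in a Gaussian vector is compared with the
  (u, v) entry of the precision matrix by integrating out the coordinates one at a time, each of
  which replaces the precision matrix by a Schur complement.
*)

theory Submission
  imports Defs "Jordan_Normal_Form.Spectral_Radius" "HOL-Real_Asymp.Real_Asymp"
begin

text \<open>An undirected edge of the output is correct only if both of its directions occur in the
  class, so soundness of the orientation rules is not enough. On the statistical side everything is
  governed by least eigenvalues: the columns of a true inverse have norm at most 1 / lam, those of
  an estimated one at most 2 / lam, and an entrywise error eps on q nodes moves the inverse by at
  most 2 q eps / lam^2, which is c / 4 for the chosen eps. Unit diagonals keep the diagonal entries
  of both inverses at least 1, so that normalising a small off-diagonal entry cannot make it larger.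
  Two obstacles come from measure theory. Conditional independence is defined by conditional
  expectations; these are identified by integrating against functions of the conditioning
  coordinates. And \<open>measure\<close> gives 0 to a nonmeasurable set, so a lower bound for the
  success probability needs a measurable success event, whatever choices the procedure makes; the
  way out is that the output depends on finitely many yes-no answers.\<close>

lemma acyclic_edgeD:
  assumes "acyclic E" "(a, b) \<in> E" shows "(b, a) \<notin> E" "a \<noteq> b" "(b, a) \<notin> E\<^sup>*"
  using assms unfolding acyclic_def
  by (meson r_into_trancl trancl_into_trancl, meson r_into_trancl, meson rtrancl_into_trancl2)

section \<open>Walks and covered edge reversals\<close>

text \<open>
  Unlike a path, a walk may repeat nodes.  This allows one to ask that the colliders lie in \<open>S\<close>
  itself, not merely have a descendant there, so that activity becomes a local condition.  The
  Boolean tells whether the last edge of the walk points into its end node.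
\<close>

inductive active_reach :: "(nat \<times> nat) set \<Rightarrow> nat set \<Rightarrow> nat \<Rightarrow> nat \<Rightarrow> bool \<Rightarrow> bool"
  for E S u where
  start: "active_reach E S u u False"
| forward: "active_reach E S u y h \<Longrightarrow> y \<notin> S \<Longrightarrow> (y, z) \<in> E \<Longrightarrow> active_reach E S u z True"
| backward: "active_reach E S u y False \<Longrightarrow> y \<notin> S \<Longrightarrow> (z, y) \<in> E \<Longrightarrow> active_reach E S u z False"
| bounce: "active_reach E S u y True \<Longrightarrow> y \<in> S \<Longrightarrow> (z, y) \<in> E \<Longrightarrow> active_reach E S u z False"

definition covered_edge :: "(nat \<times> nat) set \<Rightarrow> nat \<Rightarrow> nat \<Rightarrow> bool" where
  "covered_edge E x y \<longleftrightarrow> (x, y) \<in> E \<and> (\<forall>w. (w, y) \<in> E \<longleftrightarrow> (w, x) \<in> E \<or> w = x)"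

definition reverse_edge :: "(nat \<times> nat) set \<Rightarrow> nat \<Rightarrow> nat \<Rightarrow> (nat \<times> nat) set" where
  "reverse_edge E x y = insert (y, x) (E - {(x, y)})"

text \<open>Up to \<open>x\<close> itself both ends of a covered edge have the same parents, so a
  walk that uses a parent of one end can use it at the other end as well; this gets round what the
  reversal would block. The last edge may then have another direction, hence the existential
  \<open>h'\<close>.\<close>

lemma active_reach_reverse_covered:
  assumes cov: "covered_edge E x y" and ac: "acyclic E" and r: "active_reach E S u v h"
  shows "\<exists>h'. active_reach (reverse_edge E x y) S u v h'"
proof -
  define R where "R = active_reach (reverse_edge E x y) S u"
  have xy: "(x, y) \<in> E" and nyx: "(y, x) \<notin> E" and irr: "\<And>w. (w, w) \<notin> E" and neq: "x \<noteq> y"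
    using cov acyclic_edgeD[OF ac] unfolding covered_edge_def by metis+
  have par: "\<And>w. (w, y) \<in> E \<longleftrightarrow> (w, x) \<in> E \<or> w = x" using cov unfolding covered_edge_def by blast
  have Rs: "R u False" unfolding R_def by (rule active_reach.start)
  have Rf: "R z True" if "R w h" "w \<notin> S" "(w, z) \<in> E" "(w, z) \<noteq> (x, y)" for w z h
    using that unfolding R_def reverse_edge_def by (blast intro: active_reach.forward)
  have Rb: "R z False" if "R w False" "w \<notin> S" "(z, w) \<in> E" "(z, w) \<noteq> (x, y)" for w z
    using that unfolding R_def reverse_edge_def by (blast intro: active_reach.backward)
  have Rc: "R z False" if "R w True" "w \<in> S" "(z, w) \<in> E" "(z, w) \<noteq> (x, y)" for w z
    using that unfolding R_def reverse_edge_def by (blast intro: active_reach.bounce)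
  have Rfx: "R x True" if "R y h" "y \<notin> S" for h
    using that unfolding R_def reverse_edge_def by (blast intro: active_reach.forward)
  have Rby: "R y False" if "R x False" "x \<notin> S"
    using that unfolding R_def reverse_edge_def by (blast intro: active_reach.backward)
  have Rcy: "R y False" if "R x True" "x \<in> S"
    using that unfolding R_def reverse_edge_def by (blast intro: active_reach.bounce)
  \<comment> \<open>\<open>I z h\<close> lists the ways in which a walk that reaches \<open>(z, h)\<close> can be imitated after the reversal.\<close>
  define I where "I z h \<longleftrightarrow>
    (if z = x then if h then R x True \<and> R y True
       else R x False \<or> R x True \<and> R y False \<and> y \<notin> S \<or> R x True \<and> R y True \<and> y \<in> S
     else if z = y then if h then R x True \<and> R y True \<or> R y False \<and> R x False \<and> x \<notin> S \<or> R y False \<and> y \<notin> S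
       else R y False
     else R z h)" for z h
  have Iout: "\<exists>h'. R z h'" if "I z h" for z h
    using that unfolding I_def by (auto split: if_splits)
  have "I v h" using r
  proof (induction rule: active_reach.induct)
    case start
    then show ?case using Rs unfolding I_def by auto
  next
    case (forward w h z)
    obtain h' where h': "R w h'" using Iout forward.IH by blast
    consider "z = x" | "z = y" "w = x" | "z = y" "w \<noteq> x" | "z \<noteq> x" "z \<noteq> y" by blast
    then show ?case
    proof cases
      case 1
      then have "R x True" "R y True" using Rf[OF h'] forward.hyps par neq irr nyx by auto
      then show ?thesis using 1 unfolding I_def by simp
    next
      case 2
      then show ?thesis using forward Rby neq unfolding I_def by (auto split: if_splits)
    next
      case 3
      then have "R x True" "R y True" using Rf[OF h'] forward.hyps par neq irr nyx by auto
      then show ?thesis using 3 neq unfolding I_def by simp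
    next
      case 4
      then show ?thesis using Rf[OF h'] forward.hyps unfolding I_def by auto
    qed
  next
    case (backward w z)
    consider "w = x" | "w = y" "z = x" | "w = y" "z \<noteq> x" | "w \<noteq> x" "w \<noteq> y" by blast
    then show ?case
    proof cases
      case 1
      then have zw: "(z, x) \<in> E" "(z, y) \<in> E" "z \<noteq> x" "z \<noteq> y" using backward.hyps par irr nyx by auto
      have "R z False"
        using backward.IH 1 zw Rb[of x z] Rb[of y z] Rc[of y z] backward.hyps unfolding I_def by auto
      then show ?thesis using zw unfolding I_def by simp
    next
      case 2
      then show ?thesis using backward Rfx neq unfolding I_def by (auto split: if_splits)
    next
      case 3
      then show ?thesis using backward Rb[of y z] neq irr unfolding I_def by (auto split: if_splits)
    next
      case 4
      then have "R z False" using backward Rb[of w z] unfolding I_def by auto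
      then show ?thesis unfolding I_def by auto
    qed
  next
    case (bounce w z)
    consider "w = x" | "w = y" "z = x" | "w = y" "z \<noteq> x" | "w \<noteq> x" "w \<noteq> y" by blast
    then show ?case
    proof cases
      case 1
      then have zw: "(z, x) \<in> E" "(z, y) \<in> E" "z \<noteq> x" "z \<noteq> y" using bounce.hyps par irr nyx by auto
      have "R z False"
        using bounce.IH 1 zw Rc[of x z] bounce.hyps unfolding I_def by auto
      then show ?thesis using zw unfolding I_def by simp
    next
      case 2
      then show ?thesis using bounce neq unfolding I_def by (auto split: if_splits)
    next
      case 3
      then have zw: "(z, x) \<in> E" "(z, y) \<in> E" "z \<noteq> x" "z \<noteq> y" using bounce.hyps par irr nyx by auto
      have "R z False"
        using bounce.IH 3 zw Rc[of y z] Rb[of x z] bounce.hyps neq unfolding I_def by auto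
      then show ?thesis using zw unfolding I_def by simp
    next
      case 4
      then have "R z False" using bounce Rc[of w z] unfolding I_def by auto
      then show ?thesis unfolding I_def by auto
    qed
  qed
  then show ?thesis using Iout unfolding R_def by blast
qed

section \<open>Active walks against unblocked paths\<close>

text \<open>The negation of d-separation, with the end node left free so that paths can be extended
  and cut in an induction.\<close>

definition active_path :: "(nat \<times> nat) set \<Rightarrow> nat set \<Rightarrow> nat \<Rightarrow> nat list \<Rightarrow> bool" where
  "active_path E S u xs \<longleftrightarrow> xs \<noteq> [] \<and> hd xs = u \<and> distinct xs \<and>
     (\<forall>k. Suc k < length xs \<longrightarrow> (xs ! k, xs ! Suc k) \<in> E \<or> (xs ! Suc k, xs ! k) \<in> E) \<and>
     (\<forall>k. k + 2 < length xs \<longrightarrow> \<not> blocking_triple E S (xs ! k) (xs ! (k + 1)) (xs ! (k + 2)))"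

lemma not_d_separated_iff_active_path:
  "\<not> d_separated E u v S \<longleftrightarrow> (\<exists>xs. active_path E S u xs \<and> last xs = v)"
  unfolding d_separated_def active_path_def graph_path_def by blast

definition ends_with_head :: "(nat \<times> nat) set \<Rightarrow> nat list \<Rightarrow> bool" where
  "ends_with_head E xs \<longleftrightarrow> 2 \<le> length xs \<and> (xs ! (length xs - 2), last xs) \<in> E"

definition has_descendant_in :: "(nat \<times> nat) set \<Rightarrow> nat set \<Rightarrow> nat \<Rightarrow> bool" where
  "has_descendant_in E S z \<longleftrightarrow> (\<exists>w\<in>S. (z, w) \<in> E\<^sup>*)"

text \<open>The walk descends to the first node in \<open>S\<close>, bounces there and climbs back
  to \<open>y\<close>, now against the arrows. This excursion replaces the descendant clause for
  colliders on paths.\<close>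

lemma active_reach_turn:
  assumes "(y, w) \<in> E\<^sup>*" "w \<in> S" "active_reach E S u y True" "y \<notin> S"
  shows "active_reach E S u y False"
  using assms
proof (induction rule: converse_rtrancl_induct)
  case base
  then show ?case by blast
next
  case (step y z)
  have z: "active_reach E S u z True" using step.prems step.hyps by (blast intro: active_reach.forward)
  show ?case
  proof (cases "z \<in> S")
    case True
    then show ?thesis using z step.hyps by (blast intro: active_reach.bounce)
  next
    case False
    then show ?thesis using z step by (blast intro: active_reach.backward)
  qed
qed

text \<open>Induction along the path, the Boolean being the direction of its last edge. Chains and
  forks are single steps of the walk; a collider outside \<open>S\<close> is passed by the excursion
  of \<open>active_reach_turn\<close>.\<close>

lemma active_path_imp_reach:
  assumes ac: "acyclic E" and p: "active_path E S u xs" and u: "u \<notin> S"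
  shows "\<exists>h. active_reach E S u (last xs) h"
proof -
  have anti: "\<And>a b. (a, b) \<in> E \<Longrightarrow> (b, a) \<notin> E"
    using acyclic_edgeD[OF ac] by metis
  have ne: "xs \<noteq> []" and x0: "xs ! 0 = u" using p unfolding active_path_def by (auto simp: hd_conv_nth)
  have edge: "\<And>k. Suc k < length xs \<Longrightarrow> (xs ! k, xs ! Suc k) \<in> E \<or> (xs ! Suc k, xs ! k) \<in> E"
    and nb: "\<And>k. Suc (Suc k) < length xs \<Longrightarrow> \<not> blocking_triple E S (xs ! k) (xs ! Suc k) (xs ! Suc (Suc k))"
    using p unfolding active_path_def by auto
  have st: "active_reach E S u (xs ! Suc k) ((xs ! k, xs ! Suc k) \<in> E)" if "Suc k < length xs" for k
    using that
  proof (induction k)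
    case 0
    show ?case
    proof (cases "(xs ! 0, xs ! Suc 0) \<in> E")
      case True
      then show ?thesis using x0 u active_reach.forward[OF active_reach.start] by auto
    next
      case False
      then show ?thesis using edge[of 0] 0 x0 u active_reach.backward[OF active_reach.start] by auto
    qed
  next
    case (Suc k)
    define x y z where "x = xs ! k" and "y = xs ! Suc k" and "z = xs ! Suc (Suc k)"
    have IH: "active_reach E S u y ((x, y) \<in> E)" using Suc x_def y_def by auto
    have nb': "\<not> blocking_triple E S x y z" using nb Suc.prems x_def y_def z_def by auto
    have e1: "(x, y) \<in> E \<or> (y, x) \<in> E" and e2: "(y, z) \<in> E \<or> (z, y) \<in> E"
      using edge[of k] edge[of "Suc k"] Suc.prems x_def y_def z_def by auto
    show ?case unfolding y_def[symmetric] z_def[symmetric]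
    proof (cases "(y, z) \<in> E")
      case True
      then have "y \<notin> S" using nb' e1 unfolding blocking_triple_def by blast
      then show "active_reach E S u z ((y, z) \<in> E)" using True active_reach.forward[OF IH] by simp
    next
      case False
      then have zy: "(z, y) \<in> E" using e2 by blast
      have "active_reach E S u z False"
      proof (cases "(x, y) \<in> E")
        case True
        then obtain w where w: "(y, w) \<in> E\<^sup>*" "w \<in> S" using nb' zy unfolding blocking_triple_def by blast
        have t: "active_reach E S u y True" using IH True by simp
        show ?thesis
        proof (cases "y \<in> S")
          case True
          then show ?thesis using t zy by (blast intro: active_reach.bounce)
        next
          case False
          then show ?thesis using active_reach_turn[OF w t False] zy by (blast intro: active_reach.backward)
        qed
      next
        case False
        then have "(y, x) \<in> E" using e1 by blast
        then have "y \<notin> S" using nb' zy unfolding blocking_triple_def by blast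
        then show ?thesis using IH False zy by (auto intro: active_reach.backward)
      qed
      then show "active_reach E S u z ((y, z) \<in> E)" using False by simp
    qed
  qed
  show ?thesis
  proof (cases "length xs = 1")
    case True
    then show ?thesis using x0 active_reach.start by (metis One_nat_def diff_Suc_1 last_conv_nth ne)
  next
    case False
    then have "Suc (length xs - 2) < length xs" "Suc (length xs - 2) = length xs - 1"
      using ne by (cases xs; cases "tl xs"; simp)+
    then show ?thesis using st[of "length xs - 2"] ne by (metis last_conv_nth)
  qed
qed

text \<open>The cases of \<open>e\<close> are those in which \<open>y\<close> does not become the
  middle of a blocking triple. A one-node path has no head and is treated under
  \<open>\<not> ends_with_head\<close>.\<close>

lemma active_path_append:
  assumes ac: "acyclic E" and p: "active_path E S u xs" and y: "last xs = y" and z: "z \<notin> set xs"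
    and e: "(y, z) \<in> E \<and> (z, y) \<notin> E \<and> y \<notin> S \<or>
       (z, y) \<in> E \<and> (y, z) \<notin> E \<and>
         (ends_with_head E xs \<and> has_descendant_in E S y \<or> \<not> ends_with_head E xs \<and> y \<notin> S)"
  shows "active_path E S u (xs @ [z])" "ends_with_head E (xs @ [z]) \<longleftrightarrow> (y, z) \<in> E"
proof -
  have ne: "xs \<noteq> []" using p unfolding active_path_def by auto
  then have l: "last xs = xs ! (length xs - 1)" by (simp add: last_conv_nth)
  show "ends_with_head E (xs @ [z]) \<longleftrightarrow> (y, z) \<in> E"
    using ne y l unfolding ends_with_head_def by (auto simp: nth_append Suc_le_eq)
  have edge: "((xs @ [z]) ! k, (xs @ [z]) ! Suc k) \<in> E \<or> ((xs @ [z]) ! Suc k, (xs @ [z]) ! k) \<in> E"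
    if "Suc k < length (xs @ [z])" for k
  proof (cases "Suc k = length xs")
    case True
    then have "xs ! k = y" using l y by (metis diff_Suc_1)
    then show ?thesis using True e by (auto simp: nth_append)
  next
    case False
    then show ?thesis using p that unfolding active_path_def by (auto simp: nth_append)
  qed
  have nb: "\<not> blocking_triple E S ((xs @ [z]) ! k) ((xs @ [z]) ! (k + 1)) ((xs @ [z]) ! (k + 2))"
    if "k + 2 < length (xs @ [z])" for k
  proof (cases "k + 2 = length xs")
    case True
    have lx: "length xs - 1 = Suc k" "length xs - 2 = k" using True by simp_all
    then have k1: "xs ! Suc k = y" "length xs - 2 = k" using l y by simp_all
    have h: "ends_with_head E xs \<longleftrightarrow> (xs ! k, y) \<in> E"
      using True k1 y unfolding ends_with_head_def by auto
    have anti: "(xs ! k, y) \<in> E \<Longrightarrow> (y, xs ! k) \<notin> E" using acyclic_edgeD[OF ac] by metis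
    have "\<not> blocking_triple E S (xs ! k) y z"
      using e h anti unfolding blocking_triple_def has_descendant_in_def by blast
    then show ?thesis using True k1 by (auto simp: nth_append)
  next
    case False
    then have "k + 2 < length xs" using that by auto
    then show ?thesis using p unfolding active_path_def by (auto simp: nth_append)
  qed
  show "active_path E S u (xs @ [z])"
    using p z ne edge nb unfolding active_path_def by auto
qed

lemma active_path_take:
  assumes p: "active_path E S u xs" and i: "i < length xs"
  shows "active_path E S u (take (Suc i) xs)" "last (take (Suc i) xs) = xs ! i"
    "ends_with_head E (take (Suc i) xs) \<longleftrightarrow> 0 < i \<and> (xs ! (i - 1), xs ! i) \<in> E"
proof -
  show "active_path E S u (take (Suc i) xs)" using p i unfolding active_path_def by auto
  show l: "last (take (Suc i) xs) = xs ! i" using i by (simp add: take_Suc_conv_app_nth)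
  show "ends_with_head E (take (Suc i) xs) \<longleftrightarrow> 0 < i \<and> (xs ! (i - 1), xs ! i) \<in> E"
    unfolding ends_with_head_def l using i by (cases i) (auto simp: min_def le_Suc_eq)
qed

lemma active_path_edge:
  assumes "active_path E S u xs" "Suc k < length xs"
  shows "(xs ! k, xs ! Suc k) \<in> E \<or> (xs ! Suc k, xs ! k) \<in> E"
  using assms unfolding active_path_def by blast

lemma active_path_triple:
  assumes p: "active_path E S u xs" and i: "0 < i" "Suc i < length xs"
  shows "\<not> blocking_triple E S (xs ! (i - 1)) (xs ! i) (xs ! Suc i)"
proof -
  obtain k where k: "i = Suc k" using i(1) gr0_conv_Suc by auto
  then show ?thesis using p i(2) unfolding active_path_def by simp
qed

text \<open>From a node entered by an arrow the path either runs downwards to its end or first meets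
  a collider. That collider is not blocked, and its descendant in \<open>S\<close> is also one of
  \<open>xs ! i\<close>.\<close>

lemma active_path_descend:
  assumes p: "active_path E S u xs" and i: "0 < i" "Suc i < length xs"
    and "(xs ! (i - 1), xs ! i) \<in> E"
  shows "has_descendant_in E S (xs ! i) \<or> ends_with_head E xs"
  using assms(2-4)
proof (induction "length xs - i" arbitrary: i rule: less_induct)
  case less
  have nb: "\<not> blocking_triple E S (xs ! (i - 1)) (xs ! i) (xs ! Suc i)"
    using active_path_triple[OF p less.prems(1,2)] .
  have edge: "(xs ! i, xs ! Suc i) \<in> E \<or> (xs ! Suc i, xs ! i) \<in> E"
    using p less.prems unfolding active_path_def by blast
  show ?case
  proof (cases "(xs ! Suc i, xs ! i) \<in> E")
    case True
    then show ?thesis using nb less.prems unfolding blocking_triple_def has_descendant_in_def by blast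
  next
    case False
    then have f: "(xs ! i, xs ! Suc i) \<in> E" using edge by blast
    show ?thesis
    proof (cases "Suc (Suc i) < length xs")
      case True
      then have "has_descendant_in E S (xs ! Suc i) \<or> ends_with_head E xs"
        using less.hyps[of "Suc i"] f by auto
      then show ?thesis using f unfolding has_descendant_in_def
        by (meson converse_rtrancl_into_rtrancl)
    next
      case False
      then have L: "length xs = Suc (Suc i)" using less.prems by auto
      then have "last xs = xs ! Suc i" by (metis diff_Suc_1 last_conv_nth length_0_conv nat.distinct(1))
      then show ?thesis using f L unfolding ends_with_head_def by auto
    qed
  qed
qed

text \<open>
  A path is cut back when the walk returns to one of its nodes, which may change the direction in
  which the node is entered; the last two conjuncts say that the walk can be followed nevertheless.
\<close>

lemma reach_imp_active_path:
  assumes ac: "acyclic E" and r: "active_reach E S u v h" and u: "u \<notin> S"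
  shows "\<exists>xs. active_path E S u xs \<and> last xs = v \<and> (h \<and> v \<in> S \<longrightarrow> ends_with_head E xs) \<and>
     (\<not> h \<longrightarrow> \<not> ends_with_head E xs \<or> has_descendant_in E S v)"
  using r
proof (induction rule: active_reach.induct)
  case start
  have "active_path E S u [u]" unfolding active_path_def by auto
  then show ?case using u unfolding ends_with_head_def by (intro exI[of _ "[u]"]) auto
next
  case (forward y h z)
  have irr: "y \<noteq> z" "(z, y) \<notin> E" using acyclic_edgeD[OF ac] forward.hyps by metis+
  obtain xs where xs: "active_path E S u xs" "last xs = y" using forward.IH by blast
  show ?case
  proof (cases "z \<in> set xs")
    case False
    show ?thesis
      using active_path_append[OF ac xs False] irr forward.hyps by (intro exI[of _ "xs @ [z]"]) auto
  next
    case True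
    then obtain i where i: "i < length xs" "xs ! i = z" by (auto simp: in_set_conv_nth)
    have ne: "xs \<noteq> []" using i by auto
    have il: "Suc i < length xs"
    proof (rule ccontr)
      assume "\<not> Suc i < length xs"
      then have "i = length xs - 1" using i by simp
      then show False using xs i irr ne by (simp add: last_conv_nth)
    qed
    \<comment> \<open>An interior node of an active path that lies in \<open>S\<close> must be a
      collider, so the cut path still enters \<open>z\<close> by a head.\<close>
    have m: "0 < i \<and> (xs ! (i - 1), xs ! i) \<in> E" if "z \<in> S"
    proof -
      have i0: "0 < i" using that u i xs(1) unfolding active_path_def
        by (metis gr0I hd_conv_nth)
      have "\<not> blocking_triple E S (xs ! (i - 1)) (xs ! i) (xs ! Suc i)"
        using active_path_triple[OF xs(1) i0 il] .
      moreover have "(xs ! i, xs ! Suc i) \<in> E \<or> (xs ! Suc i, xs ! i) \<in> E"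
        "(xs ! (i - 1), xs ! i) \<in> E \<or> (xs ! i, xs ! (i - 1)) \<in> E"
        using active_path_edge[OF xs(1), of i] active_path_edge[OF xs(1), of "i - 1"] il i0 by auto
      ultimately show ?thesis using i0 i that unfolding blocking_triple_def by blast
    qed
    show ?thesis using active_path_take[OF xs(1) i(1)] i m
      by (intro exI[of _ "take (Suc i) xs"]) auto
  qed
next
  case (backward y z)
  have irr: "y \<noteq> z" "(y, z) \<notin> E" using acyclic_edgeD[OF ac] backward.hyps by metis+
  obtain xs where xs: "active_path E S u xs" "last xs = y"
    "\<not> ends_with_head E xs \<or> has_descendant_in E S y" using backward.IH by blast
  show ?case
  proof (cases "z \<in> set xs")
    case False
    show ?thesis
      using active_path_append[OF ac xs(1,2) False] xs(3) irr backward.hyps by (intro exI[of _ "xs @ [z]"]) auto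
  next
    case True
    then obtain i where i: "i < length xs" "xs ! i = z" by (auto simp: in_set_conv_nth)
    have ne: "xs \<noteq> []" using i by auto
    have il: "Suc i < length xs"
    proof (rule ccontr)
      assume "\<not> Suc i < length xs"
      then have "i = length xs - 1" using i by simp
      then show False using xs i irr ne by (simp add: last_conv_nth)
    qed
    \<comment> \<open>If \<open>z\<close> is entered by a head, then either an active collider lies
      below it on the old path, or that path ends with a head at \<open>y\<close> and the descendant
      of \<open>y\<close> in \<open>S\<close> is inherited through \<open>(z, y)\<close>.\<close>
    have "has_descendant_in E S z" if "0 < i" "(xs ! (i - 1), xs ! i) \<in> E"
      using active_path_descend[OF xs(1) that(1) il that(2)] xs(3) backward.hyps i(2)
      unfolding has_descendant_in_def by (meson converse_rtrancl_into_rtrancl)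
    then show ?thesis using active_path_take[OF xs(1) i(1)] i
      by (intro exI[of _ "take (Suc i) xs"]) auto
  qed
next
  case (bounce y z)
  have irr: "y \<noteq> z" "(y, z) \<notin> E" using acyclic_edgeD[OF ac] bounce.hyps by metis+
  have dz: "has_descendant_in E S z" "has_descendant_in E S y" using bounce.hyps unfolding has_descendant_in_def by blast+
  obtain xs where xs: "active_path E S u xs" "last xs = y" "ends_with_head E xs"
    using bounce by blast
  show ?case
  proof (cases "z \<in> set xs")
    case False
    show ?thesis
      using active_path_append[OF ac xs(1,2) False] xs(3) dz irr bounce.hyps by (intro exI[of _ "xs @ [z]"]) auto
  next
    case True
    then obtain i where i: "i < length xs" "xs ! i = z" by (auto simp: in_set_conv_nth)
    then show ?thesis using active_path_take[OF xs(1) i(1)] i dz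
      by (intro exI[of _ "take (Suc i) xs"]) auto
  qed
qed

lemma d_separated_iff_reach:
  assumes "acyclic E" "u \<notin> S"
  shows "d_separated E u v S \<longleftrightarrow> (\<forall>h. \<not> active_reach E S u v h)"
  using active_path_imp_reach[OF assms(1) _ assms(2)] reach_imp_active_path[OF assms(1) _ assms(2)]
    not_d_separated_iff_active_path by metis

section \<open>Markov equivalence\<close>

definition skeleton :: "(nat \<times> nat) set \<Rightarrow> (nat \<times> nat) set" where
  "skeleton E = E \<union> E\<inverse>"

definition v_structure :: "(nat \<times> nat) set \<Rightarrow> nat \<Rightarrow> nat \<Rightarrow> nat \<Rightarrow> bool" where
  "v_structure E x y z \<longleftrightarrow> (x, y) \<in> E \<and> (z, y) \<in> E \<and> x \<noteq> z \<and> (x, z) \<notin> skeleton E"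

text \<open>The criterion of Verma and Pearl for Markov equivalence of DAGs.\<close>

definition same_pattern :: "(nat \<times> nat) set \<Rightarrow> (nat \<times> nat) set \<Rightarrow> bool" where
  "same_pattern E H \<longleftrightarrow> skeleton E = skeleton H \<and> v_structure E = v_structure H"

lemma skeleton_iff: "(x, y) \<in> skeleton E \<longleftrightarrow> (x, y) \<in> E \<or> (y, x) \<in> E"
  unfolding skeleton_def by auto

text \<open>A cycle through \<open>(y, x)\<close> would contain a path from \<open>x\<close> to
  another parent of \<open>y\<close>, which is a parent of \<open>x\<close> too. Neither the old nor
  the new edge lies in a v-structure, since every other parent of its head is adjacent to its
  tail.\<close>

lemma covered_edge_reverse:
  assumes cov: "covered_edge E x y" and ac: "acyclic E"
  shows "acyclic (reverse_edge E x y)" "covered_edge (reverse_edge E x y) y x"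
    "reverse_edge (reverse_edge E x y) y x = E" "same_pattern E (reverse_edge E x y)"
proof -
  define F where "F = E - {(x, y)}"
  define E' where "E' = reverse_edge E x y"
  have E': "E' = insert (y, x) F" unfolding E'_def F_def reverse_edge_def by simp
  have xy: "(x, y) \<in> E" and par: "\<And>w. (w, y) \<in> E \<longleftrightarrow> (w, x) \<in> E \<or> w = x"
    using cov unfolding covered_edge_def by blast+
  have neq: "x \<noteq> y" and nyx: "(y, x) \<notin> E" and irr: "\<And>w. (w, w) \<notin> E"
    using acyclic_edgeD[OF ac] xy by metis+
  have "(x, y) \<notin> F\<^sup>*"
  proof
    assume "(x, y) \<in> F\<^sup>*"
    then obtain w where w: "(x, w) \<in> F\<^sup>*" "(w, y) \<in> F" using neq by (meson rtranclE)
    then have "w \<noteq> x" "(w, x) \<in> E" using par unfolding F_def by auto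
    moreover have "(x, w) \<in> E\<^sup>*" using w(1) rtrancl_mono[of F E] unfolding F_def by blast
    ultimately show False using acyclic_edgeD(3)[OF ac] by blast
  qed
  then have "acyclic E'"
    using ac acyclic_subset[of E F] unfolding E' F_def by (auto simp: acyclic_insert)
  then show "acyclic (reverse_edge E x y)" unfolding E'_def .
  show "covered_edge (reverse_edge E x y) y x"
    using par nyx neq irr unfolding covered_edge_def reverse_edge_def by auto
  show "reverse_edge (reverse_edge E x y) y x = E"
    using xy nyx unfolding reverse_edge_def by auto
  have sk: "skeleton E' = skeleton E" unfolding skeleton_def E' F_def using xy by auto
  have "v_structure E a b c \<longleftrightarrow> v_structure E' a b c" for a b c
  proof
    assume v: "v_structure E a b c"
    have "(a, b) \<noteq> (x, y)" "(c, b) \<noteq> (x, y)"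
      using v par unfolding v_structure_def skeleton_iff by blast+
    then have "(a, b) \<in> E'" "(c, b) \<in> E'" using v unfolding v_structure_def E' F_def by blast+
    then show "v_structure E' a b c" using v sk unfolding v_structure_def by simp
  next
    assume v: "v_structure E' a b c"
    have nadj: "(a, c) \<notin> E" "(c, a) \<notin> E" "a \<noteq> c"
      using v unfolding v_structure_def sk skeleton_iff by auto
    have e: "(a, b) \<in> insert (y, x) E" "(c, b) \<in> insert (y, x) E"
      using v unfolding v_structure_def E' F_def by blast+
    have "(a, b) \<noteq> (y, x)" "(c, b) \<noteq> (y, x)" using e nadj par by auto
    then show "v_structure E a b c" using e nadj unfolding v_structure_def skeleton_iff by blast
  qed
  then show "same_pattern E (reverse_edge E x y)" using sk unfolding same_pattern_def E'_def by blast
qed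

text \<open>The new edge is covered again and its reversal gives \<open>E\<close> back, so the
  transfer of walks in one direction yields both.\<close>

lemma d_separated_reverse_covered:
  assumes cov: "covered_edge E x y" and ac: "acyclic E" and u: "u \<notin> S"
  shows "d_separated (reverse_edge E x y) u v S \<longleftrightarrow> d_separated E u v S"
  unfolding d_separated_iff_reach[OF ac u] d_separated_iff_reach[OF covered_edge_reverse(1)[OF cov ac] u]
  using active_reach_reverse_covered[OF cov ac, of S u v]
    active_reach_reverse_covered[OF covered_edge_reverse(2)[OF cov ac] covered_edge_reverse(1)[OF cov ac], of S u v]
  unfolding covered_edge_reverse(3)[OF cov ac] by blast

text \<open>
  Chickering's choice: \<open>y\<close> is a first node into which some edge has to be reversed, and \<open>x\<close> is a
  last one among the tails of these edges.
\<close>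

lemma exists_reversible_edge:
  assumes fin: "finite E" and ac: "acyclic E" and acH: "acyclic H"
    and sp: "same_pattern E H" and ne: "\<not> E \<subseteq> H"
  shows "\<exists>x y. (x, y) \<in> E - H \<and> covered_edge E x y"
proof -
  have sk: "\<And>a b. (a, b) \<in> E \<or> (b, a) \<in> E \<longleftrightarrow> (a, b) \<in> H \<or> (b, a) \<in> H"
    using sp unfolding same_pattern_def skeleton_def by blast
  have vs: "v_structure E = v_structure H" "skeleton E = skeleton H" using sp unfolding same_pattern_def by auto
  have wf: "wf E" and wf': "wf (E\<inverse>)"
    using fin ac by (auto intro: finite_acyclic_wf finite_acyclic_wf_converse)
  obtain y where y: "\<exists>x. (x, y) \<in> E - H" "\<And>z. (z, y) \<in> E \<Longrightarrow> \<nexists>x. (x, z) \<in> E - H"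
    using ne wfE_min[OF wf, of _ "{y. \<exists>x. (x, y) \<in> E - H}"] by (auto 4 4)
  obtain x where x: "(x, y) \<in> E - H" "\<And>z. (x, z) \<in> E \<Longrightarrow> (z, y) \<notin> E - H"
    using y(1) wfE_min[OF wf', of _ "{x. (x, y) \<in> E - H}"] by (auto 4 4)
  have yxH: "(y, x) \<in> H" using sk x(1) by blast
  have trH: "(a, c) \<in> H\<^sup>*" if "(a, b) \<in> H" "(b, c) \<in> H" for a b c
    using that by auto
  have keep: "(w, z) \<in> H" if "(w, z) \<in> E" "(z, y) \<in> E" for w z using y(2) that by blast
  have irr: "\<And>w. (w, w) \<notin> E" using acyclic_edgeD[OF ac] by metis
  \<comment> \<open>Otherwise \<open>w \<rightarrow> x \<leftarrow> y\<close> would be a v-structure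
    of \<open>H\<close> that \<open>E\<close> does not have.\<close>
  have "(w, y) \<in> E" if w: "(w, x) \<in> E" for w
  proof (rule ccontr)
    assume n: "(w, y) \<notin> E"
    have "(x, y) \<in> E" using x(1) by blast
    then have "(y, w) \<notin> E"
      using acyclic_edgeD(3)[OF ac w] rtrancl_into_rtrancl[OF r_into_rtrancl, of x y E w] by blast
    then have "(w, y) \<notin> skeleton H" using n sk skeleton_iff by metis
    moreover have "w \<noteq> y" using w acyclic_edgeD(1)[OF ac] x(1) by blast
    moreover have "(w, x) \<in> H" using keep[OF w] x(1) by blast
    ultimately have "v_structure H w x y" using yxH unfolding v_structure_def by blast
    then have "v_structure E w x y" using vs by simp
    then have "(y, x) \<in> E" unfolding v_structure_def by blast
    then show False using acyclic_edgeD(1)[OF ac, of y x] x(1) by blast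
  qed
  \<comment> \<open>If \<open>w\<close> and \<open>x\<close> are nonadjacent, \<open>H\<close> lacks
    the v-structure \<open>w \<rightarrow> y \<leftarrow> x\<close> of \<open>E\<close>. If
    \<open>x \<rightarrow> w\<close>, the choice of \<open>y\<close> and of \<open>x\<close> puts
    \<open>x \<rightarrow> w \<rightarrow> y\<close> into \<open>H\<close>, where
    \<open>y \<rightarrow> x\<close> closes a cycle.\<close>
  moreover have "(w, x) \<in> E" if w: "(w, y) \<in> E" "w \<noteq> x" for w
  proof (rule ccontr)
    assume n: "(w, x) \<notin> E"
    show False
    proof (cases "(x, w) \<in> E")
      case True
      then have "(x, w) \<in> H" using keep w by blast
      moreover have "(w, y) \<in> H" using x(2)[OF True] w by blast
      ultimately show False using trH acyclic_edgeD(3)[OF acH yxH] by blast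
    next
      case False
      then have "v_structure E w y x" using n w x(1) unfolding v_structure_def skeleton_iff by blast
      then have "v_structure H w y x" using vs by simp
      then have "(x, y) \<in> H" unfolding v_structure_def by blast
      then show False using x(1) by blast
    qed
  qed
  ultimately have "covered_edge E x y" using x(1) unfolding covered_edge_def by blast
  then show ?thesis using x(1) by blast
qed

text \<open>Every reversal turns an edge to the direction it has in \<open>H\<close> and so lowers
  \<open>card (E - H)\<close>. Once \<open>E \<subseteq> H\<close>, equal skeletons and acyclicity
  give equality.\<close>

lemma same_pattern_d_separated:
  assumes "finite E" "acyclic E" "acyclic H" "same_pattern E H" "u \<notin> S"
  shows "d_separated E u v S \<longleftrightarrow> d_separated H u v S"
  using assms(1,2,4)
proof (induction "card (E - H)" arbitrary: E rule: less_induct)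
  case less
  show ?case
  proof (cases "E \<subseteq> H")
    case True
    have "H \<subseteq> E"
    proof
      fix e assume "e \<in> H"
      then obtain a b where e: "e = (a, b)" "(a, b) \<in> H" by (cases e) auto
      then have "(a, b) \<in> E \<or> (b, a) \<in> E"
        using less.prems(3) unfolding same_pattern_def skeleton_def by blast
      then show "e \<in> E" using True e acyclic_edgeD(1)[OF assms(3)] by blast
    qed
    then show ?thesis using True by auto
  next
    case False
    obtain x y where xy: "(x, y) \<in> E - H" "covered_edge E x y"
      using exists_reversible_edge[OF less.prems(1,2) assms(3) less.prems(3) False] by blast
    let ?E = "reverse_edge E x y"
    note c = covered_edge_reverse[OF xy(2) less.prems(2)]
    have "(y, x) \<in> H" using xy(1) less.prems(3) unfolding same_pattern_def skeleton_def by blast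
    then have "?E - H \<subset> E - H" using xy(1) unfolding reverse_edge_def by auto
    then have "card (?E - H) < card (E - H)" using less.prems(1) by (intro psubset_card_mono) auto
    moreover have "finite ?E" using less.prems(1) unfolding reverse_edge_def by auto
    moreover have "same_pattern ?E H" using c(4) less.prems(3) unfolding same_pattern_def by simp
    ultimately have "d_separated ?E u v S \<longleftrightarrow> d_separated H u v S" using less.hyps c(1) by blast
    then show ?thesis using d_separated_reverse_covered[OF xy(2) less.prems(2) assms(5)] by blast
  qed
qed

section \<open>Reading skeleton and v-structures off d-separation\<close>

definition parents :: "(nat \<times> nat) set \<Rightarrow> nat \<Rightarrow> nat set" where
  "parents E u = {w. (w, u) \<in> E}"

lemma adjacent_not_d_separated:
  assumes "(u, v) \<in> skeleton E" "u \<noteq> v" shows "\<not> d_separated E u v S"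
proof -
  have "graph_path E u v [u, v]" using assms unfolding graph_path_def skeleton_iff by auto
  then show ?thesis unfolding d_separated_def by fastforce
qed

lemma d_separated_triple:
  assumes "d_separated E u w S" "(u, v) \<in> skeleton E" "(v, w) \<in> skeleton E" "distinct [u, v, w]"
  shows "blocking_triple E S u v w"
proof -
  have "graph_path E u w [u, v, w]"
    using assms unfolding graph_path_def skeleton_iff by (auto simp: less_Suc_eq nth_Cons')
  then show ?thesis using assms(1) unfolding d_separated_def by fastforce
qed

text \<open>A path that begins with an arrow into \<open>u\<close> is blocked at its second node, a
  parent and no collider. A path that begins with an arrow out of \<open>u\<close> contains a
  collider, since \<open>v\<close> is no descendant; its first collider lies below \<open>u\<close>,
  and a parent of \<open>u\<close> below that collider would close a cycle.\<close>

lemma parents_d_separate: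
  assumes ac: "acyclic E" and nd: "(u, v) \<notin> E\<^sup>*" and na: "(v, u) \<notin> E"
  shows "d_separated E u v (parents E u)"
  unfolding d_separated_def
proof (intro allI impI)
  fix xs assume p: "graph_path E u v xs"
  let ?S = "parents E u"
  have ne: "xs \<noteq> []" and x0: "xs ! 0 = u" and l: "xs ! (length xs - 1) = v" and dist: "distinct xs"
    and edge: "\<And>k. Suc k < length xs \<Longrightarrow> (xs ! k, xs ! Suc k) \<in> E \<or> (xs ! Suc k, xs ! k) \<in> E"
    using p unfolding graph_path_def by (auto simp: hd_conv_nth last_conv_nth)
  have uv: "u \<noteq> v" using nd by auto
  have len: "Suc 0 < length xs" using uv x0 l ne by (cases "length xs") (auto split: nat.splits, metis One_nat_def less_Suc0 not_less_eq)
  show "\<exists>k. k + 2 < length xs \<and> blocking_triple E ?S (xs ! k) (xs ! (k + 1)) (xs ! (k + 2))"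
  proof (cases "(xs ! Suc 0, u) \<in> E")
    case True
    then have "xs ! Suc 0 \<noteq> v" using na by blast
    then have l2: "2 < length xs" using len l by (cases "length xs = 2") auto
    moreover have "xs ! Suc 0 \<in> ?S" using True unfolding parents_def by simp
    ultimately have "blocking_triple E ?S (xs ! 0) (xs ! 1) (xs ! 2)"
      using True edge[of 1] x0 unfolding blocking_triple_def by (auto simp: numeral_2_eq_2)
    then show ?thesis using l2 by (intro exI[of _ 0]) (auto simp: numeral_2_eq_2)
  next
    case False
    then have f: "(u, xs ! Suc 0) \<in> E" using edge[OF len] x0 by auto
    show ?thesis
    proof (rule ccontr)
      assume "\<not> ?thesis"
      then have nb: "\<And>k. Suc (Suc k) < length xs \<Longrightarrow> \<not> blocking_triple E ?S (xs ! k) (xs ! Suc k) (xs ! Suc (Suc k))"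
        by auto
      have st: "(xs ! k, xs ! Suc k) \<in> E \<and> (u, xs ! Suc k) \<in> E\<^sup>+" if "Suc k < length xs" for k
        using that
      proof (induction k)
        case 0
        then show ?case using f x0 by auto
      next
        case (Suc k)
        then have IH: "(xs ! k, xs ! Suc k) \<in> E" "(u, xs ! Suc k) \<in> E\<^sup>+" by auto
        have "(xs ! Suc (Suc k), xs ! Suc k) \<notin> E"
        proof
          assume "(xs ! Suc (Suc k), xs ! Suc k) \<in> E"
          then obtain w where "(xs ! Suc k, w) \<in> E\<^sup>*" "(w, u) \<in> E"
            using nb[OF Suc.prems] IH unfolding blocking_triple_def parents_def by blast
          then have "(u, u) \<in> E\<^sup>+" using IH(2) by (meson trancl_into_trancl trancl_rtrancl_trancl)
          then show False using ac unfolding acyclic_def by blast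
        qed
        then show ?case using IH edge[OF Suc.prems] by (meson trancl_into_trancl)
      qed
      have "Suc (length xs - 2) < length xs" "Suc (length xs - 2) = length xs - 1" using len by auto
      then have "(u, v) \<in> E\<^sup>+" using st[of "length xs - 2"] l by metis
      then show False using nd by (meson trancl_into_rtrancl)
    qed
  qed
qed

lemma nonadjacent_separator:
  assumes ac: "acyclic E" and na: "(u, v) \<notin> skeleton E" and uv: "u \<noteq> v"
  shows "d_separated E u v (parents E u) \<or> d_separated E v u (parents E v)"
proof -
  have "(u, v) \<notin> E\<^sup>* \<or> (v, u) \<notin> E\<^sup>*"
    using ac uv unfolding acyclic_def by (metis rtranclD rtrancl_trancl_trancl)
  then show ?thesis using parents_d_separate[OF ac] na unfolding skeleton_iff by blast
qed

lemma d_separated_sym: "d_separated E u v S \<Longrightarrow> d_separated E v u S"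
  unfolding d_separated_def
proof (intro allI impI)
  fix xs
  assume sep: "\<forall>xs. graph_path E u v xs \<longrightarrow>
      (\<exists>k. k + 2 < length xs \<and> blocking_triple E S (xs ! k) (xs ! (k + 1)) (xs ! (k + 2)))"
    and p: "graph_path E v u xs"
  let ?n = "length xs"
  have "graph_path E u v (rev xs)"
    unfolding graph_path_def
  proof (intro conjI allI impI)
    fix k assume k: "Suc k < length (rev xs)"
    define m where "m = ?n - Suc (Suc k)"
    have "rev xs ! k = xs ! Suc m" "rev xs ! Suc k = xs ! m" "Suc m < ?n"
      using k unfolding m_def by (auto simp: rev_nth Suc_diff_Suc)
    then show "(rev xs ! k, rev xs ! Suc k) \<in> E \<or> (rev xs ! Suc k, rev xs ! k) \<in> E"
      using p unfolding graph_path_def by metis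
  qed (use p in \<open>auto simp: graph_path_def hd_rev last_rev\<close>)
  then obtain k where k: "k + 2 < ?n"
    "blocking_triple E S (rev xs ! k) (rev xs ! (k + 1)) (rev xs ! (k + 2))"
    using sep by auto
  define m where "m = ?n - (k + 3)"
  have "rev xs ! k = xs ! (m + 2)" "rev xs ! (k + 1) = xs ! (m + 1)" "rev xs ! (k + 2) = xs ! m" "m + 2 < ?n"
    using k(1) unfolding m_def by (auto simp: rev_nth intro!: arg_cong[of _ _ "nth xs"])
  then show "\<exists>k. k + 2 < ?n \<and> blocking_triple E S (xs ! k) (xs ! (k + 1)) (xs ! (k + 2))"
    using k(2) unfolding blocking_triple_def by metis
qed

text \<open>Two nodes are adjacent iff no set separates them, and the middle of an unshielded triple
  is a collider iff it is outside a set separating the ends. Both criteria mention d-separation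
  only.\<close>

lemma markov_equivalent_same_pattern:
  assumes E: "dag p E" and H: "dag p H" and me: "markov_equivalent p E H"
  shows "same_pattern E H"
proof -
  have acE: "acyclic E" and acH: "acyclic H" and sub: "E \<subseteq> {..<p} \<times> {..<p}" "H \<subseteq> {..<p} \<times> {..<p}"
    using E H unfolding dag_def by auto
  have me': "d_separated E u v S \<longleftrightarrow> d_separated H u v S"
    if "u < p" "v < p" "u \<noteq> v" "S \<subseteq> {..<p} - {u, v}" for u v S
    using me that unfolding markov_equivalent_def by blast
  have sep: "\<exists>S \<subseteq> {..<p} - {u, v}. d_separated F u v S"
    if "dag p F" "(u, v) \<notin> skeleton F" "u \<noteq> v" for F u v
  proof -
    have F: "acyclic F" "F \<subseteq> {..<p} \<times> {..<p}" using that unfolding dag_def by auto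
    have nadj: "(u, v) \<notin> F" "(v, u) \<notin> F" using that(2) unfolding skeleton_iff by simp_all
    have irr: "(w, w) \<notin> F" for w using acyclic_edgeD(2)[OF F(1), of w w] by blast
    have "w \<in> {..<p} - {u, v}" if "(w, u) \<in> F \<or> (w, v) \<in> F" for w
    proof -
      have "w \<noteq> u" "w \<noteq> v" using that nadj irr by metis+
      then show ?thesis using that F(2) by auto
    qed
    then have "parents F u \<subseteq> {..<p} - {u, v}" "parents F v \<subseteq> {..<p} - {u, v}"
      unfolding parents_def by blast+
    then show ?thesis
      using nonadjacent_separator[OF F(1) that(2,3)] d_separated_sym[of F v u "parents F v"] by metis
  qed
  have skel: "(u, v) \<in> skeleton F"
    if "dag p F" "dag p G" "markov_equivalent p F G" "(u, v) \<in> skeleton G" for F G u v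
  proof (rule ccontr)
    assume n: "(u, v) \<notin> skeleton F"
    have G: "acyclic G" "G \<subseteq> {..<p} \<times> {..<p}" using that unfolding dag_def by auto
    have uv: "u \<noteq> v" "u < p" "v < p" using that(4) acyclic_edgeD(2)[OF G(1)] G(2) unfolding skeleton_iff by auto
    have "\<exists>S \<subseteq> {..<p} - {u, v}. d_separated F u v S" using sep[OF that(1) n uv(1)] .
    then obtain S where S: "S \<subseteq> {..<p} - {u, v}" "d_separated F u v S" by blast
    then have "d_separated G u v S" using \<open>markov_equivalent p F G\<close> uv unfolding markov_equivalent_def by blast
    then show False using adjacent_not_d_separated[OF \<open>(u, v) \<in> skeleton G\<close> uv(1)] by blast
  qed
  have v: "v_structure G x y z"
    if F: "dag p F" and G: "dag p G" and me: "markov_equivalent p F G" and sk: "skeleton F = skeleton G"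
      and v: "v_structure F x y z" for F G x y z
  proof -
    have acF: "acyclic F" "F \<subseteq> {..<p} \<times> {..<p}" and acG: "acyclic G" using F G unfolding dag_def by auto
    have xz: "x < p" "z < p" "x \<noteq> z" "(x, z) \<notin> skeleton F" and e: "(x, y) \<in> F" "(z, y) \<in> F"
      using v acF unfolding v_structure_def by auto
    have d: "distinct [x, y, z]" using xz e acyclic_edgeD(2)[OF acF(1)] by auto
    obtain S where S: "S \<subseteq> {..<p} - {x, z}" "d_separated F x z S" using sep[OF F xz(4,3)] by blast
    have "blocking_triple F S x y z"
      using d_separated_triple[OF S(2) _ _ d] e unfolding skeleton_iff by blast
    then have "y \<notin> S" using e acyclic_edgeD(1)[OF acF(1)] unfolding blocking_triple_def by blast
    moreover have "d_separated G x z S" using me S xz unfolding markov_equivalent_def by blast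
    then have "blocking_triple G S x y z"
      using d_separated_triple[OF _ _ _ d, of G S] e sk skeleton_iff by blast
    ultimately have "(x, y) \<in> G" "(z, y) \<in> G" unfolding blocking_triple_def by auto
    then show ?thesis using xz sk unfolding v_structure_def by auto
  qed
  have me2: "markov_equivalent p H E" using me unfolding markov_equivalent_def by blast
  have sk: "skeleton E = skeleton H" using skel[OF E H me] skel[OF H E me2] by auto
  then show ?thesis using v[OF E H me] v[OF H E me2] unfolding same_pattern_def by (auto intro!: ext)
qed

lemma same_pattern_markov_equivalent:
  assumes "dag p E" "acyclic H" "same_pattern E H"
  shows "markov_equivalent p E H"
proof -
  have "finite E" using assms(1) unfolding dag_def by (auto intro: finite_subset)
  then show ?thesis using same_pattern_d_separated[of E H] assms unfolding markov_equivalent_def dag_def by blast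
qed

section \<open>Completeness of the orientation rules\<close>

definition clique :: "('a \<times> 'a) set \<Rightarrow> 'a set \<Rightarrow> bool" where
  "clique U K \<longleftrightarrow> (\<forall>x\<in>K. \<forall>y\<in>K. x \<noteq> y \<longrightarrow> (x, y) \<in> U)"

text \<open>The head of the list is eliminated first, so edges will be oriented from the back to the front.\<close>

fun perfect_elimination :: "('a \<times> 'a) set \<Rightarrow> 'a list \<Rightarrow> bool" where
  "perfect_elimination U [] \<longleftrightarrow> True"
| "perfect_elimination U (t # xs) \<longleftrightarrow>
     t \<notin> set xs \<and> clique U (U `` {t} \<inter> set xs) \<and> perfect_elimination U xs"

lemma clique_subset: "clique U K \<Longrightarrow> L \<subseteq> K \<Longrightarrow> clique U L"
  unfolding clique_def by blast

lemma perfect_elimination_distinct: "perfect_elimination U xs \<Longrightarrow> distinct xs"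
  by (induction xs) auto

lemma perfect_elimination_clique:
  "distinct xs \<Longrightarrow> clique U (set xs) \<Longrightarrow> perfect_elimination U xs"
proof (induction xs)
  case (Cons t xs)
  have "clique U (set xs)" "clique U (U `` {t} \<inter> set xs)"
    using Cons.prems(2) by (auto intro: clique_subset)
  then show ?case using Cons by simp
qed simp

lemma perfect_elimination_appendD: "perfect_elimination U (xs @ ys) \<Longrightarrow> perfect_elimination U ys"
  by (induction xs) auto

text \<open>Allows \<open>t\<close> to be moved from the front of the list into the final clique: no
  node of \<open>ys\<close> is a neighbour of \<open>t\<close>, so the later neighbours of these
  nodes stay the same.\<close>

lemma perfect_elimination_extend_clique:
  assumes "perfect_elimination U (ys @ ls)" "set ls' = insert t (set ls)" "distinct ls'"
    "t \<notin> set ys" "clique U (set ls')" "sym U" "U `` {t} \<inter> set ys = {}"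
  shows "perfect_elimination U (ys @ ls')"
  using assms
proof (induction ys)
  case Nil
  then show ?case by (simp add: perfect_elimination_clique)
next
  case (Cons y ys)
  have "t \<notin> U `` {y}" using Cons.prems(6,7) by (auto dest: symD)
  then have "U `` {y} \<inter> set (ys @ ls') = U `` {y} \<inter> set (ys @ ls)" using Cons.prems(2) by auto
  moreover have "y \<notin> set (ys @ ls')" using Cons.prems by auto
  ultimately show ?case using Cons by auto
qed

text \<open>The head \<open>t\<close> stays in front unless it belongs to \<open>ks\<close>. In that
  case its later neighbours form a clique that contains the rest of \<open>ks\<close>; by induction
  an order ends with this clique, and \<open>t\<close> can join it because all its neighbours are
  there. As the clique grows, the induction is over all \<open>ks\<close>.\<close>

lemma perfect_elimination_clique_first:
  assumes "sym U" "irrefl U" "perfect_elimination U xs" "distinct ks" "set ks \<subseteq> set xs" "clique U (set ks)"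
  shows "\<exists>ys. perfect_elimination U (ys @ ks) \<and> set (ys @ ks) = set xs"
  using assms(3-)
proof (induction xs arbitrary: ks)
  case Nil
  then show ?case by simp
next
  case (Cons t xs)
  have nt: "t \<notin> set xs" "perfect_elimination U xs" and cl: "clique U (U `` {t} \<inter> set xs)" using Cons.prems by auto
  show ?case
  proof (cases "t \<in> set ks")
    case False
    then obtain ys where ys: "perfect_elimination U (ys @ ks)" "set (ys @ ks) = set xs"
      using Cons.IH[OF nt(2) Cons.prems(2)] Cons.prems by auto
    have "perfect_elimination U ((t # ys) @ ks)"
      using ys nt(1) cl unfolding append_Cons perfect_elimination.simps ys(2) by simp
    then show ?thesis using ys by (intro exI[of _ "t # ys"]) auto
  next
    case True
    let ?N = "U `` {t} \<inter> set xs"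
    obtain ns where ns: "set ns = ?N - set ks" "distinct ns"
      using finite_distinct_list[of "?N - set ks"] by auto
    define ls where "ls = ns @ removeAll t ks"
    have tN: "t \<notin> ?N" using nt by blast
    have "set ks - {t} \<subseteq> ?N" using Cons.prems(3,4) True unfolding clique_def by auto
    then have sl: "set ls = ?N" using ns tN unfolding ls_def by auto
    have dl: "distinct ls" using ns Cons.prems(2) unfolding ls_def by (auto simp: distinct_removeAll)
    obtain ys where ys: "perfect_elimination U (ys @ ls)" "set (ys @ ls) = set xs"
      using Cons.IH[OF nt(2) dl] sl cl by auto
    have dy: "distinct (ys @ ls)" using perfect_elimination_distinct[OF ys(1)] .
    have s: "set (ns @ ks) = insert t (set ls)" using True unfolding ls_def by auto
    have "clique U (insert t ?N)" using cl assms(1) unfolding clique_def by (auto dest: symD)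
    then have "clique U (set (ns @ ks))" using s sl by simp
    moreover have "distinct (ns @ ks)" using ns Cons.prems(2) by auto
    moreover have "t \<notin> set ys" using ys nt by auto
    moreover have "U `` {t} \<inter> set ys = {}" using ys(2) sl dy by auto
    ultimately have "perfect_elimination U (ys @ (ns @ ks))"
      using perfect_elimination_extend_clique[OF ys(1) s] assms(1) by blast
    moreover have "set (ys @ (ns @ ks)) = set (t # xs)" using s ys(2) by auto
    ultimately show ?thesis by (intro exI[of _ "ys @ ns"]) auto
  qed
qed

text \<open>Sinks come first, so that the neighbours of a node later in the list are its parents, as
  suits \<open>perfect_elimination\<close>.\<close>

lemma topological_list:
  assumes "finite V" "acyclic E"
  shows "\<exists>xs. distinct xs \<and> set xs = V \<and> (\<forall>ys t zs. xs = ys @ t # zs \<longrightarrow> (\<forall>z\<in>set zs. (t, z) \<notin> E))"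
  using assms(1)
proof (induction V rule: finite_psubset_induct)
  case (psubset V)
  show ?case
  proof (cases "V = {}")
    case True
    then show ?thesis by simp
  next
    case False
    have "finite (E \<inter> V \<times> V)" "acyclic (E \<inter> V \<times> V)"
      using psubset.hyps assms(2) by (auto intro: acyclic_subset)
    then have "wf ((E \<inter> V \<times> V)\<inverse>)" by (rule finite_acyclic_wf_converse)
    then obtain t where t: "t \<in> V" "\<And>z. (z, t) \<in> (E \<inter> V \<times> V)\<inverse> \<Longrightarrow> z \<notin> V"
      using False wfE_min'[of "(E \<inter> V \<times> V)\<inverse>" V] by blast
    then have t: "t \<in> V" "\<And>z. z \<in> V \<Longrightarrow> (t, z) \<notin> E" by blast+
    obtain xs where xs: "distinct xs" "set xs = V - {t}"
      "\<And>ys s zs. xs = ys @ s # zs \<Longrightarrow> \<forall>z\<in>set zs. (s, z) \<notin> E"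
      using psubset.IH[of "V - {t}"] t(1) by blast
    have "\<forall>z\<in>set zs. (s, z) \<notin> E" if "t # xs = ys @ s # zs" for ys s zs
      using that xs(2,3) t(2) by (cases ys) auto
    then show ?thesis using xs t(1) by (intro exI[of _ "t # xs"]) auto
  qed
qed

text \<open>
  Reasons for an arrow \<open>i \<rightarrow> j\<close>, one for v-structures and one for each rule, phrased so as to persist
  when more edges are oriented.  All that survives of the undirected edges \<open>i - k\<close> and \<open>i - l\<close> of
  the third rule is that \<open>i\<close> is adjacent to \<open>k\<close> and \<open>l\<close> and that \<open>k \<rightarrow> i \<leftarrow> l\<close> is no v-structure.
\<close>

definition oriented_reason :: "(nat \<times> nat) set \<Rightarrow> (nat \<times> nat) set \<Rightarrow> nat \<Rightarrow> nat \<Rightarrow> bool" where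
  "oriented_reason E P i j \<longleftrightarrow>
     (\<exists>k. directed P k j \<and> k \<noteq> i \<and> nonadjacent P k i) \<or>
     (\<exists>k. directed P k i \<and> nonadjacent P k j) \<or>
     (\<exists>k. directed P i k \<and> directed P k j) \<or>
     (\<exists>k l. \<not> nonadjacent P i k \<and> \<not> nonadjacent P i l \<and> directed P k j \<and> directed P l j \<and>
        k \<noteq> l \<and> nonadjacent P k l \<and> \<not> v_structure E k i l)"

text \<open>Closure under the rules alone does not suffice: for arrows given from outside the three
  rules are incomplete (Meek adds a fourth one for background knowledge). Therefore every arrow has
  to come with a reason.\<close>

locale meek_closed =
  fixes p :: nat and E P :: "(nat \<times> nat) set"
  assumes dag: "dag p E"
    and E_sub: "E \<subseteq> P" and P_sub: "P \<subseteq> skeleton E"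
    and v_dir: "\<And>x y z. v_structure E x y z \<Longrightarrow> (y, x) \<notin> P"
    and reason: "\<And>i j. directed P i j \<Longrightarrow> oriented_reason E P i j"
    and closed: "\<nexists>P'. meek_step P P'"
begin

lemma acE: "acyclic E" using dag unfolding dag_def by simp

lemma finE: "finite E" using dag unfolding dag_def by (auto intro: finite_subset)

lemma directed_E: "directed P i j \<Longrightarrow> (i, j) \<in> E"
  using E_sub P_sub unfolding directed_def skeleton_def by blast

lemma adjacent_cases:
  "\<not> nonadjacent P i j \<longleftrightarrow> directed P i j \<or> directed P j i \<or> undirected P i j"
  unfolding nonadjacent_def directed_def undirected_def by blast

lemma undirected_sym: "undirected P i j \<Longrightarrow> undirected P j i"
  unfolding undirected_def by blast

lemma not_both: "directed P i j \<Longrightarrow> \<not> directed P j i \<and> \<not> undirected P i j \<and> \<not> undirected P j i"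
  unfolding directed_def undirected_def by blast

lemma nonadjacent_sym: "nonadjacent P i j \<longleftrightarrow> nonadjacent P j i"
  unfolding nonadjacent_def by blast

lemma R1: "directed P i j \<Longrightarrow> undirected P j k \<Longrightarrow> \<not> nonadjacent P i k"
  using closed rule1 by blast

lemma R2: "directed P i k \<Longrightarrow> directed P k j \<Longrightarrow> \<not> undirected P i j"
  using closed rule2 by blast

lemma R3: "undirected P i k \<Longrightarrow> directed P k j \<Longrightarrow> undirected P i l \<Longrightarrow> directed P l j \<Longrightarrow>
    k \<noteq> l \<Longrightarrow> nonadjacent P k l \<Longrightarrow> \<not> undirected P i j"
  using closed rule3 by blast

lemma directed_or_undirected:
  "directed P a b \<Longrightarrow> undirected P b c \<Longrightarrow> directed P a c \<or> undirected P a c"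
  using R1 R2 adjacent_cases undirected_sym by metis

text \<open>The alternative is \<open>a - c\<close> undirected. Then
  \<open>d \<rightarrow> c\<close> makes the first rule applicable to \<open>c - a\<close>, and
  \<open>d - c\<close> makes the third rule applicable to \<open>c - b\<close>.\<close>

lemma v_transfer:
  assumes ab: "directed P a b" and db: "directed P d b" and "a \<noteq> d" "nonadjacent P a d"
    and bc: "undirected P b c"
  shows "directed P a c"
proof (rule ccontr)
  assume n: "\<not> directed P a c"
  have ac: "undirected P a c" using directed_or_undirected[OF ab bc] n by blast
  from directed_or_undirected[OF db bc] show False
  proof
    assume "directed P d c"
    then show False using R1[of d c a] undirected_sym[OF ac] assms(4) nonadjacent_sym by blast
  next
    assume "undirected P d c"
    then show False
      using R3[of c a b d] undirected_sym[OF ac] undirected_sym[OF bc] undirected_sym[of d c] assms by blast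
  qed
qed

text \<open>
  Hence a chain component has no arrows inside, and all of its nodes have the same parents outside:
  its edges can be oriented independently of the rest of the graph.  The proof takes the first
  \<open>b\<close>, and then the last \<open>a\<close>, in topological order.
\<close>

lemma directed_undirected:
  assumes "directed P a b" "undirected P b c"
  shows "directed P a c"
proof -
  have wf: "wf E" and wf': "wf (E\<inverse>)"
    using finE acE by (auto intro: finite_acyclic_wf finite_acyclic_wf_converse)
  have "\<forall>a c. directed P a b \<longrightarrow> undirected P b c \<longrightarrow> directed P a c"
    using wf
  proof (induction b rule: wf_induct_rule)
    case (less b)
    have "directed P a b \<longrightarrow> (\<forall>c. undirected P b c \<longrightarrow> directed P a c)" for a
      using wf'
    proof (induction a rule: wf_induct_rule)
      case inner: (less a)
      show ?case
      proof (intro impI allI, rule ccontr)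
        fix c assume ab: "directed P a b" and bc: "undirected P b c" and n: "\<not> directed P a c"
        have ac: "undirected P a c" using directed_or_undirected[OF ab bc] n by blast
        note und = undirected_sym[OF ac] undirected_sym[OF bc]
        \<comment> \<open>With \<open>a - c\<close> undirected every reason makes some rule
          applicable. Case \<open>A\<close> uses the outer induction, since \<open>a\<close>
          precedes \<open>b\<close>; case \<open>B\<close> uses the inner one, since
          \<open>k\<close> follows \<open>a\<close>. In case \<open>C\<close> both \<open>k\<close>
          and \<open>l\<close> point to \<open>c\<close>, and no orientation of \<open>a - k\<close>
          and \<open>a - l\<close> is left.\<close>
        from reason[OF ab] consider
          (V) k where "directed P k b" "k \<noteq> a" "nonadjacent P k a"
          | (A) k where "directed P k a" "nonadjacent P k b"
          | (B) k where "directed P a k" "directed P k b"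
          | (C) k l where "\<not> nonadjacent P a k" "\<not> nonadjacent P a l" "directed P k b" "directed P l b"
              "k \<noteq> l" "nonadjacent P k l" "\<not> v_structure E k a l"
          unfolding oriented_reason_def by blast
        then show False
        proof cases
          case V
          then show ?thesis using v_transfer[OF ab V(1) _ _ bc] nonadjacent_sym n by blast
        next
          case A
          have "directed P k c" using less.IH[OF directed_E[OF ab]] A(1) ac by blast
          then show ?thesis using R1[of k c b] und A(2) by blast
        next
          case B
          have "directed P k c" using inner.IH[of k] directed_E[OF B(1)] B(2) bc by blast
          then show ?thesis using R2[OF B(1)] ac by blast
        next
          case C
          have kc: "directed P k c" using v_transfer[OF C(3,4,5,6) bc] .
          have lc: "directed P l c" using v_transfer[OF C(4,3) _ _ bc] C(5,6) nonadjacent_sym by blast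
          have "\<not> directed P a k" "\<not> directed P a l" using R2 kc lc ac by blast+
          moreover have "directed P k a \<Longrightarrow> \<not> undirected P a l" "directed P l a \<Longrightarrow> \<not> undirected P a k"
            using R1[of k a l] R1[of l a k] C(6) nonadjacent_sym by blast+
          moreover have "\<not> (undirected P a k \<and> undirected P a l)"
            using R3[of a k c l] kc lc C(5,6) ac by blast
          moreover have "\<not> (directed P k a \<and> directed P l a)"
          proof
            assume "directed P k a \<and> directed P l a"
            then have "(k, a) \<in> E" "(l, a) \<in> E" using directed_E by auto
            moreover have "(k, l) \<notin> skeleton E" using C(6) E_sub unfolding nonadjacent_def skeleton_def by blast
            ultimately show False using C(5,7) unfolding v_structure_def by blast
          qed
          ultimately show ?thesis using C(1,2) adjacent_cases by blast
        qed
      qed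
    qed
    then show ?case by blast
  qed
  then show ?thesis using assms by blast
qed

text \<open>The order comes from \<open>E\<close> itself: undirected neighbours of \<open>t\<close>
  later in the list are parents of \<open>t\<close> in \<open>E\<close>. Two of them are adjacent,
  as otherwise they would form an oriented v-structure at \<open>t\<close>, and by
  \<open>directed_undirected\<close> the edge between them carries no arrow.\<close>

lemma exists_perfect_elimination:
  "\<exists>xs. perfect_elimination {(x, y). undirected P x y} xs \<and> set xs = {..<p}"
proof -
  let ?U = "{(x, y). undirected P x y}"
  obtain xs where xs: "distinct xs" "set xs = {..<p}"
    "\<And>ys t zs. xs = ys @ t # zs \<Longrightarrow> \<forall>z\<in>set zs. (t, z) \<notin> E"
    using topological_list[OF _ acE, of "{..<p}"] by auto
  have "perfect_elimination ?U zs" if "xs = ys @ zs" for ys zs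
    using that
  proof (induction zs arbitrary: ys)
    case (Cons t zs)
    have "perfect_elimination ?U zs" using Cons.IH[of "ys @ [t]"] Cons.prems by simp
    moreover have "t \<notin> set zs" using Cons.prems xs(1) by auto
    moreover have "(a, b) \<in> ?U" if "(t, a) \<in> ?U" "a \<in> set zs" "(t, b) \<in> ?U" "b \<in> set zs" "a \<noteq> b" for a b
    proof -
      have u: "undirected P t a" "undirected P t b" "undirected P a t" "undirected P b t"
        using that undirected_sym by auto
      have "(t, a) \<notin> E" "(t, b) \<notin> E" using xs(3)[OF Cons.prems] that by auto
      then have e: "(a, t) \<in> E" "(b, t) \<in> E"
        using u P_sub unfolding undirected_def skeleton_def by blast+
      have "(a, b) \<in> skeleton E"
        using v_dir[of a t b] e that(5) u unfolding v_structure_def undirected_def by blast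
      then have "\<not> nonadjacent P a b" using E_sub unfolding nonadjacent_def skeleton_def by blast
      moreover have "\<not> directed P a b" using directed_undirected[of a b t] u not_both by blast
      moreover have "\<not> directed P b a" using directed_undirected[of b a t] u not_both by blast
      ultimately show ?thesis using adjacent_cases by auto
    qed
    then have "clique ?U (?U `` {t} \<inter> set zs)" unfolding clique_def by blast
    ultimately show ?case by simp
  qed simp
  then show ?thesis using xs(2) by (intro exI[of _ xs]) auto
qed

text \<open>The witness keeps all arrows and orients every undirected edge from the later to the
  earlier node of a perfect elimination order.\<close>

lemma edge_in_class:
  assumes "(i, j) \<in> P"
  shows "\<exists>H. dag p H \<and> same_pattern E H \<and> (i, j) \<in> H"
proof (cases "undirected P i j")
  case False
  then have "(i, j) \<in> E" using assms directed_E unfolding directed_def undirected_def by blast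
  then show ?thesis using dag unfolding same_pattern_def by blast
next
  case True
  let ?U = "{(x, y). undirected P x y}"
  have P_lt: "x < p" "y < p" if "(x, y) \<in> P" for x y
    using that P_sub dag unfolding dag_def skeleton_def by auto
  have irr: "x \<noteq> y" if "(x, y) \<in> P" for x y
    using that P_sub acyclic_edgeD(2)[OF acE] unfolding skeleton_def by blast
  have symU: "sym ?U" using undirected_sym by (auto intro: symI)
  have irrU: "irrefl ?U" using irr unfolding irrefl_def undirected_def by blast
  have ij: "(i, j) \<in> P" "(j, i) \<in> P" using True unfolding undirected_def by auto
  obtain xs where xs: "perfect_elimination ?U xs" "set xs = {..<p}" using exists_perfect_elimination by blast
  \<comment> \<open>The order is made to end in \<open>j, i\<close>: being last, \<open>i\<close>
    becomes the tail of the prescribed edge.\<close>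
  have "clique ?U (set [j, i])" using True undirected_sym unfolding clique_def by auto
  then obtain ys where "perfect_elimination ?U (ys @ [j, i])" "set (ys @ [j, i]) = {..<p}"
    using perfect_elimination_clique_first[OF symU irrU xs(1), of "[j, i]"] P_lt[OF ij(1)] irr[OF ij(1)] xs(2) by auto
  then obtain zs where zs: "zs = ys @ [j, i]" "perfect_elimination ?U zs" "set zs = {..<p}" by blast
  have dz: "distinct zs" using perfect_elimination_distinct[OF zs(2)] .
  define pos where "pos = inv_into {..<length zs} (nth zs)"
  have pos: "pos (zs ! k) = k" if "k < length zs" for k
    unfolding pos_def using that dz by (intro inv_into_f_f) (auto simp: inj_on_def nth_eq_iff_index_eq)
  have pos_lt: "pos x < length zs" "zs ! pos x = x" if "x < p" for x
  proof -
    have "x \<in> set zs" using that zs(3) by simp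
    then obtain k where "k < length zs" "zs ! k = x" unfolding in_set_conv_nth by blast
    then show "pos x < length zs" "zs ! pos x = x" using pos by auto
  qed
  define N where "N = {(x, y). undirected P x y \<and> pos y < pos x}"
  define D where "D = {(x, y). directed P x y}"
  define H where "H = D \<union> N"
  have DE: "D \<subseteq> E" using directed_E unfolding D_def by auto
  have acD: "acyclic D" using acyclic_subset[OF acE DE] .
  have "N \<subseteq> inv_image (less_than\<inverse>) pos" unfolding N_def by auto
  moreover have "acyclic (inv_image (less_than\<inverse>) pos)"
    by (rule acyclicI_order[of _ "pos"]) auto
  ultimately have acN: "acyclic N" by (rule acyclic_subset[rotated])
  \<comment> \<open>An arrow followed by an edge of \<open>N\<close> can be replaced by an arrow, so
    a cycle of \<open>H\<close> contracts to a cycle inside \<open>N\<close> or inside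
    \<open>D\<close>.\<close>
  have DN: "(x, z) \<in> D" if "(x, y) \<in> D" "(y, z) \<in> N" for x y z
    using that directed_undirected unfolding D_def N_def by blast
  have DNs: "(x, z) \<in> D" if "(x, y) \<in> D" "(y, z) \<in> N\<^sup>*" for x y z
    using that(2,1) by (induction rule: rtrancl_induct) (auto intro: DN)
  have DpNs: "(x, z) \<in> D\<^sup>+" if "(x, y) \<in> D\<^sup>+" "(y, z) \<in> N\<^sup>*" for x y z
    using that by (cases rule: tranclE) (auto intro: DNs trancl_into_trancl)
  have split: "(x, y) \<in> N\<^sup>+ \<or> (\<exists>z. (x, z) \<in> N\<^sup>* \<and> (z, y) \<in> D\<^sup>+)" if "(x, y) \<in> H\<^sup>+" for x y
    using that
  proof (induction rule: trancl_induct)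
    case (base y)
    then show ?case unfolding H_def by blast
  next
    case (step y z)
    then show ?case unfolding H_def
      by (metis DpNs UnE r_into_rtrancl trancl.trancl_into_trancl r_into_trancl' trancl_into_rtrancl)
  qed
  have "acyclic H" unfolding acyclic_def
  proof (intro allI notI)
    fix x assume "(x, x) \<in> H\<^sup>+"
    from split[OF this] show False
    proof
      assume "(x, x) \<in> N\<^sup>+"
      then show False using acN unfolding acyclic_def by blast
    next
      assume "\<exists>z. (x, z) \<in> N\<^sup>* \<and> (z, x) \<in> D\<^sup>+"
      then obtain z where "(x, z) \<in> N\<^sup>*" "(z, x) \<in> D\<^sup>+" by blast
      then have "(z, z) \<in> D\<^sup>+" using DpNs by blast
      then show False using acD unfolding acyclic_def by blast
    qed
  qed
  moreover have H_sub: "H \<subseteq> P" unfolding H_def D_def N_def directed_def undirected_def by blast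
  moreover have "H \<subseteq> {..<p} \<times> {..<p}" using H_sub P_lt by auto
  ultimately have dagH: "dag p H" unfolding dag_def by blast
  have tot: "(x, y) \<in> H \<or> (y, x) \<in> H" if "(x, y) \<in> P" for x y
  proof -
    have "pos x \<noteq> pos y" using pos_lt P_lt[OF that] irr[OF that] by metis
    then show ?thesis using that undirected_sym unfolding H_def D_def N_def directed_def undirected_def
      by (auto simp: nat_neq_iff)
  qed
  have sk: "skeleton E = skeleton H"
  proof
    show "skeleton E \<subseteq> skeleton H" unfolding skeleton_def using tot E_sub by (auto simp: subset_iff)
    show "skeleton H \<subseteq> skeleton E" using H_sub P_sub unfolding skeleton_def by blast
  qed
  \<comment> \<open>An edge of \<open>N\<close> takes part in no v-structure: beside an arrow into
    \<open>y\<close> its tail is a child of the tail of that arrow, and beside another edge of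
    \<open>N\<close> both tails are later neighbours of \<open>y\<close>, hence adjacent.\<close>
  have "v_structure E x y z" if v: "v_structure H x y z" for x y z
  proof -
    have nadj: "(x, z) \<notin> skeleton E" "x \<noteq> z" and e: "(x, y) \<in> H" "(z, y) \<in> H"
      using v sk unfolding v_structure_def by auto
    have nP: "\<not> directed P x z" "\<not> directed P z x" "\<not> undirected P x z"
      using nadj P_sub unfolding directed_def undirected_def skeleton_iff[symmetric] by (auto simp: skeleton_def)
    have "\<not> ((x, y) \<in> D \<and> (z, y) \<in> N)" "\<not> ((z, y) \<in> D \<and> (x, y) \<in> N)"
      using directed_undirected[of x y z] directed_undirected[of z y x] nP undirected_sym
      unfolding D_def N_def by blast+
    moreover have "\<not> ((x, y) \<in> N \<and> (z, y) \<in> N)"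
    proof
      assume "(x, y) \<in> N \<and> (z, y) \<in> N"
      then have u: "undirected P y x" "undirected P y z" "pos y < pos x" "pos y < pos z"
        using undirected_sym unfolding N_def by auto
      have lt: "x < p" "y < p" "z < p" using u P_lt unfolding undirected_def by auto
      have "zs = take (pos y) zs @ y # drop (Suc (pos y)) zs"
        using pos_lt[OF lt(2)] by (metis id_take_nth_drop)
      then have "perfect_elimination ?U (y # drop (Suc (pos y)) zs)"
        using zs(2) perfect_elimination_appendD by metis
      then have c: "clique ?U (?U `` {y} \<inter> set (drop (Suc (pos y)) zs))" by simp
      have mem: "w \<in> set (drop (Suc (pos y)) zs)" if "w < p" "pos y < pos w" for w
        unfolding in_set_conv_nth using pos_lt[OF that(1)] that(2)
        by (intro exI[of _ "pos w - Suc (pos y)"]) auto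
      have "(x, z) \<in> ?U" using c u mem lt nadj(2) unfolding clique_def by blast
      then show False using nP by blast
    qed
    ultimately have "(x, y) \<in> D" "(z, y) \<in> D" using e unfolding H_def by blast+
    then show ?thesis using DE nadj unfolding v_structure_def by blast
  qed
  moreover have "v_structure H x y z" if v: "v_structure E x y z" for x y z
  proof -
    have "v_structure E z y x" using v unfolding v_structure_def skeleton_def by blast
    then have "(y, x) \<notin> P" "(y, z) \<notin> P" using v v_dir by blast+
    moreover have "(x, y) \<in> P" "(z, y) \<in> P" using v E_sub unfolding v_structure_def by auto
    ultimately have "(x, y) \<in> H" "(z, y) \<in> H" unfolding H_def D_def directed_def by auto
    then show ?thesis using v sk unfolding v_structure_def by simp
  qed
  ultimately have "same_pattern E H" using sk unfolding same_pattern_def by (auto intro!: ext)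
  moreover have "(i, j) \<in> H"
  proof -
    have "zs ! length ys = j" "zs ! Suc (length ys) = i" "Suc (length ys) < length zs"
      using zs(1) by (auto simp: nth_append)
    then have "pos j = length ys" "pos i = Suc (length ys)" using pos by (metis Suc_lessD)+
    then show ?thesis using True unfolding H_def N_def by auto
  qed
  ultimately show ?thesis using dagH by blast
qed

end

section \<open>The PC algorithm with correct answers\<close>

definition correct_query :: "nat \<Rightarrow> (nat \<times> nat) set \<Rightarrow> query \<Rightarrow> nat \<Rightarrow> bool" where
  "correct_query p E Q m \<longleftrightarrow> (\<forall>u v S. u < p \<longrightarrow> v < p \<longrightarrow> u \<noteq> v \<longrightarrow> S \<subseteq> {..<p} - {u, v} \<longrightarrow>
     card S \<le> m \<longrightarrow> (Q u v S \<longleftrightarrow> d_separated E u v S))"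

definition skel_inv :: "nat \<Rightarrow> (nat \<times> nat) set \<Rightarrow> skel_state \<Rightarrow> bool" where
  "skel_inv p E st \<longleftrightarrow> sym (fst st) \<and> fst st \<subseteq> complete_graph p \<and> skeleton E \<subseteq> fst st \<and>
     (\<forall>(u, v) \<in> complete_graph p - fst st. d_separated E u v (snd st {u, v}))"

text \<open>Vacuous for deleted pairs, and therefore stable under further deletions, which only
  shrink the adjacency sets.\<close>

definition separators_exhausted :: "(nat \<times> nat) set \<Rightarrow> (nat \<times> nat) set \<Rightarrow> nat \<Rightarrow> nat \<times> nat \<Rightarrow> bool" where
  "separators_exhausted E D l e \<longleftrightarrow> (e \<in> D \<longrightarrow>
     (\<forall>S \<subseteq> adj D (fst e) - {snd e}. card S = l \<longrightarrow> \<not> d_separated E (fst e) (snd e) S))"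

lemma separators_exhausted_mono:
  "separators_exhausted E D l e \<Longrightarrow> D' \<subseteq> D \<Longrightarrow> separators_exhausted E D' l e"
  unfolding separators_exhausted_def adj_def by blast

lemma dag_skeleton_sub: "dag p E \<Longrightarrow> skeleton E \<subseteq> complete_graph p"
  unfolding dag_def skeleton_def complete_graph_def by (auto dest: acyclic_edgeD(2))

lemma adj_complete:
  assumes "D \<subseteq> complete_graph p" shows "adj D u \<subseteq> {..<p} - {u}" "finite (adj D u)"
proof -
  show "adj D u \<subseteq> {..<p} - {u}" using assms unfolding adj_def complete_graph_def by auto
  then show "finite (adj D u)" by (auto intro: finite_subset)
qed

lemma skel_pair_inv:
  assumes "skel_pair Q l e st st'" and E: "dag p E" and Q: "correct_query p E Q m" and l: "l \<le> m"
    and inv: "skel_inv p E st"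
  shows "skel_inv p E st' \<and> fst st' \<subseteq> fst st \<and> separators_exhausted E (fst st') l e"
  using assms(1,5)
proof (cases rule: skel_pair.cases)
  case (not_examined u v D Sep)
  have fin: "finite (adj D u - {v})"
    using inv not_examined adj_complete[of D p] unfolding skel_inv_def by auto
  have "(u, v) \<notin> D \<or> card S \<noteq> l" if "S \<subseteq> adj D u - {v}" for S
    using not_examined card_mono[OF fin that] by linarith
  then have "separators_exhausted E D l e"
    using not_examined unfolding separators_exhausted_def by auto
  then show ?thesis using not_examined inv by auto
next
  case (exhausted u v D Sep)
  have D: "D \<subseteq> complete_graph p" using inv exhausted unfolding skel_inv_def by auto
  have uv: "u < p" "v < p" "u \<noteq> v" using D exhausted unfolding complete_graph_def by auto
  have "\<not> d_separated E u v S" if S: "S \<subseteq> adj D u - {v}" "card S = l" for S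
  proof -
    have "S \<subseteq> {..<p} - {u, v}" using S adj_complete(1)[OF D, of u] by blast
    then have "Q u v S \<longleftrightarrow> d_separated E u v S" using Q uv S(2) l unfolding correct_query_def by blast
    then show ?thesis using exhausted S by blast
  qed
  then have "separators_exhausted E D l e" using exhausted unfolding separators_exhausted_def by simp
  then show ?thesis using exhausted inv by auto
next
  case (deleted u v D S Sep)
  have D: "D \<subseteq> complete_graph p" and sk: "skeleton E \<subseteq> D" and sD: "sym D"
    and sep: "\<And>a b. (a, b) \<in> complete_graph p - D \<Longrightarrow> d_separated E a b (Sep {a, b})"
    using inv deleted unfolding skel_inv_def by auto
  have uv: "u < p" "v < p" "u \<noteq> v" using D deleted unfolding complete_graph_def by auto
  have "S \<subseteq> {..<p} - {u, v}" using deleted adj_complete(1)[OF D, of u] by blast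
  then have ds: "d_separated E u v S" using Q uv deleted l unfolding correct_query_def by blast
  then have nsk: "(u, v) \<notin> skeleton E" "(v, u) \<notin> skeleton E"
    using adjacent_not_d_separated[of u v E S] uv unfolding skeleton_iff by blast+
  define D' where "D' = D - {(u, v), (v, u)}"
  have "sym D'" using sD unfolding D'_def sym_def by blast
  moreover have "D' \<subseteq> complete_graph p" "skeleton E \<subseteq> D'" using D sk nsk unfolding D'_def by blast+
  moreover have "d_separated E a b ((Sep({u, v} := S)) {a, b})" if ab: "(a, b) \<in> complete_graph p - D'" for a b
  proof (cases "{a, b} = {u, v}")
    case True
    then have "a = u \<and> b = v \<or> a = v \<and> b = u" by (auto simp: doubleton_eq_iff)
    then show ?thesis using True ds d_separated_sym[OF ds] by auto
  next
    case False
    then have "(a, b) \<in> complete_graph p - D" using ab unfolding D'_def by auto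
    then show ?thesis using sep False by auto
  qed
  ultimately have "skel_inv p E (D', Sep({u, v} := S))"
    unfolding skel_inv_def fst_conv snd_conv by blast
  then show ?thesis using deleted unfolding D'_def separators_exhausted_def by auto
qed

lemma skel_level_inv:
  assumes "skel_level Q l es st st'" and E: "dag p E" and Q: "correct_query p E Q m" and l: "l \<le> m"
    and inv: "skel_inv p E st"
  shows "skel_inv p E st' \<and> fst st' \<subseteq> fst st \<and> (\<forall>e\<in>set es. separators_exhausted E (fst st') l e)"
  using assms(1,5)
proof (induction rule: skel_level.induct)
  case (1 st)
  then show ?case by simp
next
  case (2 e st st' es st'')
  have a: "skel_inv p E st'" "fst st' \<subseteq> fst st" "separators_exhausted E (fst st') l e"
    using skel_pair_inv[OF 2(1) E Q l 2(4)] by auto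
  then have b: "skel_inv p E st''" "fst st'' \<subseteq> fst st'" "\<forall>e\<in>set es. separators_exhausted E (fst st'') l e"
    using 2(3) by auto
  show ?case using a b separators_exhausted_mono by fastforce
qed

lemma max_degree_bounds:
  assumes E: "dag p E" and u: "u < p"
  shows "card (adj (skeleton E) u) \<le> max_degree p E" "card (parents E u) \<le> max_degree p E"
proof -
  have fin: "finite E" using E unfolding dag_def by (auto intro: finite_subset)
  let ?I = "{e \<in> E. fst e = u \<or> snd e = u}"
  have le: "node_degree E u \<le> max_degree p E" unfolding max_degree_def using u by (intro Max_ge) auto
  let ?f = "\<lambda>e. if fst e = u then snd e else fst e"
  have "adj (skeleton E) u \<subseteq> ?f ` ?I"
  proof
    fix w assume "w \<in> adj (skeleton E) u"
    then have "(u, w) \<in> ?I \<or> (w, u) \<in> ?I" unfolding adj_def skeleton_def by auto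
    then show "w \<in> ?f ` ?I" by (force simp: image_iff split: if_splits)
  qed
  then have "card (adj (skeleton E) u) \<le> node_degree E u"
    unfolding node_degree_def using surj_card_le[of ?I _ ?f] fin by simp
  then show 1: "card (adj (skeleton E) u) \<le> max_degree p E" using le by simp
  have "parents E u \<subseteq> adj (skeleton E) u" unfolding parents_def adj_def skeleton_def by auto
  then show "card (parents E u) \<le> max_degree p E"
    using 1 adj_complete(2)[OF dag_skeleton_sub[OF E]] by (meson card_mono le_trans)
qed

text \<open>A remaining nonadjacent pair would be separated by the parents of one of its ends. These
  are neighbours of that end in the current graph and number less than \<open>l\<close>, by the
  degree bound or because the loop stops, so the set has been tried before.\<close>

lemma exhausted_skeleton:
  assumes E: "dag p E" and inv: "skel_inv p E st"
    and ex: "\<And>k e. k < l \<Longrightarrow> separators_exhausted E (fst st) k e"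
    and big: "max_degree p E < l \<or> (\<forall>(u, v)\<in>fst st. card (adj (fst st) u - {v}) < l)"
  shows "fst st = skeleton E"
proof -
  define D where "D = fst st"
  have D: "D \<subseteq> complete_graph p" "skeleton E \<subseteq> D" "sym D" using inv unfolding skel_inv_def D_def by auto
  have ac: "acyclic E" using E unfolding dag_def by simp
  have no: False if uv: "(u, v) \<in> D" "(u, v) \<notin> skeleton E" and ds: "d_separated E u v (parents E u)" for u v
  proof -
    have p: "u < p" "u \<noteq> v" using D uv unfolding complete_graph_def by auto
    have sub: "parents E u \<subseteq> adj D u - {v}"
      using D(2) uv(2) unfolding parents_def adj_def skeleton_def by auto
    have "card (parents E u) < l"
    proof -
      have "card (parents E u) \<le> card (adj D u - {v})"
        using sub adj_complete(2)[OF D(1)] by (intro card_mono) auto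
      then show ?thesis using big max_degree_bounds(2)[OF E p(1)] uv(1) unfolding D_def by fastforce
    qed
    then show False using ex[of "card (parents E u)" "(u, v)"] uv(1) ds sub
      unfolding separators_exhausted_def D_def by auto
  qed
  have "D \<subseteq> skeleton E"
  proof
    fix e assume "e \<in> D"
    then obtain u v where e: "e = (u, v)" "(u, v) \<in> D" "(v, u) \<in> D" "u \<noteq> v"
      using D unfolding complete_graph_def by (cases e) (auto dest: symD)
    show "e \<in> skeleton E"
    proof (rule ccontr)
      assume "e \<notin> skeleton E"
      then have n: "(u, v) \<notin> skeleton E" "(v, u) \<notin> skeleton E" using e(1) skeleton_iff by blast+
      show False using nonadjacent_separator[OF ac n(1) e(4)] no[OF e(2) n(1)] no[OF e(3) n(2)] by blast
    qed
  qed
  then show ?thesis using D unfolding D_def by blast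
qed

lemma skel_from_skeleton:
  assumes "skel_from Q l st st'" and E: "dag p E" and Q: "correct_query p E Q (max_degree p E)"
    and "skel_inv p E st" and "\<And>k e. k < l \<Longrightarrow> separators_exhausted E (fst st) k e"
  shows "skel_inv p E st' \<and> fst st' = skeleton E"
  using assms(1,4,5)
proof (induction rule: skel_from.induct)
  case (stop st l)
  then show ?case using exhausted_skeleton[OF E stop(2,3)] by blast
next
  case (continue st l es st' st'')
  \<comment> \<open>Beyond the maximal degree the graph is already the skeleton, whose adjacency
    sets are too small for the loop to continue. Hence only queries within the scope of
    \<open>Q\<close> are asked.\<close>
  have l: "l \<le> max_degree p E"
  proof (rule ccontr)
    assume "\<not> l \<le> max_degree p E"
    then have big: "max_degree p E < l" by simp
    then have D: "fst st = skeleton E" using exhausted_skeleton[OF E continue.prems(1,2)] by blast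
    obtain u v where uv: "(u, v) \<in> skeleton E" "l \<le> card (adj (skeleton E) u - {v})"
      using continue.hyps(1) D by auto
    have "u < p" using dag_skeleton_sub[OF E] uv(1) unfolding complete_graph_def by auto
    then have "card (adj (skeleton E) u) \<le> max_degree p E" using max_degree_bounds(1)[OF E] by blast
    moreover have "card (adj (skeleton E) u - {v}) \<le> card (adj (skeleton E) u)"
      using adj_complete(2)[OF dag_skeleton_sub[OF E]] by (intro card_mono) auto
    ultimately show False using uv(2) big by simp
  qed
  have s: "skel_inv p E st'" "fst st' \<subseteq> fst st" "\<forall>e\<in>set es. separators_exhausted E (fst st') l e"
    using skel_level_inv[OF continue.hyps(4) E Q l continue.prems(1)] by auto
  have "separators_exhausted E (fst st') k e" if "k < Suc l" for k e
  proof (cases "k < l")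
    case True
    then show ?thesis using continue.prems(2) s(2) separators_exhausted_mono by blast
  next
    case False
    then have "k = l" using that by simp
    then show ?thesis using s(2,3) continue.hyps(3) unfolding separators_exhausted_def by blast
  qed
  then show ?case using continue.IH s(1) by blast
qed

text \<open>The recorded set blocks the three-node path \<open>u, v, w\<close>: it contains a
  noncollider in the middle and avoids a collider.\<close>

lemma unshielded_colliders_v_structure:
  assumes E: "dag p E" and inv: "skel_inv p E (skeleton E, Sep)"
  shows "unshielded_colliders (skeleton E) Sep = {(u, v, w). u < w \<and> v_structure E u v w}"
proof -
  have ac: "acyclic E" using E unfolding dag_def by simp
  have "(u, v) \<in> skeleton E \<and> (v, w) \<in> skeleton E \<and> (u, w) \<notin> skeleton E \<and> v \<notin> Sep {u, w} \<longleftrightarrow> v_structure E u v w"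
    if uw: "u < w" for u v w
  proof (cases "(u, v) \<in> skeleton E \<and> (v, w) \<in> skeleton E \<and> (u, w) \<notin> skeleton E")
    case True
    then have sub: "(u, v) \<in> complete_graph p" "(v, w) \<in> complete_graph p"
      using dag_skeleton_sub[OF E] by blast+
    then have d: "distinct [u, v, w]" "(u, w) \<in> complete_graph p" using uw unfolding complete_graph_def by auto
    then have "d_separated E u w (Sep {u, w})" using inv True unfolding skel_inv_def by auto
    then have b: "blocking_triple E (Sep {u, w}) u v w" using d_separated_triple d(1) True by blast
    have "v \<notin> Sep {u, w} \<longleftrightarrow> (u, v) \<in> E \<and> (w, v) \<in> E"
      using b acyclic_edgeD(1)[OF ac] unfolding blocking_triple_def by blast
    then show ?thesis using True uw unfolding v_structure_def by auto
  next
    case False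
    then show ?thesis unfolding v_structure_def skeleton_iff by blast
  qed
  then show ?thesis unfolding unshielded_colliders_def by auto
qed

section \<open>The orientation phase\<close>

text \<open>All listed colliders are oriented as in the one acyclic graph \<open>E\<close>, whose
  edges are never removed. So no conflict arises and the order of processing is immaterial.\<close>

lemma orient_colliders_result:
  assumes "orient_colliders ts P P'" and ac: "acyclic E" and "E \<subseteq> P"
    and "\<And>u v w. (u, v, w) \<in> set ts \<Longrightarrow> (u, v) \<in> E \<and> (w, v) \<in> E"
  shows "P' = P - {(v, x) |u v w x. (u, v, w) \<in> set ts \<and> (x = u \<or> x = w)}"
  using assms(1,3,4)
proof (induction rule: orient_colliders.induct)
  case (1 P)
  then show ?case by simp
next
  case (2 t P P' ts P'')
  obtain u v w where t: "t = (u, v, w)" by (cases t) auto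
  have e: "(u, v) \<in> E" "(w, v) \<in> E" using 2(5)[of u v w] t by auto
  have "P' = P - {(v, u), (v, w)}"
    using 2(1) e 2(4) unfolding t by (cases rule: orient_collider.cases) auto
  moreover have "(v, u) \<notin> E" "(v, w) \<notin> E" using e acyclic_edgeD(1)[OF ac] by auto
  ultimately have P': "P' = P - {(v, u), (v, w)}" "E \<subseteq> P'" using 2(4) by auto
  have "P'' = P' - {(v, x) |u v w x. (u, v, w) \<in> set ts \<and> (x = u \<or> x = w)}"
  proof (rule 2(3)[OF P'(2)])
    fix a b c assume "(a, b, c) \<in> set ts"
    then show "(a, b) \<in> E \<and> (c, b) \<in> E" using 2(5)[of a b c] by simp
  qed
  then show ?case unfolding P'(1) t by auto
qed

text \<open>The reasons feed completeness; the last clause is soundness, that no edge occurring in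
  the class is ever removed.\<close>

definition meek_inv :: "nat \<Rightarrow> (nat \<times> nat) set \<Rightarrow> (nat \<times> nat) set \<Rightarrow> bool" where
  "meek_inv p E P \<longleftrightarrow> P \<subseteq> skeleton E \<and> (\<forall>x y z. v_structure E x y z \<longrightarrow> (y, x) \<notin> P) \<and>
     (\<forall>i j. directed P i j \<longrightarrow> oriented_reason E P i j) \<and>
     (\<forall>H. dag p H \<and> same_pattern E H \<longrightarrow> H \<subseteq> P)"

lemma oriented_reason_remove:
  assumes r: "oriented_reason E P i j" and u: "undirected P a b" "a \<noteq> b"
  shows "oriented_reason E (P - {(a, b)}) i j"
proof -
  let ?P = "P - {(a, b)}"
  have d: "directed P x y \<Longrightarrow> directed ?P x y" for x y
    using u unfolding directed_def undirected_def by blast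
  have n: "nonadjacent ?P x y \<longleftrightarrow> nonadjacent P x y" for x y
    using u unfolding nonadjacent_def undirected_def by auto
  from r consider "\<exists>k. directed P k j \<and> k \<noteq> i \<and> nonadjacent P k i"
    | "\<exists>k. directed P k i \<and> nonadjacent P k j"
    | "\<exists>k. directed P i k \<and> directed P k j"
    | "\<exists>k l. \<not> nonadjacent P i k \<and> \<not> nonadjacent P i l \<and> directed P k j \<and> directed P l j \<and>
        k \<noteq> l \<and> nonadjacent P k l \<and> \<not> v_structure E k i l"
    unfolding oriented_reason_def by argo
  then show ?thesis
    unfolding oriented_reason_def n by cases (use d in metis)+
qed

lemma meek_inv_remove:
  assumes E: "dag p E" and inv: "meek_inv p E P" and u: "undirected P i j"
    and r: "oriented_reason E (P - {(j, i)}) i j"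
    and no: "\<And>H. dag p H \<Longrightarrow> same_pattern E H \<Longrightarrow> H \<subseteq> P \<Longrightarrow> (j, i) \<notin> H"
  shows "meek_inv p E (P - {(j, i)})"
proof -
  let ?P = "P - {(j, i)}"
  have uj: "undirected P j i" using u unfolding undirected_def by blast
  have "(j, i) \<in> complete_graph p"
    using uj inv dag_skeleton_sub[OF E] unfolding undirected_def meek_inv_def by blast
  then have ji: "j \<noteq> i" unfolding complete_graph_def by blast
  have "oriented_reason E ?P x y" if d: "directed ?P x y" for x y
  proof (cases "(x, y) = (i, j)")
    case True
    then show ?thesis using r by simp
  next
    case False
    then have "directed P x y" using d unfolding directed_def by blast
    then show ?thesis using inv oriented_reason_remove[OF _ uj ji] unfolding meek_inv_def by blast
  qed
  moreover have "P \<subseteq> skeleton E" "\<forall>x y z. v_structure E x y z \<longrightarrow> (y, x) \<notin> P"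
    "\<forall>H. dag p H \<and> same_pattern E H \<longrightarrow> H \<subseteq> P"
    using inv unfolding meek_inv_def by simp_all
  moreover from this(3) have "\<forall>H. dag p H \<and> same_pattern E H \<longrightarrow> H \<subseteq> ?P" using no by blast
  ultimately show ?thesis unfolding meek_inv_def by blast
qed

text \<open>Each rule is sound because the removed direction is impossible in every DAG of the
  class: it would create a new v-structure (first rule) or a cycle (second rule). For the third rule
  acyclicity would force \<open>k \<rightarrow> i \<leftarrow> l\<close>, a v-structure that would
  have been oriented already.\<close>

lemma meek_step_inv:
  assumes "meek_step P P'" and E: "dag p E" and inv: "meek_inv p E P"
  shows "meek_inv p E P'"
proof -
  have vdir: "\<And>x y z. v_structure E x y z \<Longrightarrow> (y, x) \<notin> P \<and> (y, z) \<notin> P"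
  proof -
    fix x y z assume v: "v_structure E x y z"
    then have "v_structure E z y x" unfolding v_structure_def skeleton_iff by blast
    then show "(y, x) \<notin> P \<and> (y, z) \<notin> P" using v inv unfolding meek_inv_def by blast
  qed
  have Psk: "P \<subseteq> skeleton E" using inv unfolding meek_inv_def by blast
  have edge: "(x, y) \<in> H" if "same_pattern E H" "H \<subseteq> P" "directed P x y" for H x y
  proof -
    have "(x, y) \<in> skeleton H" using that Psk unfolding same_pattern_def directed_def by auto
    then show ?thesis using that unfolding skeleton_iff directed_def by blast
  qed
  have nadj: "(x, y) \<notin> skeleton H" if "same_pattern E H" "nonadjacent P x y" for H x y
  proof -
    have "E \<subseteq> P" using inv E unfolding meek_inv_def same_pattern_def by blast
    then have "(x, y) \<notin> skeleton E" using that(2) unfolding skeleton_iff nonadjacent_def by blast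
    then show ?thesis using that(1) unfolding same_pattern_def by simp
  qed
  have tot: "(x, y) \<in> H \<or> (y, x) \<in> H" if "same_pattern E H" "undirected P x y" for H x y
    using that Psk unfolding same_pattern_def undirected_def skeleton_iff[symmetric] by auto
  have vH: "v_structure E x y z" if "same_pattern E H" "(x, y) \<in> H" "(z, y) \<in> H" "x \<noteq> z" "nonadjacent P x z" for H x y z
    using that nadj[OF that(1,5)] unfolding same_pattern_def by (simp add: v_structure_def)
  show ?thesis using assms(1)
  proof cases
    case (rule1 j k i)
    have ik: "i \<noteq> k" using rule1 unfolding undirected_def directed_def by blast
    have kj: "(k, j) \<notin> H" if "dag p H" "same_pattern E H" "H \<subseteq> P" for H
    proof
      assume "(k, j) \<in> H"
      then have "v_structure E i j k" using vH that edge[OF that(2,3) rule1(3)] ik rule1(4) by blast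
      then show False using vdir rule1(2) unfolding undirected_def by blast
    qed
    have "directed (P - {(k, j)}) i j" "nonadjacent (P - {(k, j)}) i k"
      using rule1 unfolding directed_def undirected_def nonadjacent_def by auto
    then have "oriented_reason E (P - {(k, j)}) j k" unfolding oriented_reason_def by blast
    then show ?thesis using meek_inv_remove[OF E inv rule1(2)] kj rule1(1) by blast
  next
    case (rule2 i j k)
    have ji: "(j, i) \<notin> H" if "dag p H" "same_pattern E H" "H \<subseteq> P" for H
    proof
      assume "(j, i) \<in> H"
      moreover have "(i, k) \<in> H" "(k, j) \<in> H" using edge that rule2 by blast+
      moreover have "acyclic H" using that(1) unfolding dag_def by simp
      ultimately show False using acyclic_edgeD(3)[of H j i] by (meson r_into_rtrancl rtrancl_into_rtrancl)
    qed
    have "directed (P - {(j, i)}) i k" "directed (P - {(j, i)}) k j"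
      using rule2 unfolding directed_def undirected_def by auto
    then have "oriented_reason E (P - {(j, i)}) i j" unfolding oriented_reason_def by blast
    then show ?thesis using meek_inv_remove[OF E inv rule2(2)] ji rule2(1) by blast
  next
    case (rule3 i j k l)
    have ji: "(j, i) \<notin> H" if H: "dag p H" "same_pattern E H" "H \<subseteq> P" for H
    proof
      assume a: "(j, i) \<in> H"
      have ac: "acyclic H" using H(1) unfolding dag_def by simp
      have into: "(m, i) \<in> H" if m: "undirected P i m" "directed P m j" for m
      proof (rule ccontr)
        assume "(m, i) \<notin> H"
        then have "(i, m) \<in> H" using tot[OF H(2) m(1)] by blast
        moreover have "(m, j) \<in> H" using edge[OF H(2,3) m(2)] .
        ultimately show False using acyclic_edgeD(3)[OF ac a] by (meson r_into_rtrancl rtrancl_into_rtrancl)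
      qed
      have "v_structure E k i l" using vH[OF H(2) into into] rule3 by blast
      then show False using vdir rule3(3) unfolding undirected_def by blast
    qed
    have nv: "\<not> v_structure E k i l" using vdir rule3(3) unfolding undirected_def by blast
    have "directed (P - {(j, i)}) k j" "directed (P - {(j, i)}) l j" "\<not> nonadjacent (P - {(j, i)}) i k"
      "\<not> nonadjacent (P - {(j, i)}) i l" "nonadjacent (P - {(j, i)}) k l"
      using rule3 unfolding directed_def undirected_def nonadjacent_def by auto
    then have "oriented_reason E (P - {(j, i)}) i j" using rule3(7) nv unfolding oriented_reason_def by blast
    then show ?thesis using meek_inv_remove[OF E inv rule3(2)] ji rule3(1) by blast
  qed
qed

lemma pc_output_correct:
  assumes E: "dag p E" and Q: "correct_query p E Q (max_degree p E)" and out: "pc_output p Q P"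
  shows "P = cpdag p E"
proof -
  have ac: "acyclic E" using E unfolding dag_def by simp
  obtain D Sep ts P0 where
    sk: "skel_from Q 0 (complete_graph p, \<lambda>_. {}) (D, Sep)" and
    ts: "set ts = unshielded_colliders D Sep" "orient_colliders ts D P0" and
    mk: "meek_step\<^sup>*\<^sup>* P0 P" and cl: "\<nexists>P'. meek_step P P'"
    using out unfolding pc_output_def by blast
  have "skel_inv p E (complete_graph p, \<lambda>_. {})"
    using dag_skeleton_sub[OF E] unfolding skel_inv_def complete_graph_def by (auto simp: sym_def)
  then have "skel_inv p E (D, Sep) \<and> fst (D, Sep) = skeleton E"
    by (rule skel_from_skeleton[OF sk E Q]) simp
  then have D: "D = skeleton E" and si: "skel_inv p E (skeleton E, Sep)" by auto
  have ts': "set ts = {(u, v, w). u < w \<and> v_structure E u v w}"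
    using unshielded_colliders_v_structure[OF E si] ts(1) D by simp
  have "P0 = skeleton E - {(v, x) |u v w x. (u, v, w) \<in> set ts \<and> (x = u \<or> x = w)}"
    using orient_colliders_result[OF ts(2) ac] unfolding D ts' v_structure_def skeleton_def by auto
  \<comment> \<open>A collider is listed once, with \<open>u < w\<close>, but both of its edges are
    oriented; symmetry of v-structures reconciles the two descriptions.\<close>
  moreover have "{(v, x) |u v w x. (u, v, w) \<in> set ts \<and> (x = u \<or> x = w)} = {(v, u) |u v w. v_structure E u v w}"
  proof -
    have vs: "v_structure E w v u" if "v_structure E u v w" for u v w
      using that unfolding v_structure_def skeleton_iff by blast
    have "\<exists>a b. (a, v, b) \<in> set ts \<and> (u = a \<or> u = b)" if "v_structure E u v w" for u v w
    proof (cases "u < w")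
      case True
      then have "(u, v, w) \<in> set ts" using that unfolding ts' by simp
      then show ?thesis by blast
    next
      case False
      then have "w < u" using that unfolding v_structure_def by auto
      then have "(w, v, u) \<in> set ts" using vs[OF that] unfolding ts' by simp
      then show ?thesis by blast
    qed
    moreover have "\<exists>b. v_structure E x v b" if "(u, v, w) \<in> set ts" "x = u \<or> x = w" for u v w x
      using that vs unfolding ts' by auto
    ultimately show ?thesis by blast
  qed
  ultimately have P0: "P0 = skeleton E - {(v, u) |u v w. v_structure E u v w}" by simp
  have "meek_inv p E P0" unfolding meek_inv_def
  proof (intro conjI allI impI)
    show "P0 \<subseteq> skeleton E" unfolding P0 by blast
    show "(y, x) \<notin> P0" if "v_structure E x y z" for x y z using that unfolding P0 by blast
    \<comment> \<open>An initial arrow stems from a v-structure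
      \<open>i \<rightarrow> j \<leftarrow> w\<close>; the other arrow of it is the reason.\<close>
    show "oriented_reason E P0 i j" if d: "directed P0 i j" for i j
    proof -
      have "(j, i) \<in> skeleton E" "(j, i) \<notin> P0"
        using d unfolding directed_def P0 by (auto simp: skeleton_iff)
      then have "(j, i) \<in> {(v, u) |u v w. v_structure E u v w}" unfolding P0 by blast
      then obtain w where v: "v_structure E i j w" by blast
      then have v': "v_structure E w j i" unfolding v_structure_def skeleton_iff by blast
      have "(i, j) \<in> E" "(w, j) \<in> E" "w \<noteq> i" "(w, i) \<notin> skeleton E" "(i, w) \<notin> skeleton E"
        using v v' unfolding v_structure_def by auto
      moreover have "(w, j) \<notin> {(v, u) |u v w. v_structure E u v w}"
        using calculation(2) acyclic_edgeD(1)[OF ac] unfolding v_structure_def by blast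
      ultimately have "directed P0 w j" "nonadjacent P0 w i"
        using v' unfolding directed_def nonadjacent_def P0 by (auto simp: skeleton_iff)
      then show ?thesis using \<open>w \<noteq> i\<close> unfolding oriented_reason_def by blast
    qed
    show "H \<subseteq> P0" if H: "dag p H \<and> same_pattern E H" for H
    proof
      fix e assume e: "e \<in> H"
      have acH: "acyclic H" using H unfolding dag_def by simp
      have "e \<notin> {(v, u) |u v w. v_structure E u v w}"
        using e H acyclic_edgeD(1)[OF acH] unfolding same_pattern_def by (auto simp: v_structure_def)
      then show "e \<in> P0" using e H unfolding P0 same_pattern_def skeleton_def by blast
    qed
  qed
  with mk have inv: "meek_inv p E P"
    by (induction rule: rtranclp_induct) (auto intro: meek_step_inv[OF _ E])
  have "E \<subseteq> P" using inv E unfolding meek_inv_def same_pattern_def by blast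
  then interpret meek_closed p E P
    using inv E cl unfolding meek_inv_def by unfold_locales blast+
  show ?thesis
  proof
    show "P \<subseteq> cpdag p E"
    proof
      fix e assume "e \<in> P"
      then obtain H where "dag p H" "same_pattern E H" "e \<in> H" using edge_in_class by (cases e) blast
      then show "e \<in> cpdag p E"
        using same_pattern_markov_equivalent[OF E] unfolding cpdag_def dag_def by blast
    qed
    show "cpdag p E \<subseteq> P"
      using inv markov_equivalent_same_pattern[OF E] unfolding meek_inv_def cpdag_def by blast
  qed
qed

section \<open>Linear algebra on finite index sets\<close>

text \<open>Matrices appear here as functions with an explicit index set, so that passing to a
  principal submatrix means shrinking \<open>I\<close>, without any renumbering.\<close>

definition quad :: "nat set \<Rightarrow> (nat \<Rightarrow> nat \<Rightarrow> real) \<Rightarrow> (nat \<Rightarrow> real) \<Rightarrow> real" where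
  "quad I A x = (\<Sum>i\<in>I. \<Sum>j\<in>I. x i * A i j * x j)"

definition sym_on :: "nat set \<Rightarrow> (nat \<Rightarrow> nat \<Rightarrow> real) \<Rightarrow> bool" where
  "sym_on I A \<longleftrightarrow> (\<forall>i\<in>I. \<forall>j\<in>I. A i j = A j i)"

definition inv_on :: "nat set \<Rightarrow> (nat \<Rightarrow> nat \<Rightarrow> real) \<Rightarrow> (nat \<Rightarrow> nat \<Rightarrow> real) \<Rightarrow> bool" where
  "inv_on I A K \<longleftrightarrow> (\<forall>i\<in>I. \<forall>l\<in>I. (\<Sum>k\<in>I. A i k * K k l) = (if i = l then 1 else 0))"

text \<open>For symmetric \<open>A\<close> and nonempty \<open>I\<close> this says that the least
  eigenvalue is at least \<open>c\<close>; in this form it passes to subsets and survives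
  perturbation directly.\<close>

definition coercive_on :: "nat set \<Rightarrow> (nat \<Rightarrow> nat \<Rightarrow> real) \<Rightarrow> real \<Rightarrow> bool" where
  "coercive_on I A c \<longleftrightarrow> (\<forall>x. c * (\<Sum>i\<in>I. (x i)\<^sup>2) \<le> quad I A x)"

lemma bilinear_inv_right:
  assumes "finite I" "inv_on I A K" "l \<in> I"
  shows "(\<Sum>i\<in>I. \<Sum>k\<in>I. x i * A i k * K k l) = x l"
proof -
  have "(\<Sum>i\<in>I. \<Sum>k\<in>I. x i * A i k * K k l) = (\<Sum>i\<in>I. x i * (\<Sum>k\<in>I. A i k * K k l))"
    by (simp add: sum_distrib_left mult.assoc)
  also have "\<dots> = (\<Sum>i\<in>I. x i * (if i = l then 1 else 0))"
    using assms unfolding inv_on_def by (intro sum.cong) auto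
  also have "\<dots> = (\<Sum>i\<in>I. if i = l then x i else 0)" by (intro sum.cong) auto
  also have "\<dots> = x l" using assms by simp
  finally show ?thesis .
qed

lemma bilinear_inv_left:
  assumes "finite I" "inv_on I A K" "sym_on I A" "l \<in> I"
  shows "(\<Sum>i\<in>I. \<Sum>k\<in>I. K i l * A i k * x k) = x l"
proof -
  have "(\<Sum>i\<in>I. \<Sum>k\<in>I. K i l * A i k * x k) = (\<Sum>k\<in>I. \<Sum>i\<in>I. K i l * A i k * x k)"
    by (rule sum.swap)
  also have "\<dots> = (\<Sum>k\<in>I. \<Sum>i\<in>I. x k * A k i * K i l)"
    using assms(3) unfolding sym_on_def by (intro sum.cong) auto
  finally show ?thesis using bilinear_inv_right[OF assms(1,2,4)] by simp
qed

lemma inv_on_sym: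
  assumes "finite I" "sym_on I A" "inv_on I A K"
  shows "sym_on I K"
  unfolding sym_on_def
proof (intro ballI)
  fix i l assume "i \<in> I" "l \<in> I"
  then show "K i l = K l i"
    using bilinear_inv_right[OF assms(1,3), of i "\<lambda>j. K j l"]
      bilinear_inv_left[OF assms(1,3,2), of l "\<lambda>k. K k i"] by simp
qed

lemma inv_on_unique:
  assumes "finite I" "sym_on I A" "inv_on I A K" "inv_on I A L" "i \<in> I" "l \<in> I"
  shows "K i l = L i l"
proof -
  have "L i l = (\<Sum>j\<in>I. \<Sum>k\<in>I. K j i * A j k * L k l)"
    using bilinear_inv_left[OF assms(1,3,2,5)] by simp
  also have "\<dots> = K l i" using bilinear_inv_right[OF assms(1,4,6)] by simp
  also have "\<dots> = K i l" using inv_on_sym[OF assms(1-3)] assms(5,6) unfolding sym_on_def by auto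
  finally show ?thesis by simp
qed

lemma quad_inv_column:
  assumes "finite I" "inv_on I A K" "l \<in> I"
  shows "quad I A (\<lambda>k. K k l) = K l l"
  unfolding quad_def by (rule bilinear_inv_right[OF assms])

lemma quad_diff:
  assumes "sym_on I A"
  shows "quad I A (\<lambda>i. x i - t * y i) = quad I A x - 2 * t * (\<Sum>i\<in>I. \<Sum>j\<in>I. y i * A i j * x j) + t\<^sup>2 * quad I A y"
proof -
  have sw: "(\<Sum>i\<in>I. \<Sum>j\<in>I. x i * A i j * y j) = (\<Sum>i\<in>I. \<Sum>j\<in>I. y i * A i j * x j)"
    by (subst sum.swap) (use assms in \<open>auto simp: sym_on_def intro!: sum.cong\<close>)
  have "quad I A (\<lambda>i. x i - t * y i) = (\<Sum>i\<in>I. \<Sum>j\<in>I. x i * A i j * x j - t * (x i * A i j * y j)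
     - t * (y i * A i j * x j) + t\<^sup>2 * (y i * A i j * y j))"
    unfolding quad_def by (intro sum.cong) (auto simp: algebra_simps power2_eq_square)
  also have "\<dots> = quad I A x - t * (\<Sum>i\<in>I. \<Sum>j\<in>I. x i * A i j * y j)
     - t * (\<Sum>i\<in>I. \<Sum>j\<in>I. y i * A i j * x j) + t\<^sup>2 * quad I A y"
    unfolding quad_def by (simp add: sum.distrib sum_subtractf sum_distrib_left)
  finally show ?thesis using sw by simp
qed

text \<open>The quadratic form at column \<open>l\<close> of the inverse is \<open>K l l\<close>.
  Coercivity bounds it below by \<open>c\<close> times the squared norm of the column, which in turn
  is at least \<open>(K l l)^2\<close>.\<close>

lemma coercive_inv_bounds:
  assumes fin: "finite I" and s: "sym_on I A" and K: "inv_on I A K" and c: "coercive_on I A c" "0 < c"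
    and l: "l \<in> I"
  shows "0 \<le> K l l" "K l l \<le> 1 / c" "(\<Sum>k\<in>I. (K k l)\<^sup>2) \<le> (1 / c)\<^sup>2"
proof -
  have q: "c * (\<Sum>k\<in>I. (K k l)\<^sup>2) \<le> K l l"
    using c(1) quad_inv_column[OF fin K l] unfolding coercive_on_def by metis
  have n: "0 \<le> (\<Sum>k\<in>I. (K k l)\<^sup>2)" by (intro sum_nonneg) auto
  show p: "0 \<le> K l l" using q n c(2) by (meson mult_nonneg_nonneg less_imp_le order_trans)
  have "(K l l)\<^sup>2 \<le> (\<Sum>k\<in>I. (K k l)\<^sup>2)" using member_le_sum[OF l, of "\<lambda>k. (K k l)\<^sup>2"] fin by auto
  then have "c * (K l l)\<^sup>2 \<le> K l l" using q c(2) by (meson mult_left_mono less_imp_le order_trans)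
  then have "K l l * (c * K l l) \<le> K l l * 1" by (simp add: power2_eq_square algebra_simps)
  then have "K l l = 0 \<or> c * K l l \<le> 1" using p mult_le_cancel_left[of "K l l" "c * K l l" 1] by linarith
  then show b: "K l l \<le> 1 / c" using c(2) by (auto simp: field_simps)
  have "(\<Sum>k\<in>I. (K k l)\<^sup>2) \<le> K l l / c" using q c(2) by (simp add: field_simps)
  also have "\<dots> \<le> (1 / c) / c" using b c(2) by (intro divide_right_mono) auto
  finally show "(\<Sum>k\<in>I. (K k l)\<^sup>2) \<le> (1 / c)\<^sup>2" by (simp add: power2_eq_square)
qed

text \<open>The form at the difference of column \<open>l\<close> and the unit vector
  \<open>l\<close> is nonnegative and equals \<open>K l l - 2 + A l l\<close>.\<close>

lemma inv_diag_ge_1: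
  assumes fin: "finite I" and s: "sym_on I A" and K: "inv_on I A K" and c: "coercive_on I A c" "0 < c"
    and l: "l \<in> I" "A l l = 1"
  shows "1 \<le> K l l"
proof -
  let ?e = "\<lambda>i. if i = l then 1 else 0 :: real"
  have ql: "quad I A ?e = 1"
    unfolding quad_def using l fin by (simp add: if_distrib[of "\<lambda>z. z * _"] if_distrib[of "(*) _"] cong: if_cong)
  have "0 \<le> c * (\<Sum>i\<in>I. (K i l - 1 * ?e i)\<^sup>2)" using c(2) by (intro mult_nonneg_nonneg sum_nonneg) auto
  also have "\<dots> \<le> quad I A (\<lambda>i. K i l - 1 * ?e i)" using c(1) unfolding coercive_on_def by fast
  also have "\<dots> = K l l - 2 * (\<Sum>i\<in>I. \<Sum>j\<in>I. ?e i * A i j * K j l) + 1"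
    unfolding quad_diff[OF s] using quad_inv_column[OF fin K l(1)] ql by simp
  also have "\<dots> = K l l - 2 + 1" using bilinear_inv_right[OF fin K l(1), of ?e] by simp
  finally show ?thesis by simp
qed

lemma abs_bilinear_le:
  fixes x y :: "nat \<Rightarrow> real"
  assumes fin: "finite I" and e: "\<And>i j. i \<in> I \<Longrightarrow> j \<in> I \<Longrightarrow> \<bar>D i j\<bar> \<le> e" and e0: "0 \<le> e"
  shows "\<bar>\<Sum>i\<in>I. \<Sum>j\<in>I. x i * D i j * y j\<bar> \<le> e * ((\<Sum>i\<in>I. \<bar>x i\<bar>) * (\<Sum>j\<in>I. \<bar>y j\<bar>))"
proof -
  have "\<bar>\<Sum>i\<in>I. \<Sum>j\<in>I. x i * D i j * y j\<bar> \<le> (\<Sum>i\<in>I. \<bar>\<Sum>j\<in>I. x i * D i j * y j\<bar>)"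
    by (rule sum_abs)
  also have "\<dots> \<le> (\<Sum>i\<in>I. \<Sum>j\<in>I. \<bar>x i * D i j * y j\<bar>)" by (intro sum_mono sum_abs)
  also have "\<dots> \<le> (\<Sum>i\<in>I. \<Sum>j\<in>I. e * (\<bar>x i\<bar> * \<bar>y j\<bar>))"
  proof (intro sum_mono)
    fix i j assume "i \<in> I" "j \<in> I"
    then have "\<bar>D i j\<bar> * (\<bar>x i\<bar> * \<bar>y j\<bar>) \<le> e * (\<bar>x i\<bar> * \<bar>y j\<bar>)" using e by (intro mult_right_mono) auto
    then show "\<bar>x i * D i j * y j\<bar> \<le> e * (\<bar>x i\<bar> * \<bar>y j\<bar>)" by (simp add: abs_mult algebra_simps)
  qed
  also have "\<dots> = e * ((\<Sum>i\<in>I. \<bar>x i\<bar>) * (\<Sum>j\<in>I. \<bar>y j\<bar>))"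
    unfolding sum_product by (simp add: sum_distrib_left)
  finally show ?thesis .
qed

lemma sum_abs_le:
  assumes "(\<Sum>i\<in>I. (x i)\<^sup>2) \<le> b\<^sup>2" "0 \<le> b" "real (card I) \<le> q"
  shows "(\<Sum>i\<in>I. \<bar>x i :: real\<bar>) \<le> sqrt q * b"
proof -
  have q: "0 \<le> q" using assms(3) by (rule order_trans[rotated]) simp
  have "(\<Sum>i\<in>I. \<bar>x i\<bar>)\<^sup>2 \<le> (\<Sum>i\<in>I. \<bar>x i\<bar>\<^sup>2) * real (card I)" by (rule sum_squared_le_sum_of_squares)
  also have "\<dots> \<le> b\<^sup>2 * q" using assms by (intro mult_mono) auto
  also have "\<dots> = (sqrt q * b)\<^sup>2" using q by (simp add: power_mult_distrib)
  finally show ?thesis by (rule power2_le_imp_le) (use q assms(2) in simp)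
qed

text \<open>The form changes by at most \<open>e\<close> times the squared l1 norm, which
  Cauchy-Schwarz bounds by \<open>q\<close> times the squared l2 norm.\<close>

lemma coercive_perturb:
  assumes fin: "finite I" and c: "coercive_on I A c"
    and D: "\<And>i j. i \<in> I \<Longrightarrow> j \<in> I \<Longrightarrow> \<bar>A' i j - A i j\<bar> \<le> e" "0 \<le> e" and q: "real (card I) \<le> q"
  shows "coercive_on I A' (c - q * e)"
  unfolding coercive_on_def
proof
  fix x :: "nat \<Rightarrow> real"
  let ?s = "\<Sum>i\<in>I. (x i)\<^sup>2"
  have s: "0 \<le> ?s" by (intro sum_nonneg) auto
  have "(\<Sum>i\<in>I. \<bar>x i\<bar>) \<le> sqrt q * sqrt ?s" using s q by (intro sum_abs_le) auto
  then have "(\<Sum>i\<in>I. \<bar>x i\<bar>) * (\<Sum>i\<in>I. \<bar>x i\<bar>) \<le> (sqrt q * sqrt ?s) * (sqrt q * sqrt ?s)"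
    using s q by (intro mult_mono) (auto intro: sum_nonneg)
  also have "\<dots> = (sqrt q)\<^sup>2 * (sqrt ?s)\<^sup>2" by (simp add: power2_eq_square algebra_simps)
  also have "\<dots> = q * ?s" using s q by simp
  finally have "e * ((\<Sum>i\<in>I. \<bar>x i\<bar>) * (\<Sum>i\<in>I. \<bar>x i\<bar>)) \<le> e * (q * ?s)" using D(2) by (rule mult_left_mono)
  moreover have "\<bar>\<Sum>i\<in>I. \<Sum>j\<in>I. x i * (A' i j - A i j) * x j\<bar> \<le> e * ((\<Sum>i\<in>I. \<bar>x i\<bar>) * (\<Sum>i\<in>I. \<bar>x i\<bar>))"
    using abs_bilinear_le[OF fin, of "\<lambda>i j. A' i j - A i j" e] D by auto
  moreover have "quad I A' x - quad I A x = (\<Sum>i\<in>I. \<Sum>j\<in>I. x i * (A' i j - A i j) * x j)"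
    unfolding quad_def by (simp add: sum_subtractf[symmetric] algebra_simps)
  moreover have "c * ?s \<le> quad I A x" using c unfolding coercive_on_def by blast
  ultimately show "(c - q * e) * ?s \<le> quad I A' x" by (simp add: algebra_simps)
qed

text \<open>Uses \<open>K - K' = K' (A' - A) K\<close>. As \<open>A'\<close> is still coercive with
  constant \<open>c / 2\<close>, the columns of \<open>K'\<close> and \<open>K\<close> have l1 norms
  at most \<open>sqrt q * 2 / c\<close> and \<open>sqrt q / c\<close>.\<close>

lemma inv_perturb:
  assumes fin: "finite I" and s: "sym_on I A" "sym_on I A'" and K: "inv_on I A K" "inv_on I A' K'"
    and c: "coercive_on I A c" "0 < c" and D: "\<And>i j. i \<in> I \<Longrightarrow> j \<in> I \<Longrightarrow> \<bar>A' i j - A i j\<bar> \<le> e" "0 \<le> e"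
    and q: "real (card I) \<le> q" "q * e \<le> c / 2" and il: "i \<in> I" "l \<in> I"
  shows "\<bar>K' i l - K i l\<bar> \<le> 2 * q * e / c\<^sup>2"
proof -
  have c': "coercive_on I A' (c / 2)"
    unfolding coercive_on_def
  proof
    fix x :: "nat \<Rightarrow> real"
    have "0 \<le> (\<Sum>i\<in>I. (x i)\<^sup>2)" by (intro sum_nonneg) auto
    then have "c / 2 * (\<Sum>i\<in>I. (x i)\<^sup>2) \<le> (c - q * e) * (\<Sum>i\<in>I. (x i)\<^sup>2)"
      using q(2) by (intro mult_right_mono) auto
    also have "\<dots> \<le> quad I A' x" using coercive_perturb[OF fin c(1) D q(1)] unfolding coercive_on_def by blast
    finally show "c / 2 * (\<Sum>i\<in>I. (x i)\<^sup>2) \<le> quad I A' x" .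
  qed
  have "K i l - K' i l = (\<Sum>j\<in>I. \<Sum>k\<in>I. K' j i * (A' j k - A j k) * K k l)"
  proof -
    have "(\<Sum>j\<in>I. \<Sum>k\<in>I. K' j i * (A' j k - A j k) * K k l)
        = (\<Sum>j\<in>I. \<Sum>k\<in>I. K' j i * A' j k * K k l) - (\<Sum>j\<in>I. \<Sum>k\<in>I. K' j i * A j k * K k l)"
      by (simp add: sum_subtractf[symmetric] algebra_simps)
    also have "\<dots> = K i l - K' l i"
      using bilinear_inv_left[OF fin K(2) s(2) il(1)] bilinear_inv_right[OF fin K(1) il(2)] by simp
    finally show ?thesis using inv_on_sym[OF fin s(2) K(2)] il unfolding sym_on_def by simp
  qed
  then have "\<bar>K' i l - K i l\<bar> \<le> e * ((\<Sum>j\<in>I. \<bar>K' j i\<bar>) * (\<Sum>k\<in>I. \<bar>K k l\<bar>))"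
    using abs_bilinear_le[OF fin, of "\<lambda>j k. A' j k - A j k" e "\<lambda>j. K' j i" "\<lambda>k. K k l"] D
    by (simp add: abs_minus_commute)
  also have "\<dots> \<le> e * ((sqrt q * (1 / (c / 2))) * (sqrt q * (1 / c)))"
    using coercive_inv_bounds(3)[OF fin s(1) K(1) c il(2)]
      coercive_inv_bounds(3)[OF fin s(2) K(2) c' _ il(1)] c(2) q(1) D(2)
    by (intro mult_left_mono mult_mono sum_abs_le) (auto intro: sum_nonneg)
  also have "\<dots> = e * ((sqrt q)\<^sup>2 * (2 / c\<^sup>2))" by (simp add: power2_eq_square)
  also have "\<dots> = 2 * q * e / c\<^sup>2" using q(1) by simp
  finally show ?thesis .
qed

lemma quad_extend:
  assumes "finite J" "I \<subseteq> J"
  shows "quad J A (\<lambda>i. if i \<in> I then x i else 0) = quad I A x"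
proof -
  have "quad J A (\<lambda>i. if i \<in> I then x i else 0) = (\<Sum>i\<in>J. if i \<in> I then (\<Sum>j\<in>J. if j \<in> I then x i * A i j * x j else 0) else 0)"
    unfolding quad_def by (auto intro!: sum.cong)
  also have "\<dots> = (\<Sum>i\<in>J. if i \<in> I then (\<Sum>j\<in>I. x i * A i j * x j) else 0)"
    using assms by (simp add: sum.inter_restrict[symmetric] Int_absorb1)
  also have "\<dots> = quad I A x"
    unfolding quad_def using assms by (simp add: sum.inter_restrict[symmetric] Int_absorb1)
  finally show ?thesis .
qed

lemma coercive_subset:
  assumes "finite J" "I \<subseteq> J" "coercive_on J A c"
  shows "coercive_on I A c"
  unfolding coercive_on_def
proof
  fix x :: "nat \<Rightarrow> real"
  have "(\<Sum>i\<in>J. (if i \<in> I then x i else 0)\<^sup>2) = (\<Sum>i\<in>J. if i \<in> I then (x i)\<^sup>2 else 0)"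
    by (intro sum.cong) auto
  also have "\<dots> = (\<Sum>i\<in>I. (x i)\<^sup>2)" using assms by (simp add: sum.inter_restrict[symmetric] Int_absorb1)
  finally show "c * (\<Sum>i\<in>I. (x i)\<^sup>2) \<le> quad I A x"
    using assms(3) quad_extend[OF assms(1,2), of A x] unfolding coercive_on_def by metis
qed

text \<open>If \<open>k = 0\<close>, then \<open>k'\<close> is at most \<open>c / 4\<close> in
  modulus and the denominator is at least 1. If not, the modulus of \<open>k\<close> is at least
  \<open>c * sqrt (a * b)\<close>, while an estimate below the threshold would bound it by
  \<open>c / 4 * 2 * sqrt (a * b) + c / 4\<close>, which is at most three quarters of that.\<close>

lemma partial_correlation_threshold:
  fixes a b k a' b' k' :: real
  assumes ge: "1 \<le> a" "1 \<le> b" "1 \<le> a'" "1 \<le> b'"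
    and d: "\<bar>a' - a\<bar> \<le> d" "\<bar>b' - b\<bar> \<le> d" "\<bar>k' - k\<bar> \<le> d" "d \<le> c / 4" and c: "0 < c" "c \<le> 1"
    and k: "k = 0 \<or> c \<le> \<bar>- k / sqrt (a * b)\<bar>"
  shows "\<bar>- k' / sqrt (a' * b')\<bar> \<le> c / 4 \<longleftrightarrow> k = 0"
proof -
  have s: "1 \<le> sqrt (a * b)" "1 \<le> sqrt (a' * b')"
    using ge mult_mono[of 1 a 1 b] mult_mono[of 1 a' 1 b'] by auto
  have d0: "0 \<le> d" using d(1) by linarith
  show ?thesis
  proof
    assume "k = 0"
    then have "\<bar>k'\<bar> \<le> c / 4" using d by auto
    moreover have "\<bar>k'\<bar> / sqrt (a' * b') \<le> \<bar>k'\<bar> / 1" using s by (intro divide_left_mono) auto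
    moreover have "\<bar>- k' / sqrt (a' * b')\<bar> = \<bar>k'\<bar> / sqrt (a' * b')" using s by (simp add: abs_divide)
    ultimately show "\<bar>- k' / sqrt (a' * b')\<bar> \<le> c / 4" by linarith
  next
    assume le: "\<bar>- k' / sqrt (a' * b')\<bar> \<le> c / 4"
    show "k = 0"
    proof (rule ccontr)
      assume "k \<noteq> 0"
      then have ck: "c * sqrt (a * b) \<le> \<bar>k\<bar>" using k s by (auto simp: abs_divide field_simps)
      have "a' \<le> a * (1 + d)" "b' \<le> b * (1 + d)"
        using d ge d0 mult_right_mono[of 1 a d] mult_right_mono[of 1 b d] by (auto simp: algebra_simps)
      then have "a' * b' \<le> (a * b) * (1 + d)\<^sup>2"
        using mult_mono[of a' "a * (1 + d)" b' "b * (1 + d)"] ge d0 by (auto simp: power2_eq_square algebra_simps)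
      then have "sqrt (a' * b') \<le> sqrt (a * b) * (1 + d)"
        using d0 by (metis real_sqrt_le_mono real_sqrt_mult real_sqrt_unique add_nonneg_nonneg zero_le_one)
      then have "c / 4 * sqrt (a' * b') \<le> c / 4 * (sqrt (a * b) * (1 + c / 4))"
        using c d(4) s by (intro mult_left_mono) (auto intro: order_trans mult_left_mono)
      moreover have "\<bar>k'\<bar> \<le> c / 4 * sqrt (a' * b')" using le s by (auto simp: abs_divide field_simps)
      moreover have "\<bar>k\<bar> \<le> \<bar>k'\<bar> + c / 4" using d(3,4) by linarith
      ultimately have "\<bar>k\<bar> \<le> c / 4 * (sqrt (a * b) * (1 + c / 4)) + c / 4" by linarith
      moreover have "c / 4 * (sqrt (a * b) * (1 + c / 4)) \<le> c / 4 * (sqrt (a * b) * 2)"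
        using c s by (intro mult_left_mono) auto
      moreover have "c / 4 \<le> c / 4 * sqrt (a * b)" using c s by simp
      moreover have "0 < c * sqrt (a * b)" using c s by (intro mult_pos_pos) auto
      ultimately show False using ck by (simp add: algebra_simps)
    qed
  qed
qed

section \<open>Principal submatrices and least eigenvalues\<close>

abbreviation entries :: "real mat \<Rightarrow> nat \<Rightarrow> nat \<Rightarrow> real" where
  "entries C i j \<equiv> C $$ (i, j)"

abbreviation rank_in :: "nat set \<Rightarrow> nat \<Rightarrow> nat" where
  "rank_in I u \<equiv> card {a \<in> I. a < u}"

lemma rank_in_less:
  assumes "finite I" "u \<in> I" "u < w" shows "rank_in I u < rank_in I w"
  by (rule psubset_card_mono) (use assms in auto)

lemma bij_rank_in:
  assumes "finite I" shows "bij_betw (rank_in I) I {..<card I}"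
proof -
  have "inj_on (rank_in I) I"
  proof (rule inj_onI)
    fix u w assume "u \<in> I" "w \<in> I" "rank_in I u = rank_in I w"
    then show "u = w"
      using rank_in_less[OF assms, of u w] rank_in_less[OF assms, of w u] by (cases u w rule: linorder_cases) auto
  qed
  moreover have "rank_in I u < card I" if "u \<in> I" for u
    using that assms by (intro psubset_card_mono) auto
  then have "rank_in I ` I \<subseteq> {..<card I}" by blast
  ultimately show ?thesis
    unfolding bij_betw_def using card_image[of "rank_in I" I] by (simp add: card_subset_eq)
qed

lemma rank_in_surj:
  assumes "finite I" "k < card I"
  obtains u where "u \<in> I" "rank_in I u = k"
proof -
  have "k \<in> (\<lambda>u. rank_in I u) ` I" using bij_rank_in[OF assms(1)] assms(2) unfolding bij_betw_def by simp
  then show ?thesis using that by blast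
qed

lemma submatrix_carrier:
  assumes "C \<in> carrier_mat p p" "I \<subseteq> {..<p}"
  shows "submatrix C I I \<in> carrier_mat (card I) (card I)"
proof -
  have "{i. i < p \<and> i \<in> I} = I" using assms(2) by auto
  then show ?thesis using assms(1) dim_submatrix[of C I I] by (intro carrier_matI) simp_all
qed

lemma submatrix_rank_in:
  assumes "C \<in> carrier_mat p p" "I \<subseteq> {..<p}" "i \<in> I" "j \<in> I"
  shows "submatrix C I I $$ (rank_in I i, rank_in I j) = C $$ (i, j)"
  using assms submatrix_index_card[of i C j I I] by auto

lemma sum_rank_in:
  assumes "finite I" shows "(\<Sum>u\<in>I. g (rank_in I u)) = (\<Sum>k<card I. g k)"
  by (rule sum.reindex_bij_betw[OF bij_rank_in[OF assms]])

lemma quad_submatrix: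
  assumes "C \<in> carrier_mat p p" "I \<subseteq> {..<p}"
  shows "quad {..<card I} (entries (submatrix C I I)) y = quad I (entries C) (\<lambda>u. y (rank_in I u))"
proof -
  have fin: "finite I" using assms(2) by (rule finite_subset) simp
  show ?thesis
    unfolding quad_def sum_rank_in[OF fin, symmetric]
    by (intro sum.cong refl) (simp add: submatrix_rank_in[OF assms])
qed

lemma coercive_submatrix:
  assumes C: "C \<in> carrier_mat p p" "I \<subseteq> {..<p}"
    and c: "coercive_on {..<card I} (entries (submatrix C I I)) c"
  shows "coercive_on I (entries C) c"
  unfolding coercive_on_def
proof
  fix x :: "nat \<Rightarrow> real"
  have fin: "finite I" using assms(2) by (rule finite_subset) simp
  define y where "y = x \<circ> inv_into I (rank_in I)"
  have y: "y (rank_in I u) = x u" if "u \<in> I" for u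
    using inv_into_f_eq[OF bij_betw_imp_inj_on[OF bij_rank_in[OF fin]] that refl] unfolding y_def by simp
  have "c * (\<Sum>k<card I. (y k)\<^sup>2) \<le> quad {..<card I} (entries (submatrix C I I)) y"
    using c unfolding coercive_on_def by blast
  also have "\<dots> = quad I (entries C) x"
    unfolding quad_submatrix[OF C] unfolding quad_def by (intro sum.cong) (auto simp: y)
  also have "(\<Sum>k<card I. (y k)\<^sup>2) = (\<Sum>u\<in>I. (x u)\<^sup>2)"
    unfolding sum_rank_in[OF fin, symmetric] by (intro sum.cong) (auto simp: y)
  finally show "c * (\<Sum>i\<in>I. (x i)\<^sup>2) \<le> quad I (entries C) x" .
qed

lemma mat_vec_quad:
  assumes "M \<in> carrier_mat m m" "v \<in> carrier_vec m"
  shows "scalar_prod v (M *\<^sub>v v) = quad {..<m} (entries M) (\<lambda>i. vec_index v i)"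
proof -
  have "vec_index (M *\<^sub>v v) i = (\<Sum>j<m. M $$ (i, j) * vec_index v j)" if "i < m" for i
    using assms that by (simp add: scalar_prod_def atLeast0LessThan)
  then show ?thesis
    using assms unfolding quad_def scalar_prod_def
    by (simp add: sum_distrib_left mult.assoc atLeast0LessThan)
qed

lemma quad_eq_0_of_kernel:
  assumes "M \<in> carrier_mat m m" "v \<in> carrier_vec m" "M *\<^sub>v v = 0\<^sub>v m"
  shows "quad {..<m} (entries M) (\<lambda>i. vec_index v i) = 0"
  using mat_vec_quad[OF assms(1,2)] assms by simp

lemma nonzero_vec_norm:
  assumes "v \<in> carrier_vec m" "v \<noteq> 0\<^sub>v m"
  shows "0 < (\<Sum>i<m. (vec_index v i :: real)\<^sup>2)"
proof -
  obtain i where i: "i < m" "vec_index v i \<noteq> 0" using assms by (metis eq_vecI carrier_vecD index_zero_vec(1,2))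
  have "0 < (vec_index v i)\<^sup>2" using i by simp
  also have "\<dots> \<le> (\<Sum>i<m. (vec_index v i)\<^sup>2)" using i by (intro member_le_sum) auto
  finally show ?thesis .
qed

lemma coercive_imp_det_nonzero:
  assumes "M \<in> carrier_mat m m" "coercive_on {..<m} (entries M) c" "0 < c"
  shows "Determinant.det M \<noteq> 0"
proof
  assume "Determinant.det M = 0"
  then obtain v where v: "v \<in> carrier_vec m" "v \<noteq> 0\<^sub>v m" "M *\<^sub>v v = 0\<^sub>v m"
    using det_0_iff_vec_prod_zero_field[OF assms(1)] by blast
  have "c * (\<Sum>i<m. (vec_index v i)\<^sup>2) \<le> 0"
    using assms(2) quad_eq_0_of_kernel[OF assms(1) v(1,3)] unfolding coercive_on_def by metis
  then show False using nonzero_vec_norm[OF v(1,2)] assms(3) by (simp add: mult_le_0_iff)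
qed

lemma mat_inverse_of_det:
  assumes "M \<in> carrier_mat m m" "Determinant.det M \<noteq> (0::real)"
  shows "\<exists>B. mat_inverse M = Some B \<and> M * B = 1\<^sub>m m \<and> B * M = 1\<^sub>m m \<and> B \<in> carrier_mat m m"
  using mat_inverse[OF assms(1)] det_non_zero_imp_unit[OF assms] by (metis option.exhaust)

lemma mult_entry:
  assumes "M \<in> carrier_mat m m" "B \<in> carrier_mat m m" "i < m" "l < m"
  shows "(M * B) $$ (i, l) = (\<Sum>k<m. M $$ (i, k) * B $$ (k, l))"
  using assms by (simp add: scalar_prod_def atLeast0LessThan)

lemma inv_on_matrix:
  assumes "M \<in> carrier_mat m m" "B \<in> carrier_mat m m" "M * B = 1\<^sub>m m"
  shows "inv_on {..<m} (entries M) (entries B)"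
  unfolding inv_on_def using mult_entry[OF assms(1,2)] assms(3) by (auto simp flip: mult_entry)

text \<open>The bridge from \<open>mat_inverse\<close> of a renumbered submatrix to the calculus on
  index sets.\<close>

lemma inv_entry_inv_on:
  assumes C: "C \<in> carrier_mat p p" "I \<subseteq> {..<p}" and c: "coercive_on I (entries C) c" "0 < c"
  shows "mat_inverse (submatrix C I I) \<noteq> None" "inv_on I (entries C) (inv_entry C I)"
proof -
  have fin: "finite I" using assms(2) by (rule finite_subset) simp
  let ?M = "submatrix C I I" and ?m = "card I"
  have M: "?M \<in> carrier_mat ?m ?m" using submatrix_carrier[OF C] .
  have "coercive_on {..<?m} (entries ?M) c"
    using c(1) unfolding coercive_on_def quad_submatrix[OF C] sum_rank_in[OF fin, symmetric] by simp
  then obtain B where B: "mat_inverse ?M = Some B" "?M * B = 1\<^sub>m ?m" "B \<in> carrier_mat ?m ?m"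
    using mat_inverse_of_det[OF M coercive_imp_det_nonzero[OF M _ c(2)]] by blast
  show "mat_inverse ?M \<noteq> None" using B by simp
  have bij: "bij_betw (rank_in I) I {..<?m}" by (rule bij_rank_in[OF fin])
  show "inv_on I (entries C) (inv_entry C I)"
    unfolding inv_on_def
  proof (intro ballI)
    fix i l assume il: "i \<in> I" "l \<in> I"
    then have r: "rank_in I i < ?m" "rank_in I l < ?m" using bij unfolding bij_betw_def by auto
    have "(\<Sum>k\<in>I. C $$ (i, k) * inv_entry C I k l)
        = (\<Sum>k\<in>I. ?M $$ (rank_in I i, rank_in I k) * B $$ (rank_in I k, rank_in I l))"
      using il B(1) submatrix_rank_in[OF C] unfolding inv_entry_def by (intro sum.cong) auto
    also have "\<dots> = (?M * B) $$ (rank_in I i, rank_in I l)"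
      unfolding mult_entry[OF M B(3) r] by (rule sum_rank_in[OF fin])
    also have "\<dots> = (if i = l then 1 else 0)"
      unfolding B(2) using r il bij unfolding bij_betw_def by (auto dest: inj_onD)
    finally show "(\<Sum>k\<in>I. C $$ (i, k) * inv_entry C I k l) = (if i = l then 1 else 0)" .
  qed
qed

text \<open>
  The infimum \<open>\<mu>\<close> of the Rayleigh quotient is an eigenvalue: otherwise an inverse of \<open>M - \<mu>\<close> would
  give a positive lower bound for the quadratic form of \<open>M - \<mu>\<close> on the unit sphere.
\<close>

lemma sym_eigenvalue_coercive:
  assumes M: "M \<in> carrier_mat m m" "0 < m" and s: "sym_on {..<m} (entries M)"
  shows "\<exists>k. eigenvalue M k \<and> coercive_on {..<m} (entries M) k"
proof -
  let ?I = "{..<m}" and ?A = "entries M"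
  define bnd :: "(nat \<Rightarrow> nat \<Rightarrow> real) \<Rightarrow> real" where "bnd A = (\<Sum>i<m. \<Sum>j<m. \<bar>A i j\<bar>) * real m" for A
  have bnd: "\<bar>quad ?I A y\<bar> \<le> bnd A" if y: "(\<Sum>i<m. (y i)\<^sup>2) = 1" for A y
  proof -
    let ?e = "\<Sum>i<m. \<Sum>j<m. \<bar>A i j\<bar>"
    have "\<bar>A i j\<bar> \<le> ?e" if "i < m" "j < m" for i j
    proof -
      have "\<bar>A i j\<bar> \<le> (\<Sum>j<m. \<bar>A i j\<bar>)" using that by (intro member_le_sum) auto
      also have "\<dots> \<le> ?e" using that by (intro member_le_sum) (auto intro: sum_nonneg)
      finally show ?thesis .
    qed
    then have "\<bar>quad ?I A y\<bar> \<le> ?e * ((\<Sum>i<m. \<bar>y i\<bar>) * (\<Sum>j<m. \<bar>y j\<bar>))"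
      unfolding quad_def by (intro abs_bilinear_le) (auto intro!: sum_nonneg)
    also have "\<dots> \<le> ?e * (sqrt (real m) * sqrt (real m))"
      using sum_abs_le[of y ?I 1 "real m"] y
      by (intro mult_left_mono mult_mono) (auto intro!: sum_nonneg)
    finally show ?thesis unfolding bnd_def by simp
  qed
  define R where "R = {quad ?I ?A y |y. (\<Sum>i<m. (y i)\<^sup>2) = 1}"
  define \<mu> where "\<mu> = Inf R"
  have "(\<Sum>i<m. (if i = 0 then 1 else 0 :: real)\<^sup>2) = (\<Sum>i<m. if i = 0 then 1 else 0)" by (intro sum.cong) auto
  also have "\<dots> = 1" using M(2) by simp
  finally have "quad ?I ?A (\<lambda>i. if i = 0 then 1 else 0) \<in> R"
    unfolding R_def mem_Collect_eq by (intro exI) (rule conjI[OF refl])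
  then have ne: "R \<noteq> {}" by force
  have bdd: "bdd_below R"
  proof (rule bdd_belowI)
    fix r assume "r \<in> R"
    then obtain y where "r = quad ?I ?A y" "(\<Sum>i<m. (y i)\<^sup>2) = 1" unfolding R_def by blast
    then show "- bnd ?A \<le> r" using bnd[of y ?A] by simp
  qed
  have co: "coercive_on ?I ?A \<mu>" unfolding coercive_on_def
  proof
    fix x :: "nat \<Rightarrow> real"
    define s where "s = (\<Sum>i<m. (x i)\<^sup>2)"
    have s0: "0 \<le> s" unfolding s_def by (intro sum_nonneg) auto
    show "\<mu> * (\<Sum>i<m. (x i)\<^sup>2) \<le> quad ?I ?A x"
    proof (cases "s = 0")
      case True
      then have "\<forall>i<m. x i = 0" unfolding s_def by (simp add: sum_nonneg_eq_0_iff)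
      then show ?thesis unfolding quad_def by simp
    next
      case False
      define y where "y i = x i / sqrt s" for i
      have "(\<Sum>i<m. (y i)\<^sup>2) = 1"
        using False s0 unfolding y_def power_divide by (simp add: sum_divide_distrib[symmetric] s_def[symmetric])
      then have "\<mu> \<le> quad ?I ?A y" unfolding \<mu>_def by (intro cInf_lower[OF _ bdd]) (auto simp: R_def)
      also have "quad ?I ?A y = (\<Sum>i<m. \<Sum>j<m. x i * ?A i j * x j / (sqrt s)\<^sup>2)"
        unfolding quad_def y_def by (intro sum.cong) (auto simp: power2_eq_square)
      also have "\<dots> = quad ?I ?A x / s"
        using s0 unfolding quad_def by (simp add: sum_divide_distrib)
      finally show ?thesis using False s0 unfolding s_def[symmetric] by (simp add: field_simps)
    qed
  qed
  moreover have "eigenvalue M \<mu>"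
  proof (rule ccontr)
    assume "\<not> eigenvalue M \<mu>"
    let ?N = "char_matrix M \<mu>"
    have N: "?N \<in> carrier_mat m m" using M(1) by simp
    have "Determinant.det ?N \<noteq> 0" using \<open>\<not> eigenvalue M \<mu>\<close> eigenvalue_det[OF M(1)] by blast
    then obtain B where B: "?N * B = 1\<^sub>m m" "B \<in> carrier_mat m m" using mat_inverse_of_det[OF N] by blast
    define K where "K = entries B"
    have inv: "inv_on ?I (entries ?N) K" unfolding K_def by (rule inv_on_matrix[OF N B(2,1)])
    have Ne: "?N $$ (i, j) = M $$ (i, j) - (if i = j then \<mu> else 0)" if "i < m" "j < m" for i j
      using that M(1) unfolding char_matrix_def by auto
    have sN: "sym_on ?I (entries ?N)" using s unfolding sym_on_def by (auto simp: Ne)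
    have qN: "quad ?I (entries ?N) x = quad ?I ?A x - \<mu> * (\<Sum>i<m. (x i)\<^sup>2)" for x
    proof -
      have "quad ?I (entries ?N) x = (\<Sum>i<m. \<Sum>j<m. x i * ?A i j * x j - (if i = j then \<mu> * (x i)\<^sup>2 else 0))"
        unfolding quad_def by (intro sum.cong) (auto simp: Ne power2_eq_square algebra_simps)
      also have "\<dots> = quad ?I ?A x - (\<Sum>i<m. \<Sum>j<m. if i = j then \<mu> * (x i)\<^sup>2 else 0)"
        unfolding quad_def by (simp add: sum_subtractf)
      also have "(\<Sum>i<m. \<Sum>j<m. if i = j then \<mu> * (x i)\<^sup>2 else 0) = \<mu> * (\<Sum>i<m. (x i)\<^sup>2)"
        by (simp add: sum_distrib_left)
      finally show ?thesis .
    qed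
    \<comment> \<open>\<open>bnd K\<close> bounds the form of the inverse on the unit sphere; the
      added 1 keeps \<open>b\<close> away from 0.\<close>
    define b where "b = bnd K + 1"
    have b1: "1 \<le> b" unfolding b_def bnd_def by (simp add: sum_nonneg)
    have "\<mu> + 1 / b \<le> quad ?I ?A y" if y: "(\<Sum>i<m. (y i)\<^sup>2) = 1" for y
    proof -
      define x where "x j = (\<Sum>k<m. K j k * y k)" for j
      have Nx: "(\<Sum>j<m. ?N $$ (i, j) * x j) = y i" if i: "i < m" for i
      proof -
        have "(\<Sum>j<m. ?N $$ (i, j) * x j) = (\<Sum>j<m. \<Sum>k<m. ?N $$ (i, j) * K j k * y k)"
          unfolding x_def by (simp add: sum_distrib_left mult.assoc)
        also have "\<dots> = (\<Sum>k<m. (\<Sum>j<m. ?N $$ (i, j) * K j k) * y k)"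
          by (subst sum.swap) (simp add: sum_distrib_right)
        also have "\<dots> = (\<Sum>k<m. if i = k then y k else 0)"
          using inv i unfolding inv_on_def by (intro sum.cong) auto
        finally show ?thesis using i by simp
      qed
      have yNx: "(\<Sum>i<m. \<Sum>j<m. z i * ?N $$ (i, j) * x j) = (\<Sum>i<m. z i * y i)" for z
        using Nx by (simp add: sum_distrib_left[symmetric] mult.assoc)
      have "quad ?I (entries ?N) x = quad ?I K y"
        unfolding quad_def yNx unfolding x_def sum_distrib_right by (auto intro!: sum.cong)
      then have "quad ?I (entries ?N) x \<le> b" using bnd[OF y, of K] unfolding b_def by linarith
      moreover have "(\<Sum>i<m. \<Sum>j<m. x i * ?N $$ (i, j) * y j) = 1"
      proof -
        have "(\<Sum>i<m. \<Sum>j<m. x i * ?N $$ (i, j) * y j) = (\<Sum>j<m. \<Sum>i<m. y j * ?N $$ (j, i) * x i)"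
          by (subst sum.swap) (use sN in \<open>auto simp: sym_on_def intro!: sum.cong\<close>)
        then show ?thesis using yNx y by (simp add: power2_eq_square)
      qed
      \<comment> \<open>As \<open>x\<close> solves \<open>N x = y\<close>, expanding the form at
        \<open>y - x / b\<close> gives at least \<open>2 / b - (1 / b)^2 * b = 1 / b\<close> for the
        form at \<open>y\<close>. So \<open>\<mu>\<close> could be raised by
        \<open>1 / b\<close>.\<close>
      moreover have "0 \<le> quad ?I (entries ?N) (\<lambda>i. y i - 1 / b * x i)"
        unfolding qN using co unfolding coercive_on_def by simp
      ultimately have "0 \<le> quad ?I (entries ?N) y - 2 * (1 / b) + (1 / b)\<^sup>2 * b"
        unfolding quad_diff[OF sN] using mult_left_mono[of "quad ?I (entries ?N) x" b "(1 / b)\<^sup>2"] by simp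
      moreover have "(1 / b)\<^sup>2 * b = 1 / b" using b1 by (simp add: power2_eq_square)
      ultimately have "1 / b \<le> quad ?I (entries ?N) y" by simp
      then show ?thesis unfolding qN using y by simp
    qed
    then have "\<mu> + 1 / b \<le> \<mu>" unfolding \<mu>_def using ne by (intro cInf_greatest) (auto simp: R_def)
    then show False using b1 by (simp add: field_simps)
  qed
  ultimately show ?thesis by blast
qed

text \<open>Coercivity with some eigenvalue implies coercivity with the smallest one; the spectrum
  is finite, so that \<open>Min\<close> is attained.\<close>

lemma lambda_min_coercive:
  assumes M: "M \<in> carrier_mat m m" "0 < m" and s: "sym_on {..<m} (entries M)"
  shows "coercive_on {..<m} (entries M) (lambda_min M)" "eigenvalue M (lambda_min M)"
proof -
  have fin: "finite {k. eigenvalue M k}" using card_finite_spectrum(1)[OF M(1)] unfolding spectrum_def .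
  obtain k where k: "eigenvalue M k" "coercive_on {..<m} (entries M) k" using sym_eigenvalue_coercive[OF assms] by blast
  have le: "lambda_min M \<le> k" unfolding lambda_min_def using fin k(1) by (intro Min_le) auto
  have "lambda_min M * (\<Sum>i<m. (x i)\<^sup>2) \<le> quad {..<m} (entries M) x" for x
  proof -
    have "lambda_min M * (\<Sum>i<m. (x i)\<^sup>2) \<le> k * (\<Sum>i<m. (x i)\<^sup>2)"
      using le by (intro mult_right_mono sum_nonneg) auto
    then show ?thesis using k(2) unfolding coercive_on_def by (meson order_trans)
  qed
  then show "coercive_on {..<m} (entries M) (lambda_min M)" unfolding coercive_on_def by blast
  show "eigenvalue M (lambda_min M)" unfolding lambda_min_def using Min_in[OF fin] k(1) by blast
qed

section \<open>Partial correlations\<close>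

lemma pd_correlation_matrixD:
  assumes "pd_correlation_matrix p C"
  shows "C \<in> carrier_mat p p" "\<And>I. I \<subseteq> {..<p} \<Longrightarrow> sym_on I (entries C)" "\<And>i. i < p \<Longrightarrow> C $$ (i, i) = 1"
    "\<And>I x i. I \<subseteq> {..<p} \<Longrightarrow> i \<in> I \<Longrightarrow> x i \<noteq> 0 \<Longrightarrow> 0 < quad I (entries C) x"
proof -
  show C: "C \<in> carrier_mat p p" and "\<And>i. i < p \<Longrightarrow> C $$ (i, i) = 1"
    using assms unfolding pd_correlation_matrix_def by auto
  show "sym_on I (entries C)" if "I \<subseteq> {..<p}" for I
    unfolding sym_on_def
  proof (intro ballI)
    fix i j assume "i \<in> I" "j \<in> I"
    then have "i < p" "j < p" using that by auto
    then have "transpose_mat C $$ (i, j) = C $$ (j, i)" using C by simp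
    then show "C $$ (i, j) = C $$ (j, i)" using assms unfolding pd_correlation_matrix_def by simp
  qed
  show "0 < quad I (entries C) x" if I: "I \<subseteq> {..<p}" and i: "i \<in> I" "x i \<noteq> 0" for I x i
  proof -
    define v where "v = Matrix.vec p (\<lambda>i. if i \<in> I then x i else 0)"
    have v: "v \<in> carrier_vec p" "vec_index v i \<noteq> 0" "i < p" unfolding v_def using I i by auto
    then have "v \<noteq> 0\<^sub>v p" by auto
    then have "0 < scalar_prod v (C *\<^sub>v v)" using assms v(1) unfolding pd_correlation_matrix_def by blast
    also have "\<dots> = quad {..<p} (entries C) (\<lambda>i. if i \<in> I then x i else 0)"
      unfolding mat_vec_quad[OF C v(1)] unfolding quad_def v_def by (intro sum.cong) auto
    also have "\<dots> = quad I (entries C) x" by (rule quad_extend) (use I in auto)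
    finally show ?thesis .
  qed
qed

lemma index_sets_iff:
  assumes "C \<in> carrier_mat p p"
  shows "J \<in> index_sets C q \<longleftrightarrow> J \<subseteq> {..<p} \<and> card J = min q p"
  using assms unfolding index_sets_def by auto

lemma finite_index_sets: "finite (index_sets C q)"
  unfolding index_sets_def by (rule finite_subset[of _ "Pow {..<dim_row C}"]) auto

lemma index_set_extend:
  assumes "C \<in> carrier_mat p p" "I \<subseteq> {..<p}" "card I \<le> q"
  obtains J where "J \<in> index_sets C q" "I \<subseteq> J" "J \<subseteq> {..<p}"
proof -
  have "card I \<le> min q p" using assms card_mono[of "{..<p}" I] by auto
  then obtain J where "I \<subseteq> J" "J \<subseteq> {..<p}" "card J = min q p"
    using exists_subset_between[of I "min q p" "{..<p}"] assms by auto
  then show ?thesis using that index_sets_iff[OF assms(1)] by blast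
qed

text \<open>Positivity is read off from an eigenvector, and the bound by 1 from a single coordinate,
  where the form is a diagonal entry. A smaller index set extends to one of the prescribed size,
  from which coercivity is inherited.\<close>

lemma lambda_min_order_bounds:
  assumes pd: "pd_correlation_matrix p C" and p: "0 < p" "0 < q"
  shows "0 < lambda_min_order C q" "lambda_min_order C q \<le> 1"
    "\<And>I. I \<subseteq> {..<p} \<Longrightarrow> card I \<le> q \<Longrightarrow> coercive_on I (entries C) (lambda_min_order C q)"
proof -
  note P = pd_correlation_matrixD[OF pd]
  let ?L = "(\<lambda>I. lambda_min (submatrix C I I)) ` index_sets C q"
  have J: "coercive_on J (entries C) (lambda_min (submatrix C J J)) \<and> 0 < lambda_min (submatrix C J J)"
    if "J \<in> index_sets C q" for J
  proof -
    have JJ: "J \<subseteq> {..<p}" "card J = min q p" using that index_sets_iff[OF P(1)] by blast+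
    then have fin: "finite J" by (auto intro: finite_subset)
    let ?M = "submatrix C J J" and ?m = "card J"
    have m: "0 < ?m" using JJ p by simp
    have M: "?M \<in> carrier_mat ?m ?m" using submatrix_carrier[OF P(1) JJ(1)] .
    have "sym_on {..<?m} (entries ?M)"
      unfolding sym_on_def
    proof (intro ballI)
      fix i j assume "i \<in> {..<?m}" "j \<in> {..<?m}"
      then have ij: "i < ?m" "j < ?m" by auto
      obtain a where a: "a \<in> J" "rank_in J a = i" using rank_in_surj[OF fin ij(1)] .
      obtain b where b: "b \<in> J" "rank_in J b = j" using rank_in_surj[OF fin ij(2)] .
      note ab = a b
      then show "?M $$ (i, j) = ?M $$ (j, i)"
        using submatrix_rank_in[OF P(1) JJ(1) ab(1,3)] submatrix_rank_in[OF P(1) JJ(1) ab(3,1)]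
          P(2)[OF JJ(1)] unfolding sym_on_def by auto
    qed
    note lm = lambda_min_coercive[OF M m this]
    obtain v where v: "v \<in> carrier_vec ?m" "v \<noteq> 0\<^sub>v ?m" "?M *\<^sub>v v = lambda_min ?M \<cdot>\<^sub>v v"
      using lm(2) M unfolding eigenvalue_def eigenvector_def by auto
    have n: "0 < (\<Sum>i<?m. (vec_index v i)\<^sup>2)" using nonzero_vec_norm[OF v(1,2)] .
    have "quad {..<?m} (entries ?M) (\<lambda>i. vec_index v i) = lambda_min ?M * (\<Sum>i<?m. (vec_index v i)\<^sup>2)"
      unfolding mat_vec_quad[OF M v(1), symmetric] v(3)
      using v(1) by (simp add: scalar_prod_def power2_eq_square atLeast0LessThan sum_distrib_left mult.left_commute)
    moreover have "0 < quad {..<?m} (entries ?M) (\<lambda>i. vec_index v i)"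
    proof -
      obtain k where k: "k < ?m" "vec_index v k \<noteq> 0"
        using v(1,2) by (metis eq_vecI carrier_vecD index_zero_vec(1,2))
      obtain u where "u \<in> J" "rank_in J u = k" using rank_in_surj[OF fin k(1)] .
      then show ?thesis unfolding quad_submatrix[OF P(1) JJ(1)] using P(4)[OF JJ(1)] k by auto
    qed
    ultimately have "0 < lambda_min ?M" using n by (simp add: zero_less_mult_iff)
    then show ?thesis using coercive_submatrix[OF P(1) JJ(1) lm(1)] by blast
  qed
  obtain J0 where J0: "J0 \<in> index_sets C q"
    using index_set_extend[OF P(1), of "{}" q] by auto
  have fin: "finite ?L" "?L \<noteq> {}" using finite_index_sets J0 by auto
  show pos: "0 < lambda_min_order C q" unfolding lambda_min_order_def using Min_in[OF fin] J by auto
  show co: "coercive_on I (entries C) (lambda_min_order C q)" if I: "I \<subseteq> {..<p}" "card I \<le> q" for I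
  proof -
    obtain K where K: "K \<in> index_sets C q" "I \<subseteq> K" "K \<subseteq> {..<p}" using index_set_extend[OF P(1) I] .
    then have "finite K" by (auto intro: finite_subset)
    then have "coercive_on I (entries C) (lambda_min (submatrix C K K))"
      using coercive_subset K(2) J[OF K(1)] by blast
    moreover have "lambda_min_order C q \<le> lambda_min (submatrix C K K)"
      unfolding lambda_min_order_def using fin K(1) by (intro Min_le) auto
    ultimately show ?thesis unfolding coercive_on_def
      by (meson mult_right_mono order_trans sum_nonneg zero_le_power2)
  qed
  have "coercive_on {0} (entries C) (lambda_min_order C q)" using co[of "{0}"] p by simp
  then have "lambda_min_order C q * (\<Sum>i\<in>{0::nat}. 1\<^sup>2) \<le> quad {0} (entries C) (\<lambda>_. 1)"
    unfolding coercive_on_def by (rule spec)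
  then show "lambda_min_order C q \<le> 1" using P(3)[OF p(1)] unfolding quad_def by simp
qed

lemma rank_in_image:
  assumes "finite J" "I \<subseteq> J" "u \<in> I"
  shows "rank_in (rank_in J ` I) (rank_in J u) = rank_in I u"
proof -
  have less: "rank_in J a < rank_in J u \<longleftrightarrow> a < u" if "a \<in> I" for a
    using rank_in_less[OF assms(1), of a u] rank_in_less[OF assms(1), of u a] assms that
    by (cases a u rule: linorder_cases) auto
  have "{a \<in> rank_in J ` I. a < rank_in J u} = rank_in J ` {a \<in> I. a < u}" using less by auto
  moreover have "inj_on (rank_in J) {a \<in> I. a < u}"
    using bij_betw_imp_inj_on[OF bij_rank_in[OF assms(1)]] by (rule inj_on_subset) (use assms(2) in auto)
  ultimately show ?thesis by (simp add: card_image)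
qed

text \<open>Principal submatrices of principal submatrices are principal submatrices, up to
  renumbering. This lets minima over index sets of one fixed size control all smaller sets.\<close>

lemma inv_entry_submatrix:
  assumes C: "C \<in> carrier_mat p p" and J: "J \<subseteq> {..<p}" and I: "I \<subseteq> J" and uv: "u \<in> I" "v \<in> I"
  shows "inv_entry (submatrix C J J) (rank_in J ` I) (rank_in J u) (rank_in J v) = inv_entry C I u v"
proof -
  have finJ: "finite J" and finI: "finite I" using J I by (auto intro: finite_subset)
  let ?M = "submatrix C J J" and ?I = "rank_in J ` I"
  have M: "?M \<in> carrier_mat (card J) (card J)" using submatrix_carrier[OF C J] .
  have bij: "bij_betw (rank_in J) J {..<card J}" using bij_rank_in[OF finJ] .
  have sub: "?I \<subseteq> {..<card J}" using bij I unfolding bij_betw_def by blast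
  have cI: "card ?I = card I" using bij_betw_imp_inj_on[OF bij] I by (meson card_image inj_on_subset)
  have Ip: "I \<subseteq> {..<p}" using I J by blast
  have "submatrix ?M ?I ?I = submatrix C I I"
  proof (rule eq_matI)
    have d: "submatrix ?M ?I ?I \<in> carrier_mat (card I) (card I)" "submatrix C I I \<in> carrier_mat (card I) (card I)"
      using submatrix_carrier[OF M sub] submatrix_carrier[OF C Ip] cI by simp_all
    then show "dim_row (submatrix ?M ?I ?I) = dim_row (submatrix C I I)"
      "dim_col (submatrix ?M ?I ?I) = dim_col (submatrix C I I)" by simp_all
    fix i j assume "i < dim_row (submatrix C I I)" "j < dim_col (submatrix C I I)"
    then have ij: "i < card I" "j < card I" using d(2) by auto
    obtain a where a: "a \<in> I" "rank_in I a = i" using rank_in_surj[OF finI ij(1)] .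
    obtain b where b: "b \<in> I" "rank_in I b = j" using rank_in_surj[OF finI ij(2)] .
    note ab = a(1) b(1) a(2) b(2)
    have "submatrix ?M ?I ?I $$ (rank_in ?I (rank_in J a), rank_in ?I (rank_in J b)) = ?M $$ (rank_in J a, rank_in J b)"
      by (rule submatrix_rank_in[OF M sub]) (use ab in auto)
    also have "\<dots> = C $$ (a, b)" by (rule submatrix_rank_in[OF C J]) (use ab I in auto)
    also have "\<dots> = submatrix C I I $$ (i, j)" using submatrix_rank_in[OF C Ip ab(1,2)] ab by simp
    finally show "submatrix ?M ?I ?I $$ (i, j) = submatrix C I I $$ (i, j)"
      unfolding rank_in_image[OF finJ I ab(1)] rank_in_image[OF finJ I ab(2)] ab(3,4) .
  qed
  then show ?thesis unfolding inv_entry_def rank_in_image[OF finJ I uv(1)] rank_in_image[OF finJ I uv(2)] by simp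
qed

lemma pcor_submatrix:
  assumes C: "C \<in> carrier_mat p p" and J: "J \<subseteq> {..<p}" and I: "{u, v} \<union> S \<subseteq> J"
  shows "pcor (submatrix C J J) (rank_in J u) (rank_in J v) (rank_in J ` S) = pcor C u v S"
proof -
  have "{rank_in J u, rank_in J v} \<union> rank_in J ` S = rank_in J ` ({u, v} \<union> S)" by auto
  then show ?thesis unfolding pcor_def Let_def using inv_entry_submatrix[OF C J I] by simp
qed

lemma finite_nonzero_pcors: "finite (nonzero_pcors C)"
proof -
  let ?n = "dim_row C"
  have "nonzero_pcors C \<subseteq> (\<lambda>(u, v, S). \<bar>pcor C u v S\<bar>) ` ({..<?n} \<times> {..<?n} \<times> Pow {..<?n})"
    unfolding nonzero_pcors_def by (auto simp: image_iff) blast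
  then show ?thesis by (rule finite_subset) auto
qed

text \<open>A partial correlation depends only on the entries indexed by
  \<open>{u, v} \<union> S\<close>, so it reappears in the submatrix of any larger index set, in
  particular of one with the size required by \<open>index_sets\<close>.\<close>

lemma c_min_order_bounds:
  assumes C: "C \<in> carrier_mat p p"
  shows "0 < c_min_order C q"
    "\<And>u v S. u < p \<Longrightarrow> v < p \<Longrightarrow> u \<noteq> v \<Longrightarrow> S \<subseteq> {..<p} - {u, v} \<Longrightarrow> card S + 2 \<le> q \<Longrightarrow> pcor C u v S \<noteq> 0 \<Longrightarrow>
      c_min_order C q \<le> \<bar>pcor C u v S\<bar>"
proof -
  define \<J> where "\<J> = {I \<in> index_sets C q. nonzero_pcors (submatrix C I I) \<noteq> {}}"
  have fin: "finite \<J>" unfolding \<J>_def using finite_index_sets[of C q] by simp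
  have co: "c_min_order C q = (if \<J> = {} then 1 else Min ((\<lambda>I. c_min (submatrix C I I)) ` \<J>))"
    unfolding c_min_order_def \<J>_def Let_def ..
  have "0 < c_min (submatrix C I I)" if "I \<in> \<J>" for I
  proof -
    have "c_min (submatrix C I I) \<in> nonzero_pcors (submatrix C I I)"
      unfolding c_min_def using that finite_nonzero_pcors unfolding \<J>_def by (intro Min_in) auto
    then show ?thesis unfolding nonzero_pcors_def by auto
  qed
  then show "0 < c_min_order C q" unfolding co using fin by simp
  fix u v S assume uv: "u < p" "v < p" "u \<noteq> v" and S: "S \<subseteq> {..<p} - {u, v}" "card S + 2 \<le> q"
    and nz: "pcor C u v S \<noteq> 0"
  have "card ({u, v} \<union> S) \<le> card {u, v} + card S" by (rule card_Un_le)
  then have "card ({u, v} \<union> S) \<le> q" using S(2) uv by simp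
  then obtain J where J: "J \<in> index_sets C q" "{u, v} \<union> S \<subseteq> J" "J \<subseteq> {..<p}"
    using index_set_extend[OF C, of "{u, v} \<union> S" q] uv S by auto
  have fJ: "finite J" using J(3) by (auto intro: finite_subset)
  let ?M = "submatrix C J J"
  have M: "dim_row ?M = card J" using submatrix_carrier[OF C J(3)] by simp
  have bij: "inj_on (rank_in J) J" "rank_in J ` J = {..<card J}" using bij_rank_in[OF fJ] unfolding bij_betw_def by auto
  have mem: "\<bar>pcor C u v S\<bar> \<in> nonzero_pcors ?M"
    unfolding nonzero_pcors_def M mem_Collect_eq
  proof (intro exI conjI)
    show "\<bar>pcor C u v S\<bar> = \<bar>pcor ?M (rank_in J u) (rank_in J v) (rank_in J ` S)\<bar>"
      and "pcor ?M (rank_in J u) (rank_in J v) (rank_in J ` S) \<noteq> 0"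
      using pcor_submatrix[OF C J(3,2)] nz by simp_all
    have m: "u \<in> J" "v \<in> J" "S \<subseteq> J" using J(2) by auto
    show "rank_in J u < card J" "rank_in J v < card J" using bij(2) m by blast+
    show "rank_in J u \<noteq> rank_in J v" using inj_onD[OF bij(1) _ m(1,2)] uv(3) by argo
    show "rank_in J ` S \<subseteq> {..<card J} - {rank_in J u, rank_in J v}"
    proof
      fix k assume "k \<in> rank_in J ` S"
      then obtain s where s: "s \<in> S" "k = rank_in J s" by blast
      then have "s \<in> J" "s \<noteq> u" "s \<noteq> v" using m S(1) by auto
      then have "rank_in J s \<noteq> rank_in J u" "rank_in J s \<noteq> rank_in J v"
        using inj_onD[OF bij(1), of s u] inj_onD[OF bij(1), of s v] m by auto
      moreover have "rank_in J s < card J" using bij(2) \<open>s \<in> J\<close> by blast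
      ultimately show "k \<in> {..<card J} - {rank_in J u, rank_in J v}" using s(2) by simp
    qed
  qed
  then have "J \<in> \<J>" using J(1) unfolding \<J>_def by blast
  then have "c_min_order C q \<le> c_min ?M" unfolding co using fin by auto
  also have "\<dots> \<le> \<bar>pcor C u v S\<bar>" unfolding c_min_def using mem finite_nonzero_pcors by (intro Min_le)
  finally show "c_min_order C q \<le> \<bar>pcor C u v S\<bar>" .
qed

lemma pcor_eq_0_iff:
  assumes "pd_correlation_matrix p C" "u < p" "v < p" "S \<subseteq> {..<p}"
  shows "pcor C u v S = 0 \<longleftrightarrow> inv_entry C ({u, v} \<union> S) u v = 0"
proof -
  note P = pd_correlation_matrixD[OF assms(1)]
  let ?I = "{u, v} \<union> S"
  have I: "?I \<subseteq> {..<p}" "finite ?I" using assms by (auto intro: finite_subset)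
  have p: "0 < p" using assms(2) by simp
  \<comment> \<open>The order \<open>p + 1\<close> admits every index set, so \<open>S\<close> may
    be of any size here.\<close>
  have "0 < p + 1" "card ?I \<le> p + 1" using card_mono[OF _ I(1)] by auto
  note L = lambda_min_order_bounds[OF assms(1) p this(1)]
  note c = L(3)[OF I(1) \<open>card ?I \<le> p + 1\<close>]
  note K = inv_entry_inv_on(2)[OF P(1) I(1) c L(1)]
  have "1 \<le> inv_entry C ?I u u" "1 \<le> inv_entry C ?I v v"
    using inv_diag_ge_1[OF I(2) P(2)[OF I(1)] K c L(1)] P(3) assms(2,3) by auto
  then show ?thesis unfolding pcor_def Let_def by simp
qed

lemma rpc_query_correct:
  assumes pd: "pd_correlation_matrix p C" and p: "0 < p" and q: "0 < q"
    and c: "c = min 1 (c_min_order C q)" and lam: "lam = lambda_min_order C q"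
    and C': "C' \<in> carrier_mat p p" "sym_on {..<p} (entries C')" "\<And>i. i < p \<Longrightarrow> C' $$ (i, i) = 1"
    and close: "\<And>i j. i < p \<Longrightarrow> j < p \<Longrightarrow> \<bar>C' $$ (i, j) - C $$ (i, j)\<bar> \<le> c * lam\<^sup>2 / (8 * real q)"
    and uv: "u < p" "v < p" "u \<noteq> v" and S: "S \<subseteq> {..<p} - {u, v}" "card S + 2 \<le> q"
  shows "rpc_query und (c / 4) C' u v S \<longleftrightarrow> pcor C u v S = 0"
proof -
  note P = pd_correlation_matrixD[OF pd]
  define I where "I = {u, v} \<union> S"
  have I: "I \<subseteq> {..<p}" "finite I" unfolding I_def using uv S by (auto intro: finite_subset)
  have "card I \<le> card {u, v} + card S" unfolding I_def by (rule card_Un_le)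
  then have cI: "card I \<le> q" using S(2) uv by simp
  note L = lambda_min_order_bounds[OF pd p q, folded lam]
  note co = L(3)[OF I(1) cI]
  have c01: "0 < c" "c \<le> 1" using c_min_order_bounds(1)[OF P(1)] c by auto
  define e where "e = c * lam\<^sup>2 / (8 * real q)"
  have e: "0 \<le> e" "real q * e = c * lam\<^sup>2 / 8" unfolding e_def using c01 q by auto
  have "c * lam\<^sup>2 \<le> 1 * lam" using c01 L(1,2) by (intro mult_mono) (auto simp: power2_eq_square)
  then have qe: "real q * e \<le> lam / 2" using e(2) L(1) by simp
  have D: "\<bar>C' $$ (i, j) - C $$ (i, j)\<bar> \<le> e" if "i \<in> I" "j \<in> I" for i j
    using close that I(1) unfolding e_def by blast
  have co': "coercive_on I (entries C') (lam - real q * e)"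
    using coercive_perturb[OF I(2) co D e(1)] cI by simp
  have lam': "0 < lam - real q * e" using qe L(1) by simp
  have s: "sym_on I (entries C)" "sym_on I (entries C')"
    using P(2)[OF I(1)] C'(2) I(1) unfolding sym_on_def by blast+
  let ?K = "inv_entry C I" and ?K' = "inv_entry C' I"
  have K: "inv_on I (entries C) ?K" using inv_entry_inv_on(2)[OF P(1) I(1) co L(1)] .
  have K': "mat_inverse (submatrix C' I I) \<noteq> None" "inv_on I (entries C') ?K'"
    using inv_entry_inv_on[OF C'(1) I(1) co' lam'] .
  have uvI: "u \<in> I" "v \<in> I" unfolding I_def by auto
  have ge: "1 \<le> ?K u u" "1 \<le> ?K v v" "1 \<le> ?K' u u" "1 \<le> ?K' v v"
    using inv_diag_ge_1[OF I(2) s(1) K co L(1)] inv_diag_ge_1[OF I(2) s(2) K'(2) co' lam'] uvI uv P(3) C'(3) by auto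
  have "2 * real q * e / lam\<^sup>2 = c / 4" using e(2) L(1) by (simp add: field_simps)
  then have d: "\<bar>?K' i j - ?K i j\<bar> \<le> c / 4" if "i \<in> I" "j \<in> I" for i j
    using inv_perturb[OF I(2) s K K'(2) co L(1) D e(1) _ qe that] cI by simp
  have pc: "pcor M u v S = - inv_entry M I u v / sqrt (inv_entry M I u u * inv_entry M I v v)" for M
    unfolding pcor_def Let_def I_def ..
  have "?K u v = 0 \<or> c \<le> \<bar>- ?K u v / sqrt (?K u u * ?K v v)\<bar>"
    using c_min_order_bounds(2)[OF P(1) uv S] c unfolding pc using ge by fastforce
  then have "\<bar>pcor C' u v S\<bar> \<le> c / 4 \<longleftrightarrow> ?K u v = 0"
    unfolding pc using partial_correlation_threshold[OF ge d d d order_refl c01] uvI by blast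
  moreover have "0 < ?K' u u * ?K' v v" using ge by (intro mult_pos_pos) auto
  then have "pcor_defined C' u v S" unfolding pcor_defined_def Let_def I_def[symmetric] using K'(1) by blast
  moreover have "?K u v = 0 \<longleftrightarrow> pcor C u v S = 0"
    using pcor_eq_0_iff[OF pd uv(1,2)] S(1) unfolding I_def by auto
  ultimately show ?thesis unfolding rpc_query_def pcor_estimate_def using C'(1) uv S by simp
qed

section \<open>Gaussian densities\<close>

abbreviation lebesgue_on_coords :: "nat set \<Rightarrow> (nat \<Rightarrow> real) measure" where
  "lebesgue_on_coords I \<equiv> PiM I (\<lambda>_. lborel)"

interpretation lborel_product: product_sigma_finite "\<lambda>_ :: nat. lborel :: real measure"
  by unfold_locales

text \<open>Without normalising factor, since marginals are mostly needed up to a constant.\<close>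

definition gauss_kernel :: "nat set \<Rightarrow> (nat \<Rightarrow> nat \<Rightarrow> real) \<Rightarrow> (nat \<Rightarrow> real) \<Rightarrow> real" where
  "gauss_kernel I K x = exp (- quad I K x / 2)"

definition schur :: "(nat \<Rightarrow> nat \<Rightarrow> real) \<Rightarrow> nat \<Rightarrow> nat \<Rightarrow> nat \<Rightarrow> real" where
  "schur K j k l = K k l - K k j * K j l / K j j"

lemma measurable_coord:
  "i \<in> J \<Longrightarrow> (\<lambda>x. x i) \<in> borel_measurable (lebesgue_on_coords J)"
  using measurable_component_singleton[of i J "\<lambda>_. lborel"] by simp

lemma measurable_quad:
  "I \<subseteq> J \<Longrightarrow> quad I K \<in> borel_measurable (lebesgue_on_coords J)"
  unfolding quad_def using measurable_coord[of _ J]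
  by (intro borel_measurable_sum borel_measurable_times borel_measurable_const) auto

lemma measurable_gauss_kernel:
  "I \<subseteq> J \<Longrightarrow> gauss_kernel I K \<in> borel_measurable (lebesgue_on_coords J)"
  unfolding gauss_kernel_def using measurable_quad[of I J K] by simp

lemma measurable_ennreal_gauss_kernel:
  "I \<subseteq> J \<Longrightarrow> (\<lambda>x. ennreal (gauss_kernel I K x)) \<in> borel_measurable (lebesgue_on_coords J)"
  by (rule measurable_compose[OF measurable_gauss_kernel measurable_ennreal])

lemma quad_cong: "(\<And>i. i \<in> I \<Longrightarrow> x i = y i) \<Longrightarrow> quad I K x = quad I K y"
  unfolding quad_def by (intro sum.cong) auto

lemma sym_onD: "sym_on (insert j I) K \<Longrightarrow> k \<in> I \<Longrightarrow> K k j = K j k"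
  unfolding sym_on_def by blast

lemma quad_insert:
  assumes "finite I" "j \<notin> I" "sym_on (insert j I) K"
  shows "quad (insert j I) K (x(j := y)) = K j j * y\<^sup>2 + 2 * y * (\<Sum>k\<in>I. K j k * x k) + quad I K x"
proof -
  let ?z = "x(j := y)"
  have z: "?z k = x k" if "k \<in> I" for k using that assms(2) by auto
  have r: "(\<Sum>l\<in>insert j I. w * K i l * ?z l) = w * K i j * y + (\<Sum>l\<in>I. w * K i l * x l)" for w i
  proof -
    have "(\<Sum>l\<in>I. w * K i l * ?z l) = (\<Sum>l\<in>I. w * K i l * x l)" using z by (intro sum.cong) simp_all
    then show ?thesis using assms(1,2) by simp
  qed
  have "quad (insert j I) K ?z = (\<Sum>i\<in>insert j I. ?z i * K i j * y + (\<Sum>l\<in>I. ?z i * K i l * x l))"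
    unfolding quad_def r ..
  also have "\<dots> = (y * K j j * y + (\<Sum>l\<in>I. y * K j l * x l))
      + (\<Sum>i\<in>I. ?z i * K i j * y + (\<Sum>l\<in>I. ?z i * K i l * x l))"
    using assms(1,2) by simp
  also have "(\<Sum>i\<in>I. ?z i * K i j * y + (\<Sum>l\<in>I. ?z i * K i l * x l))
      = (\<Sum>i\<in>I. x i * K i j * y + (\<Sum>l\<in>I. x i * K i l * x l))"
    using z by (intro sum.cong) simp_all
  also have "\<dots> = (\<Sum>k\<in>I. x k * K k j * y) + quad I K x" unfolding quad_def by (rule sum.distrib)
  also have "(\<Sum>l\<in>I. y * K j l * x l) = y * (\<Sum>k\<in>I. K j k * x k)" by (simp add: sum_distrib_left mult.assoc)
  also have "(\<Sum>k\<in>I. x k * K k j * y) = (\<Sum>k\<in>I. y * K j k * x k)"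
    using sym_onD[OF assms(3)] by (intro sum.cong) simp_all
  also have "\<dots> = y * (\<Sum>k\<in>I. K j k * x k)" by (simp add: sum_distrib_left mult.assoc)
  finally show ?thesis by (simp add: power2_eq_square algebra_simps del: fun_upd_apply)
qed

lemma quad_schur:
  assumes "sym_on (insert j I) K"
  shows "quad I (schur K j) x = quad I K x - (\<Sum>k\<in>I. K j k * x k)\<^sup>2 / K j j"
proof -
  have "quad I (schur K j) x = (\<Sum>i\<in>I. \<Sum>l\<in>I. x i * K i l * x l - (K j i * x i) * (K j l * x l) / K j j)"
    unfolding quad_def schur_def using sym_onD[OF assms]
    by (intro sum.cong refl) (simp add: algebra_simps)
  also have "\<dots> = quad I K x - (\<Sum>i\<in>I. \<Sum>l\<in>I. (K j i * x i) * (K j l * x l)) / K j j"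
    unfolding quad_def by (simp add: sum_subtractf sum_divide_distrib)
  finally show ?thesis by (simp add: power2_eq_square sum_product)
qed

text \<open>Completing the square in the coordinate \<open>j\<close>: the middle factor is its
  conditional density given the others, and its mean is linear in them.\<close>

lemma gauss_complete_square:
  assumes "finite I" "j \<notin> I" "sym_on (insert j I) K" "0 < K j j"
  shows "gauss_kernel (insert j I) K (x(j := y)) = sqrt (2 * pi / K j j) *
     normal_density (- (\<Sum>k\<in>I. K j k * x k) / K j j) (1 / sqrt (K j j)) y * gauss_kernel I (schur K j) x"
proof -
  let ?m = "\<Sum>k\<in>I. K j k * x k" and ?a = "K j j"
  have "quad (insert j I) K (x(j := y)) = ?a * (y - - ?m / ?a)\<^sup>2 + quad I (schur K j) x"
    unfolding quad_insert[OF assms(1-3)] quad_schur[OF assms(3)]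
    using assms(4) by (simp add: power2_eq_square field_simps)
  then have "gauss_kernel (insert j I) K (x(j := y)) = exp (- (?a * (y - - ?m / ?a)\<^sup>2) / 2) * gauss_kernel I (schur K j) x"
    unfolding gauss_kernel_def by (simp add: exp_add[symmetric] add_divide_distrib)
  moreover have "sqrt (2 * pi / ?a) * normal_density (- ?m / ?a) (1 / sqrt ?a) y = exp (- (?a * (y - - ?m / ?a)\<^sup>2) / 2)"
  proof -
    have "2 * pi * (1 / sqrt ?a)\<^sup>2 = 2 * pi / ?a" using assms(4) by (simp add: power_divide)
    moreover have "- (y - - ?m / ?a)\<^sup>2 / (2 * (1 / sqrt ?a)\<^sup>2) = - (?a * (y - - ?m / ?a)\<^sup>2) / 2"
      using assms(4) by (simp add: power_divide)
    moreover have "0 < sqrt (2 * pi / ?a)" using assms(4) by simp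
    ultimately show ?thesis unfolding normal_density_def using assms(4) by simp
  qed
  ultimately show ?thesis by simp
qed

text \<open>In row \<open>i\<close> of the identity \<open>A K = 1\<close> the term with
  \<open>A i j\<close> is eliminated between the columns \<open>l\<close> and \<open>j\<close>. So
  the precision matrix of a marginal stays the inverse of a principal submatrix of the
  covariance.\<close>

lemma inv_on_schur:
  assumes "finite I" "j \<notin> I" "inv_on (insert j I) A K" "K j j \<noteq> 0"
  shows "inv_on I A (schur K j)"
  unfolding inv_on_def
proof (intro ballI)
  fix i l assume il: "i \<in> I" "l \<in> I"
  have inv: "A i j * K j b + (\<Sum>k\<in>I. A i k * K k b) = (if i = b then 1 else 0)" if "b \<in> insert j I" for b
    using assms(3) il(1) that assms(1,2) unfolding inv_on_def by auto
  have "(\<Sum>k\<in>I. A i k * schur K j k l) = (\<Sum>k\<in>I. A i k * K k l) - (\<Sum>k\<in>I. A i k * K k j) * (K j l / K j j)"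
    unfolding schur_def by (simp add: algebra_simps sum_subtractf sum_distrib_left sum_divide_distrib)
  also have "\<dots> = ((if i = l then 1 else 0) - A i j * K j l) - (- A i j * K j j) * (K j l / K j j)"
  proof -
    have "(\<Sum>k\<in>I. A i k * K k l) = (if i = l then 1 else 0) - A i j * K j l"
      "(\<Sum>k\<in>I. A i k * K k j) = - A i j * K j j"
    proof -
      show "(\<Sum>k\<in>I. A i k * K k l) = (if i = l then 1 else 0) - A i j * K j l"
        using inv[of l] il by (simp add: algebra_simps)
      have "i \<noteq> j" using il assms(2) by blast
      then have "A i j * K j j + (\<Sum>k\<in>I. A i k * K k j) = 0" using inv[of j] by simp
      then show "(\<Sum>k\<in>I. A i k * K k j) = - A i j * K j j" by linarith
    qed
    then show ?thesis by simp
  qed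
  finally show "(\<Sum>k\<in>I. A i k * schur K j k l) = (if i = l then 1 else 0)" using assms(4) by simp
qed

lemma nn_integral_normal_density:
  assumes "0 < \<sigma>" shows "(\<integral>\<^sup>+ y. ennreal (normal_density m \<sigma> y) \<partial>lborel) = 1"
proof -
  interpret prob_space "density lborel (\<lambda>x. ennreal (normal_density m \<sigma> x))"
    by (rule prob_space_normal_density[OF assms])
  show ?thesis using emeasure_space_1 by (simp add: emeasure_density)
qed

lemma gauss_marginal_one:
  assumes I: "finite I" "j \<notin> I" and K: "sym_on (insert j I) K" "0 < K j j"
    and f: "f \<in> borel_measurable (lebesgue_on_coords I)"
  shows "(\<integral>\<^sup>+ x. f (restrict x I) * ennreal (gauss_kernel (insert j I) K x) \<partial>lebesgue_on_coords (insert j I))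
    = ennreal (sqrt (2 * pi / K j j)) * (\<integral>\<^sup>+ x. f x * ennreal (gauss_kernel I (schur K j) x) \<partial>lebesgue_on_coords I)"
proof -
  let ?c = "sqrt (2 * pi / K j j)"
  have r: "(\<lambda>x. restrict x I) \<in> measurable (lebesgue_on_coords (insert j I)) (lebesgue_on_coords I)"
    by (rule measurable_restrict_subset) auto
  have "(\<lambda>x. f (restrict x I) * ennreal (gauss_kernel (insert j I) K x)) \<in> borel_measurable (lebesgue_on_coords (insert j I))"
    by (intro borel_measurable_times_ennreal measurable_compose[OF r f] measurable_ennreal_gauss_kernel) simp
  then have "(\<integral>\<^sup>+ x. f (restrict x I) * ennreal (gauss_kernel (insert j I) K x) \<partial>lebesgue_on_coords (insert j I))
    = (\<integral>\<^sup>+ x. \<integral>\<^sup>+ y. f (restrict (x(j := y)) I) * ennreal (gauss_kernel (insert j I) K (x(j := y))) \<partial>lborel \<partial>lebesgue_on_coords I)"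
    by (rule lborel_product.product_nn_integral_insert[OF I])
  also have "\<dots> = (\<integral>\<^sup>+ x. ennreal ?c * (f x * ennreal (gauss_kernel I (schur K j) x)) \<partial>lebesgue_on_coords I)"
  proof (intro nn_integral_cong)
    fix x assume x: "x \<in> space (lebesgue_on_coords I)"
    let ?m = "- (\<Sum>k\<in>I. K j k * x k) / K j j" and ?s = "1 / sqrt (K j j)"
    have rx: "restrict (x(j := y)) I = x" for y
      using x I(2) by (auto simp: space_PiM PiE_def extensional_def restrict_def)
    have "(\<integral>\<^sup>+ y. f (restrict (x(j := y)) I) * ennreal (gauss_kernel (insert j I) K (x(j := y))) \<partial>lborel)
      = (\<integral>\<^sup>+ y. (ennreal ?c * (f x * ennreal (gauss_kernel I (schur K j) x))) * ennreal (normal_density ?m ?s y) \<partial>lborel)"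
      unfolding rx gauss_complete_square[OF I K] using K(2)
      by (intro nn_integral_cong) (simp add: ennreal_mult gauss_kernel_def mult_ac)
    also have "\<dots> = (ennreal ?c * (f x * ennreal (gauss_kernel I (schur K j) x))) * 1"
      using K(2) by (subst nn_integral_cmult) (auto simp: nn_integral_normal_density)
    finally show "(\<integral>\<^sup>+ y. f (restrict (x(j := y)) I) * ennreal (gauss_kernel (insert j I) K (x(j := y))) \<partial>lborel)
      = ennreal ?c * (f x * ennreal (gauss_kernel I (schur K j) x))" by simp
  qed
  also have "\<dots> = ennreal ?c * (\<integral>\<^sup>+ x. f x * ennreal (gauss_kernel I (schur K j) x) \<partial>lebesgue_on_coords I)"
    by (intro nn_integral_cmult borel_measurable_times_ennreal f measurable_ennreal_gauss_kernel) simp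
  finally show ?thesis .
qed

lemma pd_coercive:
  assumes "pd_correlation_matrix p C"
  obtains c where "0 < c" "\<And>I. I \<subseteq> {..<p} \<Longrightarrow> coercive_on I (entries C) c"
proof (cases "p = 0")
  case True
  then have "\<And>I. I \<subseteq> {..<p} \<Longrightarrow> coercive_on I (entries C) 1" unfolding coercive_on_def quad_def by auto
  then show ?thesis using that[of 1] by auto
next
  case False
  then have p: "0 < p" "0 < p + 1" by auto
  have "card I \<le> p + 1" if "I \<subseteq> {..<p}" for I using card_mono[OF _ that] by simp
  then show ?thesis using that lambda_min_order_bounds[OF assms p] by blast
qed

lemma pd_inverse_diag:
  assumes pd: "pd_correlation_matrix p C" and I: "I \<subseteq> {..<p}" and K: "inv_on I (entries C) K" and j: "j \<in> I"
  shows "sym_on I K" "1 \<le> K j j"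
proof -
  note P = pd_correlation_matrixD[OF pd]
  have fin: "finite I" using I by (rule finite_subset) simp
  obtain c where c: "0 < c" "coercive_on I (entries C) c" using pd_coercive[OF pd] I by metis
  show "sym_on I K" using inv_on_sym[OF fin P(2)[OF I] K] .
  show "1 \<le> K j j" using inv_diag_ge_1[OF fin P(2)[OF I] K c(2,1) j] P(3) I j by auto
qed

text \<open>Only the fact that \<open>L\<close> inverts the submatrix on \<open>I\<close> is
  recorded, which determines \<open>L\<close> there; the factor \<open>c\<close> is left open,
  because total mass 1 fixes it wherever it matters.\<close>

lemma gauss_marginal:
  assumes pd: "pd_correlation_matrix p C" and J: "J \<subseteq> {..<p}" and K: "inv_on J (entries C) K" and I: "I \<subseteq> J"
  shows "\<exists>c L. 0 < c \<and> inv_on I (entries C) L \<and> (\<forall>f \<in> borel_measurable (lebesgue_on_coords I).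
    (\<integral>\<^sup>+ x. f (restrict x I) * ennreal (gauss_kernel J K x) \<partial>lebesgue_on_coords J)
    = ennreal c * (\<integral>\<^sup>+ x. f x * ennreal (gauss_kernel I L x) \<partial>lebesgue_on_coords I))"
proof -
  have "finite D \<Longrightarrow> D \<inter> I = {} \<Longrightarrow> I \<union> D \<subseteq> {..<p} \<Longrightarrow> inv_on (I \<union> D) (entries C) K \<Longrightarrow>
    \<exists>c L. 0 < c \<and> inv_on I (entries C) L \<and> (\<forall>f \<in> borel_measurable (lebesgue_on_coords I).
    (\<integral>\<^sup>+ x. f (restrict x I) * ennreal (gauss_kernel (I \<union> D) K x) \<partial>lebesgue_on_coords (I \<union> D))
    = ennreal c * (\<integral>\<^sup>+ x. f x * ennreal (gauss_kernel I L x) \<partial>lebesgue_on_coords I))" for D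
  proof (induction D arbitrary: K rule: finite_induct)
    case empty
    have "restrict x I = x" if "x \<in> space (lebesgue_on_coords I)" for x
      using that by (auto simp: space_PiM PiE_def extensional_restrict)
    then have eq: "(\<integral>\<^sup>+ x. f (restrict x I) * ennreal (gauss_kernel I K x) \<partial>lebesgue_on_coords I)
      = ennreal 1 * (\<integral>\<^sup>+ x. f x * ennreal (gauss_kernel I K x) \<partial>lebesgue_on_coords I)" for f
      unfolding ennreal_1 mult_1 by (intro nn_integral_cong) metis
    show ?case unfolding Un_empty_right
    proof (intro exI conjI ballI)
      show "(0::real) < 1" "inv_on I (entries C) K" using empty.prems by simp_all
    qed (rule eq)
  next
    case (insert j D)
    let ?J = "I \<union> D"
    have j: "j \<notin> ?J" and Jeq: "I \<union> insert j D = insert j ?J" and fin: "finite ?J"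
      using insert.hyps insert.prems by (auto intro: finite_subset)
    have inv: "inv_on (insert j ?J) (entries C) K" and sub: "insert j ?J \<subseteq> {..<p}"
      using insert.prems(2,3) unfolding Jeq by blast+
    have sK: "sym_on (insert j ?J) K" and Kj: "0 < K j j"
      using pd_inverse_diag[OF pd sub inv, of j] by auto
    have inv': "inv_on ?J (entries C) (schur K j)" using inv_on_schur[OF fin j inv] Kj by simp
    obtain c L where cL: "0 < c" "inv_on I (entries C) L" "\<And>f. f \<in> borel_measurable (lebesgue_on_coords I) \<Longrightarrow>
      (\<integral>\<^sup>+ x. f (restrict x I) * ennreal (gauss_kernel ?J (schur K j) x) \<partial>lebesgue_on_coords ?J)
      = ennreal c * (\<integral>\<^sup>+ x. f x * ennreal (gauss_kernel I L x) \<partial>lebesgue_on_coords I)"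
    proof -
      have "D \<inter> I = {}" "?J \<subseteq> {..<p}" using insert.prems by auto
      from insert.IH[OF this inv'] show ?thesis using that by blast
    qed
    let ?d = "sqrt (2 * pi / K j j)"
    have "(\<integral>\<^sup>+ x. f (restrict x I) * ennreal (gauss_kernel (I \<union> insert j D) K x) \<partial>lebesgue_on_coords (I \<union> insert j D))
      = ennreal (?d * c) * (\<integral>\<^sup>+ x. f x * ennreal (gauss_kernel I L x) \<partial>lebesgue_on_coords I)"
      if f: "f \<in> borel_measurable (lebesgue_on_coords I)" for f
    proof -
      have "(\<lambda>x. f (restrict x I)) \<in> borel_measurable (lebesgue_on_coords ?J)"
        by (rule measurable_compose[OF measurable_restrict_subset f]) auto
      note m = gauss_marginal_one[OF fin j sK Kj this]
      have "restrict (restrict x ?J) I = restrict x I" for x :: "nat \<Rightarrow> real" by auto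
      then show ?thesis using m cL(3)[OF f] cL(1) Kj unfolding Jeq by (simp add: ennreal_mult mult.assoc)
    qed
    note eq = this
    show ?case
    proof (intro exI conjI ballI)
      show "0 < ?d * c" "inv_on I (entries C) L" using cL(1,2) Kj by simp_all
    qed (rule eq)
  qed
  from this[of "J - I"] show ?thesis using I J K finite_subset[OF J] by (auto simp: Un_absorb1)
qed

lemma inv_on_cong:
  assumes "inv_on I A K" "\<And>i j. i \<in> I \<Longrightarrow> j \<in> I \<Longrightarrow> A i j = A' i j"
  shows "inv_on I A' K"
  unfolding inv_on_def
proof (intro ballI)
  fix i l assume il: "i \<in> I" "l \<in> I"
  then have "(\<Sum>k\<in>I. A' i k * K k l) = (\<Sum>k\<in>I. A i k * K k l)" using assms(2) by (intro sum.cong) auto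
  then show "(\<Sum>k\<in>I. A' i k * K k l) = (if i = l then 1 else 0)" using assms(1) il unfolding inv_on_def by simp
qed

section \<open>Determinants and the normalising constant\<close>

lemma pd_correlation_matrixI:
  assumes "C \<in> carrier_mat p p" "\<And>i j. i < p \<Longrightarrow> j < p \<Longrightarrow> C $$ (i, j) = C $$ (j, i)" "\<And>i. i < p \<Longrightarrow> C $$ (i, i) = 1"
    and "\<And>x i. i < p \<Longrightarrow> x i \<noteq> 0 \<Longrightarrow> 0 < quad {..<p} (entries C) x"
  shows "pd_correlation_matrix p C"
proof -
  have "transpose_mat C = C" using assms(1,2) by (intro eq_matI) auto
  moreover have "0 < scalar_prod x (C *\<^sub>v x)" if x: "x \<in> carrier_vec p" "x \<noteq> 0\<^sub>v p" for x
  proof -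
    obtain i where "i < p" "vec_index x i \<noteq> 0" using x by (metis eq_vecI carrier_vecD index_zero_vec(1,2))
    then show ?thesis unfolding mat_vec_quad[OF assms(1) x(1)] using assms(4) by blast
  qed
  ultimately show ?thesis unfolding pd_correlation_matrix_def using assms(1,3) by blast
qed

lemma pd_inverse:
  assumes pd: "pd_correlation_matrix p C"
  obtains B where "mat_inverse C = Some B" "C * B = 1\<^sub>m p" "B \<in> carrier_mat p p" "inv_on {..<p} (entries C) (entries B)"
proof -
  note P = pd_correlation_matrixD[OF pd]
  obtain c where c: "0 < c" "coercive_on {..<p} (entries C) c" using pd_coercive[OF pd] order_refl by metis
  obtain B where "mat_inverse C = Some B" "C * B = 1\<^sub>m p" "B \<in> carrier_mat p p"
    using mat_inverse_of_det[OF P(1) coercive_imp_det_nonzero[OF P(1) c(2,1)]] by blast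
  then show ?thesis using that inv_on_matrix[OF P(1)] by blast
qed

text \<open>Cramer's rule, from the adjugate. It serves twice: for the pivots of the determinant and
  for the measurability of inverse entries.\<close>

lemma mat_inverse_cofactor:
  assumes M: "M \<in> carrier_mat m m" and B: "M * B = 1\<^sub>m m" "B \<in> carrier_mat m m" and ab: "a < m" "b < m"
  shows "cofactor M b a = Determinant.det M * (B $$ (a, b) :: real)"
proof -
  have adj: "Determinant.adj_mat M \<in> carrier_mat m m" by (rule adj_mat(1)[OF M])
  have "Determinant.adj_mat M = Determinant.adj_mat M * (M * B)" unfolding B(1) using adj by simp
  also have "\<dots> = Determinant.adj_mat M * M * B" using adj M B(2) by simp
  also have "\<dots> = Determinant.det M \<cdot>\<^sub>m B"
    unfolding adj_mat(3)[OF M] using B(2) by (simp add: mult_smult_assoc_mat[OF one_carrier_mat B(2)])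
  finally have "Determinant.adj_mat M $$ (a, b) = Determinant.det M * B $$ (a, b)" using B(2) ab by simp
  then show ?thesis unfolding adj_mat_def using M ab by simp
qed

lemma last_pivot_det:
  assumes pd: "pd_correlation_matrix (Suc p) C" and K: "inv_on {..<Suc p} (entries C) K"
    and C1: "C1 = Matrix.mat p p (\<lambda>(i, j). C $$ (i, j))"
  shows "Determinant.det C1 = Determinant.det C * K p p"
proof -
  note P = pd_correlation_matrixD[OF pd]
  obtain B where B: "C * B = 1\<^sub>m (Suc p)" "B \<in> carrier_mat (Suc p) (Suc p)" "inv_on {..<Suc p} (entries C) (entries B)"
    using pd_inverse[OF pd] by blast
  have Kp: "K p p = B $$ (p, p)"
    using inv_on_unique[OF _ P(2) K B(3), of p p] by auto
  have "cofactor C p p = Determinant.det C * B $$ (p, p)"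
    by (rule mat_inverse_cofactor[OF P(1) B(1,2)]) simp_all
  moreover have "mat_delete C p p = C1" unfolding C1 mat_delete_def using P(1) by (intro eq_matI) auto
  ultimately show ?thesis unfolding Kp cofactor_def by simp
qed

text \<open>Integrating out the last coordinate gives the factor
  \<open>sqrt (2 * pi / K p p)\<close>, and by \<open>last_pivot_det\<close> the same
  \<open>K p p\<close> is the ratio of the two determinants. Positivity of the determinant comes
  from the same induction.\<close>

lemma gauss_normalization:
  assumes "pd_correlation_matrix p C" "inv_on {..<p} (entries C) K"
  shows "0 < Determinant.det C \<and> (\<integral>\<^sup>+ x. ennreal (gauss_kernel {..<p} K x) \<partial>lebesgue_on_coords {..<p})
    = ennreal (sqrt ((2 * pi) ^ p * Determinant.det C))"
  using assms
proof (induction p arbitrary: C K)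
  case 0
  then have "C \<in> carrier_mat 0 0" using pd_correlation_matrixD(1) by blast
  then have "Determinant.det C = 1" by (rule det_dim_zero)
  moreover have "(\<integral>\<^sup>+ x. ennreal (gauss_kernel {..<0} K x) \<partial>lebesgue_on_coords {..<0}) = 1"
  proof -
    interpret prob_space "lebesgue_on_coords {}" by (rule prob_space_PiM) simp
    show ?thesis using emeasure_space_1 by (simp add: gauss_kernel_def quad_def)
  qed
  ultimately show ?case by simp
next
  case (Suc p)
  note P = pd_correlation_matrixD[OF Suc.prems(1)]
  define C1 where "C1 = Matrix.mat p p (\<lambda>(i, j). C $$ (i, j))"
  have ent: "C1 $$ (i, j) = C $$ (i, j)" if "i < p" "j < p" for i j unfolding C1_def using that by simp
  have pd1: "pd_correlation_matrix p C1"
  proof (rule pd_correlation_matrixI)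
    show "C1 \<in> carrier_mat p p" unfolding C1_def by simp
    show "C1 $$ (i, j) = C1 $$ (j, i)" if "i < p" "j < p" for i j
      using P(2)[OF order_refl] that ent unfolding sym_on_def by auto
    show "C1 $$ (i, i) = 1" if "i < p" for i using P(3) that ent by simp
    show "0 < quad {..<p} (entries C1) x" if "i < p" "x i \<noteq> 0" for x i
    proof -
      have "quad {..<p} (entries C1) x = quad {..<p} (entries C) x"
        unfolding quad_def using ent by (intro sum.cong) auto
      then show ?thesis using P(4)[of "{..<p}" i x] that by auto
    qed
  qed
  have ins: "{..<Suc p} = insert p {..<p}" by auto
  have inv: "inv_on (insert p {..<p}) (entries C) K" using Suc.prems(2) unfolding ins .
  have sK: "sym_on (insert p {..<p}) K" and Kp: "1 \<le> K p p"
    using pd_inverse_diag[OF Suc.prems(1) _ inv, of p] by auto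
  have "inv_on {..<p} (entries C1) (schur K p)"
    using inv_on_cong[OF inv_on_schur[OF _ _ inv]] Kp ent by auto
  note IH = Suc.IH[OF pd1 this]
  have det: "Determinant.det C1 = Determinant.det C * K p p" using last_pivot_det[OF Suc.prems C1_def] .
  then have dC: "0 < Determinant.det C" using IH Kp by (simp add: zero_less_mult_iff)
  have "(\<integral>\<^sup>+ x. ennreal (gauss_kernel {..<Suc p} K x) \<partial>lebesgue_on_coords {..<Suc p})
    = (\<integral>\<^sup>+ x. (\<lambda>_. 1) (restrict x {..<p}) * ennreal (gauss_kernel (insert p {..<p}) K x) \<partial>lebesgue_on_coords (insert p {..<p}))"
    unfolding ins by simp
  also have "\<dots> = ennreal (sqrt (2 * pi / K p p)) * (\<integral>\<^sup>+ x. 1 * ennreal (gauss_kernel {..<p} (schur K p) x) \<partial>lebesgue_on_coords {..<p})"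
    by (rule gauss_marginal_one[OF _ _ sK]) (use Kp in auto)
  also have "\<dots> = ennreal (sqrt (2 * pi / K p p) * sqrt ((2 * pi) ^ p * Determinant.det C1))"
    using IH Kp by (simp add: ennreal_mult)
  also have "sqrt (2 * pi / K p p) * sqrt ((2 * pi) ^ p * Determinant.det C1) = sqrt ((2 * pi) ^ Suc p * Determinant.det C)"
    unfolding det real_sqrt_mult[symmetric] using Kp by simp
  finally show ?case using dC by blast
qed

lemma normal_dist_density:
  assumes pd: "pd_correlation_matrix p C"
  obtains K Z where "inv_on {..<p} (entries C) K" "0 < Z"
    "normal_dist p C = density (lebesgue_on_coords {..<p}) (\<lambda>x. ennreal (gauss_kernel {..<p} K x / Z))"
    "(\<integral>\<^sup>+ x. ennreal (gauss_kernel {..<p} K x) \<partial>lebesgue_on_coords {..<p}) = ennreal Z"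
proof -
  obtain B where B: "mat_inverse C = Some B" "B \<in> carrier_mat p p" "inv_on {..<p} (entries C) (entries B)"
    using pd_inverse[OF pd] by blast
  define Z where "Z = sqrt ((2 * pi) ^ p * Determinant.det C)"
  note n = gauss_normalization[OF pd B(3)]
  have "scalar_prod (Matrix.vec p x) (the (mat_inverse C) *\<^sub>v Matrix.vec p x) = quad {..<p} (entries B) x" for x
  proof -
    have v: "Matrix.vec p x \<in> carrier_vec p" by simp
    have "quad {..<p} (entries B) (\<lambda>i. vec_index (Matrix.vec p x) i) = quad {..<p} (entries B) x"
      by (rule quad_cong) simp
    then show ?thesis unfolding B(1) option.sel mat_vec_quad[OF B(2) v] .
  qed
  then have "normal_dist p C = density (lebesgue_on_coords {..<p}) (\<lambda>x. ennreal (gauss_kernel {..<p} (entries B) x / Z))"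
    unfolding normal_dist_def gauss_kernel_def Z_def by simp
  moreover have "0 < Z" unfolding Z_def using n by simp
  ultimately show ?thesis using that B(3) n unfolding Z_def by blast
qed

lemma sets_normal_dist: "sets (normal_dist p C) = sets (PiM {..<p} (\<lambda>_. borel))"
  unfolding normal_dist_def by (auto intro!: sets_PiM_cong)

lemma normal_dist_marginal:
  assumes pd: "pd_correlation_matrix p C" and I: "I \<subseteq> {..<p}"
  obtains c L where "0 < c" "inv_on I (entries C) L" "\<forall>f \<in> borel_measurable (lebesgue_on_coords I).
    (\<integral>\<^sup>+ x. f (restrict x I) \<partial>normal_dist p C) = ennreal c * (\<integral>\<^sup>+ x. f x * ennreal (gauss_kernel I L x) \<partial>lebesgue_on_coords I)"
proof -
  obtain K Z where K: "inv_on {..<p} (entries C) K" "0 < Z"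
    "normal_dist p C = density (lebesgue_on_coords {..<p}) (\<lambda>x. ennreal (gauss_kernel {..<p} K x / Z))"
    using normal_dist_density[OF pd] by metis
  from gauss_marginal[OF pd order_refl K(1) I]
  obtain c L where c: "0 < c" "inv_on I (entries C) L" "\<forall>f \<in> borel_measurable (lebesgue_on_coords I).
    (\<integral>\<^sup>+ x. f (restrict x I) * ennreal (gauss_kernel {..<p} K x) \<partial>lebesgue_on_coords {..<p})
    = ennreal c * (\<integral>\<^sup>+ x. f x * ennreal (gauss_kernel I L x) \<partial>lebesgue_on_coords I)"
    by (elim exE conjE)
  have "(\<integral>\<^sup>+ x. f (restrict x I) \<partial>normal_dist p C) = ennreal (c / Z) * (\<integral>\<^sup>+ x. f x * ennreal (gauss_kernel I L x) \<partial>lebesgue_on_coords I)"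
    if f: "f \<in> borel_measurable (lebesgue_on_coords I)" for f
  proof -
    have m: "(\<lambda>x. f (restrict x I)) \<in> borel_measurable (lebesgue_on_coords {..<p})"
      by (rule measurable_compose[OF measurable_restrict_subset[OF I] f])
    have g: "(\<lambda>x. ennreal (gauss_kernel {..<p} K x / Z)) \<in> borel_measurable (lebesgue_on_coords {..<p})"
      using measurable_gauss_kernel[of "{..<p}" "{..<p}" K]
      by (intro measurable_compose[OF _ measurable_ennreal] borel_measurable_divide) auto
    have "(\<integral>\<^sup>+ x. f (restrict x I) \<partial>normal_dist p C)
      = (\<integral>\<^sup>+ x. ennreal (1 / Z) * (f (restrict x I) * ennreal (gauss_kernel {..<p} K x)) \<partial>lebesgue_on_coords {..<p})"
    proof -
      have "ennreal (gauss_kernel {..<p} K x / Z) = ennreal (1 / Z) * ennreal (gauss_kernel {..<p} K x)" for x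
        using K(2) by (subst ennreal_mult[symmetric]) (auto simp: gauss_kernel_def)
      then show ?thesis unfolding K(3) nn_integral_density[OF g m] by (simp add: mult_ac)
    qed
    also have "\<dots> = ennreal (1 / Z) * (\<integral>\<^sup>+ x. f (restrict x I) * ennreal (gauss_kernel {..<p} K x) \<partial>lebesgue_on_coords {..<p})"
      by (intro nn_integral_cmult borel_measurable_times_ennreal m measurable_ennreal_gauss_kernel order_refl)
    also have "\<dots> = ennreal (c / Z) * (\<integral>\<^sup>+ x. f x * ennreal (gauss_kernel I L x) \<partial>lebesgue_on_coords I)"
      unfolding bspec[OF c(3) f] using c(1) K(2) by (simp add: mult.assoc[symmetric] ennreal_mult[symmetric])
    finally show ?thesis .
  qed
  moreover have "0 < c / Z" using c(1) K(2) by simp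
  ultimately show ?thesis using that c(2) by blast
qed

lemma prob_space_normal_dist:
  assumes pd: "pd_correlation_matrix p C"
  shows "prob_space (normal_dist p C)"
proof
  obtain K Z where K: "0 < Z"
    "normal_dist p C = density (lebesgue_on_coords {..<p}) (\<lambda>x. ennreal (gauss_kernel {..<p} K x / Z))"
    "(\<integral>\<^sup>+ x. ennreal (gauss_kernel {..<p} K x) \<partial>lebesgue_on_coords {..<p}) = ennreal Z"
    using normal_dist_density[OF pd] by metis
  have g: "(\<lambda>x. ennreal (gauss_kernel {..<p} K x / Z)) \<in> borel_measurable (lebesgue_on_coords {..<p})"
    using measurable_gauss_kernel[of "{..<p}" "{..<p}" K]
    by (intro measurable_compose[OF _ measurable_ennreal] borel_measurable_divide) auto
  have "emeasure (normal_dist p C) (space (normal_dist p C))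
    = (\<integral>\<^sup>+ x. ennreal (1 / Z) * ennreal (gauss_kernel {..<p} K x) \<partial>lebesgue_on_coords {..<p})"
    unfolding K(2) using K(1) emeasure_density[OF g sets.top]
    by (auto intro!: nn_integral_cong simp: ennreal_mult[symmetric] gauss_kernel_def)
  also have "\<dots> = ennreal (1 / Z) * ennreal Z"
    unfolding K(3)[symmetric] by (intro nn_integral_cmult measurable_ennreal_gauss_kernel order_refl)
  also have "\<dots> = 1" using K(1) by (simp add: ennreal_mult[symmetric])
  finally show "emeasure (normal_dist p C) (space (normal_dist p C)) = 1" .
qed

lemma strict_mono_borel:
  assumes "strict_mono (g :: real \<Rightarrow> real)" shows "g \<in> borel_measurable borel"
  using assms by (intro borel_measurable_mono strict_mono_mono)

lemma strict_marginals_id: "strict_marginals p (\<lambda>_ x. x)"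
  by (simp add: strict_marginals_def strict_mono_def)

lemma measurable_marginal_map:
  assumes "strict_marginals p h"
  shows "(\<lambda>z. \<lambda>v\<in>{..<p}. h v (z v)) \<in> measurable (normal_dist p C) (PiM {..<p} (\<lambda>_. borel))"
proof -
  have "(\<lambda>z. \<lambda>v\<in>{..<p}. h v (z v)) \<in> measurable (PiM {..<p} (\<lambda>_. borel)) (PiM {..<p} (\<lambda>_. borel))"
  proof (rule measurable_restrict)
    fix v assume v: "v \<in> {..<p}"
    then have "h v \<in> borel_measurable borel" using assms strict_mono_borel unfolding strict_marginals_def by auto
    then show "(\<lambda>z. h v (z v)) \<in> borel_measurable (PiM {..<p} (\<lambda>_. borel))"
      by (rule measurable_compose[OF measurable_component_singleton[OF v]])
  qed
  then show ?thesis using measurable_cong_sets[OF sets_normal_dist refl] by blast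
qed

lemma prob_space_npn:
  assumes "pd_correlation_matrix p C" "strict_marginals p h"
  shows "prob_space (npn p h C)"
  unfolding npn_def by (rule prob_space.prob_space_distr[OF prob_space_normal_dist[OF assms(1)] measurable_marginal_map[OF assms(2)]])

lemma sets_npn: "sets (npn p h C) = sets (PiM {..<p} (\<lambda>_. borel))"
  unfolding npn_def by simp

section \<open>Conditional independence and the precision matrix\<close>

definition normal_prob :: "real \<Rightarrow> real \<Rightarrow> real set \<Rightarrow> ennreal" where
  "normal_prob m \<sigma> F = (\<integral>\<^sup>+ t. ennreal (normal_density m \<sigma> t) * indicator F t \<partial>lborel)"

text \<open>\<open>P (T \<in> F, Y \<in> H)\<close> for \<open>Y \<sim> N(m, \<tau>\<^sup>2)\<close> and \<open>T \<sim> N(\<alpha> + \<beta> Y, \<sigma>\<^sup>2)\<close> given \<open>Y\<close>.\<close>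

definition regression_prob ::
  "real \<Rightarrow> real \<Rightarrow> real \<Rightarrow> real \<Rightarrow> real \<Rightarrow> real set \<Rightarrow> real set \<Rightarrow> ennreal" where
  "regression_prob m \<tau> \<alpha> \<beta> \<sigma> F H =
     (\<integral>\<^sup>+ y. ennreal (normal_density m \<tau> y) * (indicator H y * normal_prob (\<alpha> + \<beta> * y) \<sigma> F) \<partial>lborel)"

lemma measurable_normal_prob [measurable]:
  assumes [measurable]: "m \<in> borel_measurable N" "F \<in> sets borel"
  shows "(\<lambda>x. normal_prob (m x) \<sigma> F) \<in> borel_measurable N"
  unfolding normal_prob_def normal_density_def by measurable

lemma measurable_regression_prob [measurable]:
  assumes [measurable]: "m \<in> borel_measurable N" "\<alpha> \<in> borel_measurable N" "F \<in> sets borel" "H \<in> sets borel"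
  shows "(\<lambda>x. regression_prob (m x) \<tau> (\<alpha> x) \<beta> \<sigma> F H) \<in> borel_measurable N"
  unfolding regression_prob_def normal_density_def by measurable

lemma normal_prob_UNIV: "0 < \<sigma> \<Longrightarrow> normal_prob m \<sigma> UNIV = 1"
  unfolding normal_prob_def by (simp add: nn_integral_normal_density)

lemma normal_prob_le_1: "0 < \<sigma> \<Longrightarrow> normal_prob m \<sigma> F \<le> 1"
  unfolding normal_prob_UNIV[symmetric, of \<sigma> m] normal_prob_def
  by (intro nn_integral_mono) (auto split: split_indicator)

lemma regression_prob_UNIV_left: "0 < \<sigma> \<Longrightarrow> regression_prob m \<tau> \<alpha> \<beta> \<sigma> UNIV H = normal_prob m \<tau> H"
  unfolding regression_prob_def normal_prob_UNIV unfolding normal_prob_def by simp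

lemma regression_prob_le_1:
  assumes "0 < \<sigma>" "0 < \<tau>" shows "regression_prob m \<tau> \<alpha> \<beta> \<sigma> F H \<le> 1"
proof -
  have "regression_prob m \<tau> \<alpha> \<beta> \<sigma> F H \<le> (\<integral>\<^sup>+ y. ennreal (normal_density m \<tau> y) \<partial>lborel)"
    unfolding regression_prob_def
  proof (rule nn_integral_mono)
    fix y
    have "indicator H y * normal_prob (\<alpha> + \<beta> * y) \<sigma> F \<le> 1 * 1"
      using normal_prob_le_1[OF assms(1)] by (intro mult_mono) (auto split: split_indicator)
    then show "ennreal (normal_density m \<tau> y) * (indicator H y * normal_prob (\<alpha> + \<beta> * y) \<sigma> F) \<le> ennreal (normal_density m \<tau> y)"
      using mult_left_mono[of _ 1 "ennreal (normal_density m \<tau> y)"] by simp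
  qed
  then show ?thesis using nn_integral_normal_density[OF assms(2)] by simp
qed

lemma regression_prob_no_slope:
  assumes "0 < \<sigma>" "0 < \<tau>" and [measurable]: "F \<in> sets borel" "H \<in> sets borel"
  shows "regression_prob m \<tau> \<alpha> 0 \<sigma> F H = regression_prob m \<tau> \<alpha> 0 \<sigma> F UNIV * regression_prob m \<tau> \<alpha> 0 \<sigma> UNIV H"
proof -
  have "regression_prob m \<tau> \<alpha> 0 \<sigma> F H' = normal_prob \<alpha> \<sigma> F * normal_prob m \<tau> H'"
    if [measurable]: "H' \<in> sets borel" for H'
  proof -
    have "regression_prob m \<tau> \<alpha> 0 \<sigma> F H' = (\<integral>\<^sup>+ y. normal_prob \<alpha> \<sigma> F * (ennreal (normal_density m \<tau> y) * indicator H' y) \<partial>lborel)"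
      unfolding regression_prob_def by (intro nn_integral_cong) (simp add: mult_ac)
    also have "\<dots> = normal_prob \<alpha> \<sigma> F * normal_prob m \<tau> H'"
      unfolding normal_prob_def[of m \<tau> H'] by (rule nn_integral_cmult) measurable
    finally show ?thesis .
  qed
  then show ?thesis using normal_prob_UNIV[OF assms(2)] regression_prob_UNIV_left[OF assms(1)] by simp
qed

lemma normal_prob_positive_half:
  assumes "0 < \<sigma>"
  shows "normal_prob m \<sigma> {0<..} = emeasure (density lborel std_normal_density) {- m / \<sigma><..}"
proof -
  have d: "\<sigma> * normal_density m \<sigma> (m + \<sigma> * x) = std_normal_density x" for x
    using assms by (simp add: normal_density_def real_sqrt_mult power_mult_distrib)
  have "normal_prob m \<sigma> {0<..} = ennreal \<bar>\<sigma>\<bar> *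
      (\<integral>\<^sup>+ x. ennreal (normal_density m \<sigma> (m + \<sigma> * x)) * indicator {0<..} (m + \<sigma> * x) \<partial>lborel)"
    unfolding normal_prob_def by (rule nn_integral_real_affine) (use assms in auto)
  also have "\<dots> = (\<integral>\<^sup>+ x. ennreal (std_normal_density x) * indicator {- m / \<sigma><..} x \<partial>lborel)"
    using assms unfolding d[symmetric]
    by (subst nn_integral_cmult[symmetric])
      (auto intro!: nn_integral_cong simp: ennreal_mult field_simps split: split_indicator)
  finally show ?thesis by (simp add: emeasure_density)
qed

text \<open>After standardisation a larger mean adds an interval of positive length, on which the
  density is positive.\<close>

lemma normal_prob_positive_half_strict_mono:
  assumes "0 < \<sigma>" "m < m'"
  shows "normal_prob m \<sigma> {0<..} < normal_prob m' \<sigma> {0<..}"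
proof -
  let ?E = "density lborel std_normal_density"
  interpret E: prob_space ?E by (rule prob_space_normal_density) simp
  define a b where "a = - m' / \<sigma>" and "b = - m / \<sigma>"
  have ab: "a < b" unfolding a_def b_def using assms by (simp add: divide_strict_right_mono)
  have "emeasure ?E {a<..b} \<noteq> 0"
  proof
    assume "emeasure ?E {a<..b} = 0"
    then have "{a<..b} \<in> null_sets ?E" by auto
    then have "AE x in lborel. x \<in> {a<..b} \<longrightarrow> ennreal (std_normal_density x) = 0"
      by (subst (asm) null_sets_density_iff) auto
    then have "AE x in lborel. x \<notin> {a<..b}"
    proof (eventually_elim)
      case (elim x)
      then show ?case using normal_density_pos[of 1 0 x] by (auto simp: ennreal_eq_0_iff)
    qed
    then have "emeasure lborel {a<..b} = 0" by (subst (asm) AE_iff_measurable[of "{a<..b}"]) auto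
    then show False using ab by simp
  qed
  moreover have "emeasure ?E {a<..} = emeasure ?E {a<..b} + emeasure ?E {b<..}"
  proof -
    have "{a<..} = {a<..b} \<union> {b<..}" using ab by auto
    then show ?thesis using plus_emeasure[of "{a<..b}" ?E "{b<..}"] by (simp add: Int_def)
  qed
  ultimately have "emeasure ?E {b<..} < emeasure ?E {a<..}"
    unfolding E.emeasure_eq_measure
    by (auto simp: ennreal_plus[symmetric] ennreal_less_iff less_le simp del: ennreal_plus)
  then show ?thesis unfolding normal_prob_positive_half[OF assms(1)] a_def b_def .
qed

text \<open>
  Chebyshev's association inequality: \<open>P (T > 0 | Y = y)\<close> is strictly monotone in \<open>y\<close>, hence
  strictly correlated with the indicator of \<open>y > 0\<close>.
\<close>

lemma regression_prob_slope:
  assumes s: "0 < \<sigma>" "0 < \<tau>" and b: "\<beta> \<noteq> 0"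
  shows "regression_prob m \<tau> \<alpha> \<beta> \<sigma> {0<..} {0<..} \<noteq>
    regression_prob m \<tau> \<alpha> \<beta> \<sigma> {0<..} UNIV * regression_prob m \<tau> \<alpha> \<beta> \<sigma> UNIV {0<..}"
proof
  let ?R = "regression_prob m \<tau> \<alpha> \<beta> \<sigma>" and ?H = "{0<..} :: real set"
  assume eq: "?R ?H ?H = ?R ?H UNIV * ?R UNIV ?H"
  define N where "N = density lborel (\<lambda>y. ennreal (normal_density m \<tau> y))"
  interpret N: prob_space N unfolding N_def by (rule prob_space_normal_density[OF s(2)])
  define G where "G y = enn2real (normal_prob (\<alpha> + \<beta> * y) \<sigma> ?H)" for y
  have sN [measurable_cong]: "sets N = sets borel" unfolding N_def by simp
  have [measurable]: "G \<in> borel_measurable borel" unfolding G_def by measurable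
  have G: "normal_prob (\<alpha> + \<beta> * y) \<sigma> ?H = ennreal (G y)" "0 \<le> G y" "G y \<le> 1" for y
    using normal_prob_le_1[OF s(1), of "\<alpha> + \<beta> * y" ?H] unfolding G_def
    by (auto simp: enn2real_leI ennreal_enn2real_if top_unique)
  have R: "?R ?H X = ennreal (\<integral>y. G y * indicator X y \<partial>N)" if [measurable]: "X \<in> sets borel" for X
  proof -
    have "?R ?H X = (\<integral>\<^sup>+ y. ennreal (G y * indicator X y) \<partial>N)"
      unfolding N_def regression_prob_def G
      by (subst nn_integral_density) (auto intro!: nn_integral_cong split: split_indicator)
    also have "\<dots> = ennreal (\<integral>y. G y * indicator X y \<partial>N)"
      using G by (intro nn_integral_eq_integral N.integrable_const_bound[of _ 1])
        (auto split: split_indicator)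
    finally show ?thesis .
  qed
  have RU: "?R UNIV ?H = ennreal (N.prob ?H)"
    unfolding regression_prob_UNIV_left[OF s(1)] normal_prob_def
    by (simp add: N_def emeasure_density N.emeasure_eq_measure[symmetric, unfolded N_def])
  define sg where "sg = sgn \<beta>"
  \<comment> \<open>Both differences change sign only at 0, and \<open>sg\<close> corrects for a
    decreasing \<open>G\<close>, so \<open>W\<close> is positive off 0. Subtracting
    \<open>G 0\<close> instead of the mean of \<open>G\<close> is allowed because the second factor
    has mean 0; the integral of \<open>W\<close> is \<open>sg\<close> times the covariance.\<close>
  define W where "W y = sg * ((G y - G 0) * (indicator ?H y - N.prob ?H))" for y
  have integ: "integrable N (\<lambda>y. G y * indicator X y)" if [measurable]: "X \<in> sets borel" for X
    using G by (intro N.integrable_const_bound[of _ 1]) (auto split: split_indicator)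
  have iH: "integrable N (\<lambda>y. indicator ?H y :: real)" by (intro N.integrable_const_bound[of _ 1]) auto
  have iW: "integrable N W"
    using integ[of ?H] integ[of UNIV] iH unfolding W_def
    by (simp add: algebra_simps) 
  have "(\<integral>y. G y * indicator ?H y \<partial>N) = (\<integral>y. G y * indicator UNIV y \<partial>N) * N.prob ?H"
    using eq unfolding R[of ?H, simplified] R[of UNIV, simplified] RU
    using G by (simp add: ennreal_mult[symmetric] ennreal_inj integral_nonneg_AE)
  moreover have "integral\<^sup>L N W = sg * ((\<integral>y. G y * indicator ?H y \<partial>N) - (\<integral>y. G y * indicator UNIV y \<partial>N) * N.prob ?H)"
  proof -
    have "W = (\<lambda>y. sg * (G y * indicator ?H y - G y * indicator UNIV y * N.prob ?H - G 0 * indicator ?H y + G 0 * N.prob ?H))"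
      unfolding W_def by (auto simp: algebra_simps)
    then show ?thesis using integ[of ?H] integ[of UNIV] iH by (simp add: N.prob_space)
  qed
  ultimately have W0: "integral\<^sup>L N W = 0" by simp
  have "normal_prob m \<tau> ?H = ennreal (N.prob ?H)" using RU regression_prob_UNIV_left[OF s(1)] by metis
  \<comment> \<open>Comparison with the means \<open>m + 1\<close> and \<open>m - 1\<close> puts the
    probability strictly between 0 and 1.\<close>
  then have "ennreal (N.prob ?H) < normal_prob (m + 1) \<tau> ?H" "normal_prob (m - 1) \<tau> ?H < ennreal (N.prob ?H)"
    using normal_prob_positive_half_strict_mono[OF s(2), of m "m + 1"]
      normal_prob_positive_half_strict_mono[OF s(2), of "m - 1" m] by simp_all
  then have "ennreal (N.prob ?H) < 1" "0 < ennreal (N.prob ?H)"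
    using normal_prob_le_1[OF s(2), of "m + 1" ?H]
    by (blast intro: order.strict_trans2 order.strict_trans1[OF zero_le])+
  then have meas: "N.prob ?H < 1" "0 < N.prob ?H" by simp_all
  have Gm: "G y < G z" if "\<alpha> + \<beta> * y < \<alpha> + \<beta> * z" for y z
    using normal_prob_positive_half_strict_mono[OF s(1) that] unfolding G(1) using G(2) by (simp add: ennreal_less_iff)
  have Wpos: "0 < W y" if y: "y \<noteq> 0" for y
  proof -
    have "0 < sg * (G y - G 0)" if "0 < y"
    proof (cases "0 < \<beta>")
      case True
      then show ?thesis using Gm[of 0 y] that unfolding sg_def by simp
    next
      case False
      then have "\<beta> * y < 0" using b that by (simp add: mult_neg_pos)
      then show ?thesis using Gm[of y 0] False b unfolding sg_def by (simp add: sgn_if)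
    qed
    moreover have "sg * (G y - G 0) < 0" if "y < 0"
    proof (cases "0 < \<beta>")
      case True
      then have "\<beta> * y < 0" using that by (simp add: mult_pos_neg)
      then show ?thesis using Gm[of y 0] True unfolding sg_def by simp
    next
      case False
      then have "0 < \<beta> * y" using b that by (simp add: mult_neg_neg)
      then show ?thesis using Gm[of 0 y] False b unfolding sg_def by (simp add: sgn_if)
    qed
    ultimately show ?thesis using y meas unfolding W_def mult.assoc[symmetric]
      by (cases "0 < y") (auto simp: mult_neg_neg mult_neg_pos)
  qed
  have Wnn: "0 \<le> W y" for y using Wpos[of y] by (cases "y = 0") (auto simp: W_def)
  have "AE y in N. W y = 0"
    using W0 integral_nonneg_eq_0_iff_AE[OF iW] Wnn by simp
  then have "AE y in N. y \<notin> ?H"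
  proof eventually_elim
    case (elim y)
    then show ?case using Wpos[of y] by auto
  qed
  then have "N.prob ?H = 0" by (subst N.prob_eq_0) auto
  then show False using meas(2) by simp
qed


section \<open>Conditional law of two coordinates given others\<close>

lemma measurable_lebesgue_on_coords:
  "measurable (lebesgue_on_coords I) N = measurable (PiM I (\<lambda>_. borel)) N"
  by (intro measurable_cong_sets sets_PiM_cong) auto

text \<open>A disintegration over the coordinates in \<open>S\<close>: the remaining ones are
  integrated out, then the square is completed at \<open>u\<close> and at \<open>v\<close>.
  \<open>\<rho>\<close> is the density of the conditioning coordinates and
  \<open>- L u v / L u u\<close> the regression coefficient of coordinate \<open>u\<close> on
  coordinate \<open>v\<close>. The free function \<open>g\<close> is what identifies conditional
  expectations later.\<close>

lemma normal_dist_regression: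
  assumes pd: "pd_correlation_matrix p C" and uv: "u < p" "v < p" "u \<noteq> v" and S: "S \<subseteq> {..<p} - {u, v}"
  obtains L \<rho> m \<alpha> \<tau> \<sigma> where "inv_on (insert u (insert v S)) (entries C) L" "0 < \<sigma>" "0 < \<tau>"
    "\<rho> \<in> borel_measurable (lebesgue_on_coords S)"
    "m \<in> borel_measurable (lebesgue_on_coords S)" "\<alpha> \<in> borel_measurable (lebesgue_on_coords S)"
    "1 \<le> L u u"
    "\<forall>g \<in> borel_measurable (lebesgue_on_coords S). \<forall>F \<in> sets borel. \<forall>H \<in> sets borel.
      (\<integral>\<^sup>+ x. g (restrict x S) * (indicator F (x u) * indicator H (x v)) \<partial>normal_dist p C)
      = (\<integral>\<^sup>+ s. \<rho> s * (g s * regression_prob (m s) \<tau> (\<alpha> s) (- L u v / L u u) \<sigma> F H) \<partial>lebesgue_on_coords S)"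
proof -
  define J I where "J = insert v S" and "I = insert u J"
  have fin: "finite S" "finite J" and nin: "v \<notin> S" "u \<notin> J" "u \<notin> S" and Ip: "I \<subseteq> {..<p}" "J \<subseteq> {..<p}"
    using S uv unfolding I_def J_def by (auto intro: finite_subset[of S "{..<p}"])
  obtain c L where L: "0 < c" "inv_on I (entries C) L" "\<forall>f \<in> borel_measurable (lebesgue_on_coords I).
    (\<integral>\<^sup>+ x. f (restrict x I) \<partial>normal_dist p C) = ennreal c * (\<integral>\<^sup>+ x. f x * ennreal (gauss_kernel I L x) \<partial>lebesgue_on_coords I)"
    by (rule normal_dist_marginal[OF pd Ip(1)])
  have sL: "sym_on (insert u J) L" and Lu: "1 \<le> L u u"
    using pd_inverse_diag[OF pd Ip(1) L(2), of u] unfolding I_def by auto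
  define L1 where "L1 = schur L u"
  have inv1: "inv_on J (entries C) L1"
    using inv_on_schur[OF fin(2) nin(2) L(2)[unfolded I_def]] Lu unfolding L1_def by simp
  have sL1: "sym_on (insert v S) L1" and L1v: "1 \<le> L1 v v"
    using pd_inverse_diag[OF pd Ip(2) inv1, of v] unfolding J_def by auto
  define L2 where "L2 = schur L1 v"
  have Lu0: "0 < L u u" and L1v0: "0 < L1 v v" using Lu L1v by simp_all
  define \<sigma> \<tau> where "\<sigma> = 1 / sqrt (L u u)" and "\<tau> = 1 / sqrt (L1 v v)"
  have st: "0 < \<sigma>" "0 < \<tau>" using Lu L1v unfolding \<sigma>_def \<tau>_def by auto
  define \<alpha> where "\<alpha> s = - (\<Sum>k\<in>S. L u k * s k) / L u u" for s
  define m where "m s = - (\<Sum>k\<in>S. L1 v k * s k) / L1 v v" for s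
  define c1 c2 where "c1 = sqrt (2 * pi / L u u)" and "c2 = sqrt (2 * pi / L1 v v)"
  have c12: "0 < c1" "0 < c2" unfolding c1_def c2_def using Lu L1v by auto
  define \<rho> where "\<rho> s = ennreal (c * c1 * c2) * ennreal (gauss_kernel S L2 s)" for s
  have meas: "(\<lambda>s. - (\<Sum>k\<in>B. a k * s k) / b) \<in> borel_measurable (lebesgue_on_coords B)" for a :: "nat \<Rightarrow> real" and b B
    using measurable_coord[of _ B]
    by (intro borel_measurable_divide borel_measurable_uminus borel_measurable_sum borel_measurable_times) auto
  have m\<rho>: "\<rho> \<in> borel_measurable (lebesgue_on_coords S)" unfolding \<rho>_def
    by (intro borel_measurable_times_ennreal borel_measurable_const measurable_ennreal_gauss_kernel order_refl)
  have m\<alpha>: "\<alpha> \<in> borel_measurable (lebesgue_on_coords S)" and mm: "m \<in> borel_measurable (lebesgue_on_coords S)"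
    unfolding \<alpha>_def m_def by (rule meas)+
  have main: "(\<integral>\<^sup>+ x. g (restrict x S) * (indicator F (x u) * indicator H (x v)) \<partial>normal_dist p C)
      = (\<integral>\<^sup>+ s. \<rho> s * (g s * regression_prob (m s) \<tau> (\<alpha> s) (- L u v / L u u) \<sigma> F H) \<partial>lebesgue_on_coords S)"
    if g: "g \<in> borel_measurable (lebesgue_on_coords S)" and F[measurable]: "F \<in> sets borel" and H[measurable]: "H \<in> sets borel" for g F H
  proof -
    define f where "f x = g (restrict x S) * (indicator F (x u) * indicator H (x v))" for x :: "nat \<Rightarrow> real"
    define \<mu> where "\<mu> x = - (\<Sum>k\<in>J. L u k * x k) / L u u" for x
    have ind: "(\<lambda>x. indicator F (x j) :: ennreal) \<in> borel_measurable (lebesgue_on_coords B)" if "j \<in> B" "F \<in> sets borel" for j B and F :: "real set"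
      by (rule measurable_compose[OF measurable_coord[OF that(1)]]) (use that(2) in simp)
    have gB: "(\<lambda>x. g (restrict x S)) \<in> borel_measurable (lebesgue_on_coords B)" if "S \<subseteq> B" for B
      by (rule measurable_compose[OF measurable_restrict_subset[OF that] g])
    have f: "f \<in> borel_measurable (lebesgue_on_coords I)" unfolding f_def
      by (intro borel_measurable_times_ennreal gB ind F H) (auto simp: I_def J_def)
    have "restrict (restrict x I) S = restrict x S" "restrict x I u = x u" "restrict x I v = x v" for x :: "nat \<Rightarrow> real"
      by (auto simp: I_def J_def)
    then have "(\<integral>\<^sup>+ x. f x \<partial>normal_dist p C) = (\<integral>\<^sup>+ x. f (restrict x I) \<partial>normal_dist p C)"
      unfolding f_def by simp
    also have "\<dots> = ennreal c * (\<integral>\<^sup>+ x. f x * ennreal (gauss_kernel I L x) \<partial>lebesgue_on_coords I)"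
      by (rule bspec[OF L(3) f])
    also have "(\<integral>\<^sup>+ x. f x * ennreal (gauss_kernel I L x) \<partial>lebesgue_on_coords I)
      = (\<integral>\<^sup>+ x. \<integral>\<^sup>+ t. f (x(u := t)) * ennreal (gauss_kernel I L (x(u := t))) \<partial>lborel \<partial>lebesgue_on_coords J)"
      unfolding I_def
      by (rule lborel_product.product_nn_integral_insert[OF fin(2) nin(2)])
        (intro borel_measurable_times_ennreal f[unfolded I_def] measurable_ennreal_gauss_kernel order_refl)
    also have "\<dots> = (\<integral>\<^sup>+ x. ennreal c1 * (g (restrict x S) * indicator H (x v) * normal_prob (\<mu> x) \<sigma> F) * ennreal (gauss_kernel J L1 x) \<partial>lebesgue_on_coords J)"
    proof (intro nn_integral_cong)
      fix x :: "nat \<Rightarrow> real"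
      have r: "restrict (x(u := t)) S = restrict x S" "(x(u := t)) u = t" "(x(u := t)) v = x v" for t
        using nin uv(3) by auto
      have "(\<integral>\<^sup>+ t. f (x(u := t)) * ennreal (gauss_kernel I L (x(u := t))) \<partial>lborel)
        = (\<integral>\<^sup>+ t. (ennreal c1 * (g (restrict x S) * indicator H (x v)) * ennreal (gauss_kernel J L1 x)) *
            (ennreal (normal_density (\<mu> x) \<sigma> t) * indicator F t) \<partial>lborel)"
        unfolding f_def r I_def gauss_complete_square[OF fin(2) nin(2) sL Lu0]
          L1_def[symmetric] c1_def[symmetric] \<sigma>_def[symmetric] \<mu>_def[symmetric]
        using c12 by (intro nn_integral_cong) (simp add: ennreal_mult gauss_kernel_def mult_ac)
      also have "\<dots> = (ennreal c1 * (g (restrict x S) * indicator H (x v)) * ennreal (gauss_kernel J L1 x)) * normal_prob (\<mu> x) \<sigma> F"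
        unfolding normal_prob_def by (rule nn_integral_cmult) measurable
      finally show "(\<integral>\<^sup>+ t. f (x(u := t)) * ennreal (gauss_kernel I L (x(u := t))) \<partial>lborel)
        = ennreal c1 * (g (restrict x S) * indicator H (x v) * normal_prob (\<mu> x) \<sigma> F) * ennreal (gauss_kernel J L1 x)"
        by (simp add: mult_ac)
    qed
    also have "\<dots> = (\<integral>\<^sup>+ s. \<integral>\<^sup>+ y. ennreal c1 * (g (restrict (s(v := y)) S) * indicator H ((s(v := y)) v) *
        normal_prob (\<mu> (s(v := y))) \<sigma> F) * ennreal (gauss_kernel J L1 (s(v := y))) \<partial>lborel \<partial>lebesgue_on_coords S)"
      unfolding J_def
    proof (rule lborel_product.product_nn_integral_insert[OF fin(1) nin(1)])
      have "\<mu> \<in> borel_measurable (lebesgue_on_coords J)" unfolding \<mu>_def by (rule meas)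
      then show "(\<lambda>x. ennreal c1 * (g (restrict x S) * indicator H (x v) * normal_prob (\<mu> x) \<sigma> F) *
          ennreal (gauss_kernel (insert v S) L1 x)) \<in> borel_measurable (lebesgue_on_coords (insert v S))"
        unfolding J_def
        by (intro borel_measurable_times_ennreal borel_measurable_const gB ind H F measurable_normal_prob
            measurable_ennreal_gauss_kernel order_refl) auto
    qed
    also have "\<dots> = (\<integral>\<^sup>+ s. ennreal (c1 * c2) * ennreal (gauss_kernel S L2 s) *
        (g s * regression_prob (m s) \<tau> (\<alpha> s) (- L u v / L u u) \<sigma> F H) \<partial>lebesgue_on_coords S)"
    proof (intro nn_integral_cong)
      fix s assume s: "s \<in> space (lebesgue_on_coords S)"
      have rs: "restrict (s(v := y)) S = s" for y
        using s nin(1) by (auto simp: space_PiM PiE_def extensional_def restrict_def)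
      \<comment> \<open>The conditional mean of coordinate \<open>u\<close> is split into the part
        from \<open>S\<close> and the part linear in coordinate \<open>v\<close>.\<close>
      have mu: "\<mu> (s(v := y)) = \<alpha> s + (- L u v / L u u) * y" for y
      proof -
        have "(\<Sum>k\<in>S. L u k * (s(v := y)) k) = (\<Sum>k\<in>S. L u k * s k)" using nin(1) by (intro sum.cong) auto
        then have "(\<Sum>k\<in>J. L u k * (s(v := y)) k) = L u v * y + (\<Sum>k\<in>S. L u k * s k)"
          unfolding J_def using fin(1) nin(1) by simp
        then show ?thesis unfolding \<mu>_def \<alpha>_def by (simp add: add_divide_distrib diff_divide_distrib del: fun_upd_apply)
      qed
      have "(\<integral>\<^sup>+ y. ennreal c1 * (g (restrict (s(v := y)) S) * indicator H ((s(v := y)) v) *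
        normal_prob (\<mu> (s(v := y))) \<sigma> F) * ennreal (gauss_kernel J L1 (s(v := y))) \<partial>lborel)
        = (\<integral>\<^sup>+ y. (ennreal (c1 * c2) * ennreal (gauss_kernel S L2 s) * g s) * (ennreal (normal_density (m s) \<tau> y) *
            (indicator H y * normal_prob (\<alpha> s + (- L u v / L u u) * y) \<sigma> F)) \<partial>lborel)"
        unfolding rs mu J_def gauss_complete_square[OF fin(1) nin(1) sL1 L1v0]
          L2_def[symmetric] c2_def[symmetric] \<tau>_def[symmetric] m_def[symmetric]
        using c12 by (intro nn_integral_cong) (simp add: ennreal_mult gauss_kernel_def mult_ac)
      also have "\<dots> = (ennreal (c1 * c2) * ennreal (gauss_kernel S L2 s) * g s) *
          regression_prob (m s) \<tau> (\<alpha> s) (- L u v / L u u) \<sigma> F H"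
        unfolding regression_prob_def by (rule nn_integral_cmult) measurable
      finally show "(\<integral>\<^sup>+ y. ennreal c1 * (g (restrict (s(v := y)) S) * indicator H ((s(v := y)) v) *
        normal_prob (\<mu> (s(v := y))) \<sigma> F) * ennreal (gauss_kernel J L1 (s(v := y))) \<partial>lborel)
        = ennreal (c1 * c2) * ennreal (gauss_kernel S L2 s) *
          (g s * regression_prob (m s) \<tau> (\<alpha> s) (- L u v / L u u) \<sigma> F H)" by (simp add: mult_ac)
    qed
    also have "ennreal c * \<dots> = (\<integral>\<^sup>+ s. \<rho> s * (g s * regression_prob (m s) \<tau> (\<alpha> s) (- L u v / L u u) \<sigma> F H) \<partial>lebesgue_on_coords S)"
    proof -
      have "(\<lambda>s. ennreal (c1 * c2) * ennreal (gauss_kernel S L2 s) *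
        (g s * regression_prob (m s) \<tau> (\<alpha> s) (- L u v / L u u) \<sigma> F H)) \<in> borel_measurable (lebesgue_on_coords S)"
        by (intro borel_measurable_times_ennreal borel_measurable_const g measurable_regression_prob mm m\<alpha> F H
            measurable_ennreal_gauss_kernel order_refl)
      then show ?thesis unfolding \<rho>_def using L(1) c12
        by (subst nn_integral_cmult[symmetric]) (auto intro!: nn_integral_cong simp: ennreal_mult mult_ac)
    qed
    finally show ?thesis unfolding f_def .
  qed
  show ?thesis
    by (rule that[OF L(2)[unfolded I_def J_def] st m\<rho> mm m\<alpha> Lu]) (use main in blast)
qed

lemma nn_integral_npn_id:
  assumes f: "f \<in> borel_measurable (PiM {..<p} (\<lambda>_. borel))"
  shows "(\<integral>\<^sup>+ x. f x \<partial>npn p (\<lambda>_ x. x) C) = (\<integral>\<^sup>+ x. f x \<partial>normal_dist p C)"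
proof -
  have m: "(\<lambda>z. \<lambda>v\<in>{..<p}. z v) \<in> measurable (normal_dist p C) (PiM {..<p} (\<lambda>_. borel))"
    by (rule measurable_marginal_map[OF strict_marginals_id])
  have "space (normal_dist p C) = space (PiM {..<p} (\<lambda>_. borel :: real measure))"
    using sets_eq_imp_space_eq[OF sets_normal_dist] .
  then have "(\<lambda>v\<in>{..<p}. z v) = z" if "z \<in> space (normal_dist p C)" for z
    using that by (auto simp: space_PiM PiE_def extensional_restrict)
  then show ?thesis unfolding npn_def using m f
    by (subst nn_integral_distr) (auto intro!: nn_integral_cong)
qed

lemma sets_coord_algebra:
  assumes "X \<in> sets (coord_algebra M S)" "space M = space (PiM J (\<lambda>_. borel))"
  obtains G where "G \<in> sets (PiM S (\<lambda>_. borel))" "X = (\<lambda>x. restrict x S) -` G \<inter> space M"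
proof -
  have "(\<lambda>x. restrict x S) \<in> space M \<rightarrow> space (PiM S (\<lambda>_. borel :: real measure))"
    by (auto simp: space_PiM)
  then show ?thesis using assms(1) that unfolding coord_algebra_def by (auto simp: sets_vimage_algebra2)
qed

lemma subalgebra_coord_algebra:
  assumes M: "sets M = sets (PiM J (\<lambda>_. borel))" and S: "S \<subseteq> J"
  shows "subalgebra M (coord_algebra M S)"
  unfolding subalgebra_def
proof
  have sp: "space M = space (PiM J (\<lambda>_. borel :: real measure))" using sets_eq_imp_space_eq[OF M] .
  show "space (coord_algebra M S) = space M" unfolding coord_algebra_def by simp
  have r: "(\<lambda>x. restrict x S) \<in> measurable M (PiM S (\<lambda>_. borel))"
    using measurable_restrict_subset[OF S] measurable_cong_sets[OF M refl] by blast
  show "sets (coord_algebra M S) \<subseteq> sets M"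
  proof
    fix X assume "X \<in> sets (coord_algebra M S)"
    then obtain G where "G \<in> sets (PiM S (\<lambda>_. borel))" "X = (\<lambda>x. restrict x S) -` G \<inter> space M"
      by (rule sets_coord_algebra[OF _ sp])
    then show "X \<in> sets M" using measurable_sets[OF r] by blast
  qed
qed

lemma indicator_singleton_coord:
  assumes "F \<in> sets (PiM {u} (\<lambda>_. borel))"
  obtains F' where "F' \<in> sets (borel :: real measure)"
    "\<And>y. indicator F (restrict y {u}) = (indicator F' (y u) :: real)"
proof -
  define e where "e t = (\<lambda>i\<in>{u}. t :: real)" for t
  have e: "e \<in> measurable borel (PiM {u} (\<lambda>_. borel))" unfolding e_def by (rule measurable_restrict) simp
  have "e -` F \<in> sets borel" using measurable_sets[OF e assms] by simp
  moreover have "restrict y {u} = e (y u)" for y unfolding e_def by auto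
  ultimately show ?thesis using that[of "e -` F"] by (simp add: indicator_def)
qed

text \<open>Given the coordinates in \<open>S\<close>, the conditional probabilities of events in
  coordinates \<open>u\<close> and \<open>v\<close> are the regression probabilities
  \<open>\<Theta>\<close>. They factor for all events if the slope vanishes, and fail to do so for
  two half-lines otherwise.\<close>

lemma cond_indep_npn_iff:
  assumes pd: "pd_correlation_matrix p C" and uv: "u < p" "v < p" "u \<noteq> v" and S: "S \<subseteq> {..<p} - {u, v}"
  shows "cond_indep (npn p (\<lambda>_ x. x) C) {u} {v} S \<longleftrightarrow> inv_entry C ({u, v} \<union> S) u v = 0"
proof -
  define M where "M = npn p (\<lambda>_ x. x) C"
  interpret M: prob_space M unfolding M_def by (rule prob_space_npn[OF pd strict_marginals_id])
  have sM: "sets M = sets (PiM {..<p} (\<lambda>_. borel))" unfolding M_def by (rule sets_npn)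
  have spM: "space M = space (PiM {..<p} (\<lambda>_. borel :: real measure))" using sets_eq_imp_space_eq[OF sM] .
  have SJ: "S \<subseteq> {..<p}" using S by blast
  define A where "A = coord_algebra M S"
  have sub: "subalgebra M A" unfolding A_def by (rule subalgebra_coord_algebra[OF sM SJ])
  interpret A: finite_measure_subalgebra M A by unfold_locales (rule sub)
  obtain L \<rho> m \<alpha> \<tau> \<sigma> where L: "inv_on (insert u (insert v S)) (entries C) L" "0 < \<sigma>" "0 < \<tau>"
    "\<rho> \<in> borel_measurable (lebesgue_on_coords S)"
    "m \<in> borel_measurable (lebesgue_on_coords S)" "\<alpha> \<in> borel_measurable (lebesgue_on_coords S)"
    "1 \<le> L u u"
    and reg: "\<forall>g \<in> borel_measurable (lebesgue_on_coords S). \<forall>F \<in> sets borel. \<forall>H \<in> sets borel.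
      (\<integral>\<^sup>+ x. g (restrict x S) * (indicator F (x u) * indicator H (x v)) \<partial>normal_dist p C)
      = (\<integral>\<^sup>+ s. \<rho> s * (g s * regression_prob (m s) \<tau> (\<alpha> s) (- L u v / L u u) \<sigma> F H) \<partial>lebesgue_on_coords S)"
    by (rule normal_dist_regression[OF pd uv S])
  define \<Theta> where "\<Theta> F H s = regression_prob (m s) \<tau> (\<alpha> s) (- L u v / L u u) \<sigma> F H" for F H s
  have \<Theta>1: "\<Theta> F H s \<le> 1" for F H s unfolding \<Theta>_def by (rule regression_prob_le_1[OF L(2,3)])
  have \<Theta>r: "ennreal (enn2real (\<Theta> F H s)) = \<Theta> F H s" for F H s
    using \<Theta>1[of F H s] by (intro ennreal_enn2real order.strict_trans1[OF _ ennreal_one_less_top])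
  have \<Theta>m: "\<Theta> F H \<in> borel_measurable (PiM S (\<lambda>_. borel))" if "F \<in> sets borel" "H \<in> sets borel" for F H
    unfolding \<Theta>_def measurable_lebesgue_on_coords[symmetric] by (intro measurable_regression_prob L that)
  define \<phi> where "\<phi> F H x = enn2real (\<Theta> F H (restrict x S))" for F H and x :: "nat \<Rightarrow> real"
  have r: "(\<lambda>x. restrict x S) \<in> measurable M (PiM S (\<lambda>_. borel))"
    using measurable_restrict_subset[OF SJ] measurable_cong_sets[OF sM refl] by blast
  have rA: "(\<lambda>x. restrict x S) \<in> measurable A (PiM S (\<lambda>_. borel))"
    unfolding A_def coord_algebra_def by (rule measurable_vimage_algebra1) (auto simp: space_PiM)
  have comp: "(\<lambda>x. x w) \<in> borel_measurable M" if "w < p" for w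
    using measurable_component_singleton[of w "{..<p}" "\<lambda>_. borel"] that measurable_cong_sets[OF sM refl] by blast
  have \<phi>A: "\<phi> F H \<in> borel_measurable A" if "F \<in> sets borel" "H \<in> sets borel" for F H
    unfolding \<phi>_def by (intro borel_measurable_enn2real measurable_compose[OF rA \<Theta>m[OF that]])
  have ce: "AE x in M. real_cond_exp M A (\<lambda>y. indicator F (y u) * indicator H (y v)) x = \<phi> F H x"
    if F: "F \<in> sets borel" and H: "H \<in> sets borel" for F H
  proof (rule A.real_cond_exp_charact)
    define f where "f y = (indicator F (y u) * indicator H (y v) :: real)" for y :: "nat \<Rightarrow> real"
    have fm: "f \<in> borel_measurable M" unfolding f_def
      by (intro borel_measurable_times measurable_compose[OF comp[OF uv(1)] borel_measurable_indicator[OF F]]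
          measurable_compose[OF comp[OF uv(2)] borel_measurable_indicator[OF H]])
    have \<phi>M: "\<phi> F H \<in> borel_measurable M" using \<phi>A[OF F H] measurable_from_subalg[OF sub] by blast
    have \<phi>1: "0 \<le> \<phi> F H x" "\<phi> F H x \<le> 1" for x
      using \<Theta>1[of F H "restrict x S"] unfolding \<phi>_def by (auto intro: enn2real_leI)
    show "integrable M (\<lambda>y. indicator F (y u) * indicator H (y v) :: real)"
      using fm unfolding f_def by (intro M.integrable_const_bound[of _ 1]) (auto split: split_indicator)
    show "integrable M (\<phi> F H)" using \<phi>M \<phi>1 by (intro M.integrable_const_bound[of _ 1]) auto
    show "\<phi> F H \<in> borel_measurable A" using \<phi>A[OF F H] .
    fix X assume "X \<in> sets A"
    then obtain G where G: "G \<in> sets (PiM S (\<lambda>_. borel))" "X = (\<lambda>x. restrict x S) -` G \<inter> space M"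
      unfolding A_def by (rule sets_coord_algebra[OF _ spM])
    have XM: "X \<in> sets M" using measurable_sets[OF r G(1)] G(2) by blast
    have int: "(LINT x:X|M. g x) = enn2real (\<integral>\<^sup>+ x. indicator G (restrict x S) * ennreal (g x) \<partial>M)"
      if "g \<in> borel_measurable M" "\<And>x. 0 \<le> g x" for g :: "(nat \<Rightarrow> real) \<Rightarrow> real"
    proof -
      have "(LINT x:X|M. g x) = (\<integral>x. indicator X x * g x \<partial>M)" unfolding set_lebesgue_integral_def by simp
      also have "\<dots> = enn2real (\<integral>\<^sup>+ x. ennreal (indicator X x * g x) \<partial>M)"
        using that XM by (intro integral_eq_nn_integral) auto
      also have "(\<integral>\<^sup>+ x. ennreal (indicator X x * g x) \<partial>M) = (\<integral>\<^sup>+ x. indicator G (restrict x S) * ennreal (g x) \<partial>M)"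
        using G(2) by (intro nn_integral_cong) (auto split: split_indicator)
      finally show ?thesis .
    qed
    have iG: "(\<lambda>s. indicator G s :: ennreal) \<in> borel_measurable (PiM S (\<lambda>_. borel))" using G(1) by simp
    have toN: "(\<integral>\<^sup>+ x. g x \<partial>M) = (\<integral>\<^sup>+ x. g x \<partial>normal_dist p C)" if "g \<in> borel_measurable M" for g
      unfolding M_def by (rule nn_integral_npn_id) (use that measurable_cong_sets[OF sM refl] in blast)
    have 1: "(\<integral>\<^sup>+ x. indicator G (restrict x S) * ennreal (f x) \<partial>M)
      = (\<integral>\<^sup>+ s. \<rho> s * (indicator G s * \<Theta> F H s) \<partial>lebesgue_on_coords S)"
    proof -
      have "(\<integral>\<^sup>+ x. indicator G (restrict x S) * ennreal (f x) \<partial>M)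
        = (\<integral>\<^sup>+ x. indicator G (restrict x S) * ennreal (f x) \<partial>normal_dist p C)"
        by (intro toN borel_measurable_times_ennreal measurable_compose[OF r iG] measurable_compose[OF fm measurable_ennreal])
      also have "\<dots> = (\<integral>\<^sup>+ x. indicator G (restrict x S) * (indicator F (x u) * indicator H (x v)) \<partial>normal_dist p C)"
        unfolding f_def by (intro nn_integral_cong) (auto split: split_indicator)
      also have "\<dots> = (\<integral>\<^sup>+ s. \<rho> s * (indicator G s * \<Theta> F H s) \<partial>lebesgue_on_coords S)"
        unfolding \<Theta>_def by (rule reg[rule_format]) (use iG F H measurable_lebesgue_on_coords in auto)
      finally show ?thesis .
    qed
    have 2: "(\<integral>\<^sup>+ x. indicator G (restrict x S) * ennreal (\<phi> F H x) \<partial>M)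
      = (\<integral>\<^sup>+ s. \<rho> s * (indicator G s * \<Theta> F H s) \<partial>lebesgue_on_coords S)"
    proof -
      have g: "(\<lambda>s. indicator G s * \<Theta> F H s) \<in> borel_measurable (PiM S (\<lambda>_. borel))"
        by (intro borel_measurable_times_ennreal iG \<Theta>m F H)
      have "(\<integral>\<^sup>+ x. indicator G (restrict x S) * ennreal (\<phi> F H x) \<partial>M)
        = (\<integral>\<^sup>+ x. indicator G (restrict x S) * \<Theta> F H (restrict x S) \<partial>normal_dist p C)"
        unfolding \<phi>_def \<Theta>r by (intro toN measurable_compose[OF r g])
      \<comment> \<open>The disintegration is used again with \<open>UNIV\<close> for both events,
        whose regression probability is 1; it then integrates functions of the conditioning
        coordinates against \<open>\<rho>\<close>.\<close>
      also have "\<dots> = (\<integral>\<^sup>+ x. (\<lambda>s. indicator G s * \<Theta> F H s) (restrict x S) * (indicator UNIV (x u) * indicator UNIV (x v)) \<partial>normal_dist p C)"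
        by simp
      also have "\<dots> = (\<integral>\<^sup>+ s. \<rho> s * ((\<lambda>s. indicator G s * \<Theta> F H s) s * \<Theta> UNIV UNIV s) \<partial>lebesgue_on_coords S)"
        unfolding \<Theta>_def by (rule reg[rule_format]) (use g[unfolded \<Theta>_def] measurable_lebesgue_on_coords in auto)
      also have "\<dots> = (\<integral>\<^sup>+ s. \<rho> s * (indicator G s * \<Theta> F H s) \<partial>lebesgue_on_coords S)"
        unfolding \<Theta>_def[of UNIV UNIV] regression_prob_UNIV_left[OF L(2)] normal_prob_UNIV[OF L(3)] by simp
      finally show ?thesis .
    qed
    show "(LINT x:X|M. indicator F (x u) * indicator H (x v)) = (LINT x:X|M. \<phi> F H x)"
      using int[OF fm] int[OF \<phi>M \<phi>1(1)] 1 2 unfolding f_def by simp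
  qed
  have ce1: "AE x in M. real_cond_exp M A (\<lambda>y. indicator F (y u)) x = \<phi> F UNIV x" if "F \<in> sets borel" for F
    using ce[OF that, of UNIV] by simp
  have ce2: "AE x in M. real_cond_exp M A (\<lambda>y. indicator H (y v)) x = \<phi> UNIV H x" if "H \<in> sets borel" for H
    using ce[of UNIV, OF _ that] by simp
  have Luv: "L u v = inv_entry C ({u, v} \<union> S) u v"
  proof -
    note P = pd_correlation_matrixD[OF pd]
    have I: "insert u (insert v S) \<subseteq> {..<p}" "finite (insert u (insert v S))"
      using uv SJ by (auto intro: finite_subset)
    obtain c where c: "0 < c" "coercive_on (insert u (insert v S)) (entries C) c"
      using pd_coercive[OF pd] I by metis
    have "insert u (insert v S) = {u, v} \<union> S" by auto
    then show ?thesis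
      using inv_on_unique[OF I(2) P(2)[OF I(1)] L(1) inv_entry_inv_on(2)[OF P(1) I(1) c(2,1)], of u v] by simp
  qed
  show ?thesis unfolding Luv[symmetric] M_def[symmetric]
  proof
    assume z: "L u v = 0"
    show "cond_indep M {u} {v} S" unfolding cond_indep_def A_def[symmetric]
    proof (intro ballI)
      fix F H assume "F \<in> sets (PiM {u} (\<lambda>_. borel :: real measure))" "H \<in> sets (PiM {v} (\<lambda>_. borel :: real measure))"
      then obtain F' H' where F': "F' \<in> sets borel" "\<And>y. indicator F (restrict y {u}) = (indicator F' (y u) :: real)"
        and H': "H' \<in> sets borel" "\<And>y. indicator H (restrict y {v}) = (indicator H' (y v) :: real)"
        using indicator_singleton_coord by metis
      have fac: "\<phi> F' H' x = \<phi> F' UNIV x * \<phi> UNIV H' x" for x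
        unfolding \<phi>_def \<Theta>_def enn2real_mult[symmetric] using regression_prob_no_slope[OF L(2,3) F'(1) H'(1)] z by simp
      show "AE x in M. real_cond_exp M A (\<lambda>y. indicator F (restrict y {u}) * indicator H (restrict y {v})) x =
          real_cond_exp M A (\<lambda>y. indicator F (restrict y {u})) x * real_cond_exp M A (\<lambda>y. indicator H (restrict y {v})) x"
        unfolding F'(2) H'(2) using ce[OF F'(1) H'(1)] ce1[OF F'(1)] ce2[OF H'(1)]
        by eventually_elim (simp add: fac)
    qed
  next
    assume ci: "cond_indep M {u} {v} S"
    show "L u v = 0"
    proof (rule ccontr)
      assume nz: "L u v \<noteq> 0"
      let ?H = "{0<..} :: real set"
      have half: "{z \<in> space (PiM {w} (\<lambda>_. borel)). z w \<in> ?H} \<in> sets (PiM {w} (\<lambda>_. borel))"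
        and ind: "indicator {z \<in> space (PiM {w} (\<lambda>_. borel)). z w \<in> ?H} (restrict y {w}) = (indicator ?H (y w) :: real)" for w and y :: "nat \<Rightarrow> real"
      proof -
        show "{z \<in> space (PiM {w} (\<lambda>_. borel)). z w \<in> ?H} \<in> sets (PiM {w} (\<lambda>_. borel))"
          using measurable_sets[OF measurable_component_singleton[of w "{w}" "\<lambda>_. borel"], of ?H]
          by (simp add: vimage_def Int_def conj_commute)
        show "indicator {z \<in> space (PiM {w} (\<lambda>_. borel)). z w \<in> ?H} (restrict y {w}) = (indicator ?H (y w) :: real)"
          by (simp add: space_PiM indicator_def)
      qed
      have "AE x in M. real_cond_exp M A (\<lambda>y. indicator ?H (y u) * indicator ?H (y v)) x =
          real_cond_exp M A (\<lambda>y. indicator ?H (y u)) x * real_cond_exp M A (\<lambda>y. indicator ?H (y v)) x"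
        using bspec[OF bspec[OF ci[unfolded cond_indep_def A_def[symmetric]] half[of u]] half[of v]] unfolding ind .
      moreover have "?H \<in> sets borel" by simp
      note ce[OF this this] ce1[OF this] ce2[OF this]
      ultimately have "AE x in M. \<phi> ?H ?H x = \<phi> ?H UNIV x * \<phi> UNIV ?H x"
        by eventually_elim simp
      \<comment> \<open>The slope does not depend on the conditioning values, so the factorisation
        fails at every point, which contradicts its validity almost everywhere.\<close>
      moreover have "\<phi> ?H ?H x \<noteq> \<phi> ?H UNIV x * \<phi> UNIV ?H x" for x
      proof
        let ?s = "restrict x S"
        assume "\<phi> ?H ?H x = \<phi> ?H UNIV x * \<phi> UNIV ?H x"
        then have "ennreal (enn2real (\<Theta> ?H ?H ?s)) = ennreal (enn2real (\<Theta> ?H UNIV ?s)) * ennreal (enn2real (\<Theta> UNIV ?H ?s))"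
          unfolding \<phi>_def by (simp add: ennreal_mult)
        then show False unfolding \<Theta>r unfolding \<Theta>_def
          using regression_prob_slope[OF L(2,3), of "- L u v / L u u"] nz L(7) by auto
      qed
      ultimately have "AE x in M. False" by simp
      then show False by simp
    qed
  qed
qed

text \<open>Faithfulness is applied to identity marginals, that is, to the Gaussian vector itself,
  and to singletons.\<close>

lemma faithful_d_separated_iff:
  assumes pd: "pd_correlation_matrix p C" and f: "faithful p E C"
    and uv: "u < p" "v < p" "u \<noteq> v" and S: "S \<subseteq> {..<p} - {u, v}"
  shows "d_separated E u v S \<longleftrightarrow> pcor C u v S = 0"
proof -
  have fd: "faithful_dist p E (npn p (\<lambda>_ x. x) C)"
    using f strict_marginals_id unfolding faithful_def by blast
  have "d_separated_sets E {u} {v} S \<longleftrightarrow> cond_indep (npn p (\<lambda>_ x. x) C) {u} {v} S"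
    by (rule fd[unfolded faithful_dist_def, THEN spec[of _ "{u}"], THEN spec[of _ "{v}"], THEN spec[of _ S], THEN mp])
      (use uv S in auto)
  moreover have "S \<subseteq> {..<p}" using S by blast
  ultimately show ?thesis
    unfolding cond_indep_npn_iff[OF pd uv S] pcor_eq_0_iff[OF pd uv(1,2) \<open>S \<subseteq> {..<p}\<close>]
    by (simp add: d_separated_sets_def)
qed

section \<open>Bivariate marginals\<close>

lemma sym_on_eq: "sym_on I A \<Longrightarrow> i \<in> I \<Longrightarrow> j \<in> I \<Longrightarrow> A i j = A j i"
  unfolding sym_on_def by blast

text \<open>At the vector with entries 1 and \<open>- r\<close> the form is \<open>1 - r^2\<close>.
  The strict bound is what the hypothesis on the estimator asks for.\<close>

lemma pd_correlation_bound:
  assumes pd: "pd_correlation_matrix p C" and uv: "u < p" "v < p" "u \<noteq> v"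
  shows "\<bar>C $$ (u, v)\<bar> < 1"
proof -
  note P = pd_correlation_matrixD[OF pd]
  let ?r = "C $$ (u, v)" and ?x = "\<lambda>i. if i = u then 1 else - C $$ (u, v)"
  have r: "C $$ (v, u) = ?r" using sym_on_eq[OF P(2)[OF order_refl], of v u] uv by simp
  have "0 < quad {u, v} (entries C) ?x" by (rule P(4)[of _ u]) (use uv in auto)
  also have "\<dots> = 1 - ?r\<^sup>2" unfolding quad_def using uv P(3) r by (simp add: power2_eq_square)
  finally show ?thesis using abs_square_less_1[of ?r] by simp
qed

lemma pd_correlation_two:
  assumes "\<bar>r\<bar> < 1"
  shows "pd_correlation_matrix 2 (Matrix.mat 2 2 (\<lambda>(i, j). if i = j then 1 else r))"
proof (rule pd_correlation_matrixI)
  let ?C = "Matrix.mat 2 2 (\<lambda>(i, j). if i = j then 1 else r)"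
  fix x :: "nat \<Rightarrow> real" and i assume i: "i < 2" "x i \<noteq> 0"
  have "r\<^sup>2 < 1" using assms abs_square_less_1[of r] by simp
  have s: "{..<2} = {0, 1 :: nat}" by auto
  have "quad {..<2} (entries ?C) x = (x 0 + r * x 1)\<^sup>2 + (1 - r\<^sup>2) * (x 1)\<^sup>2"
    unfolding quad_def s by (simp add: power2_eq_square algebra_simps)
  also have "0 < \<dots>"
  proof (cases "x 1 = 0")
    case True
    then have "x 0 \<noteq> 0" using i by (cases i) (auto simp: less_Suc_eq numeral_2_eq_2)
    then show ?thesis using True by simp
  next
    case False
    then show ?thesis using \<open>r\<^sup>2 < 1\<close> by (intro add_nonneg_pos) auto
  qed
  finally show "0 < quad {..<2} (entries ?C) x" .
qed auto

lemma measurable_coord_pair: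
  assumes "u < p" "v < p" "sets M = sets (PiM {..<p} (\<lambda>_. borel))"
  shows "(\<lambda>x. (x u, x v)) \<in> measurable M (borel :: (real \<times> real) measure)"
  unfolding measurable_cong_sets[OF assms(3) refl]
  using assms measurable_component_singleton[of _ "{..<p}" "\<lambda>_. borel :: real measure"]
  by (intro borel_measurable_Pair) auto

definition bivariate_kernel :: "real \<Rightarrow> real \<Rightarrow> real \<Rightarrow> real" where
  "bivariate_kernel r t y = exp (- (t\<^sup>2 - 2 * r * t * y + y\<^sup>2) / (2 * (1 - r\<^sup>2)))"

text \<open>The 2 by 2 precision matrix is solved for explicitly, which shows that up to the factor
  \<open>c\<close> the law of the pair depends on the correlation alone.\<close>

lemma normal_dist_pair:
  assumes pd: "pd_correlation_matrix p C" and uv: "u < p" "v < p" "u \<noteq> v"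
  obtains c where "\<forall>f \<in> borel_measurable (borel :: (real \<times> real) measure).
    (\<integral>\<^sup>+ x. f (x u, x v) \<partial>normal_dist p C) =
    c * (\<integral>\<^sup>+ y. \<integral>\<^sup>+ t. f (t, y) * ennreal (bivariate_kernel (C $$ (u, v)) t y) \<partial>lborel \<partial>lborel)"
proof -
  note P = pd_correlation_matrixD[OF pd]
  define r where "r = C $$ (u, v)"
  have sub: "insert u {v} \<subseteq> {..<p}" using uv by auto
  have vu: "C $$ (v, u) = r" using sym_on_eq[OF P(2)[OF sub], of v u] unfolding r_def by simp
  have ruv: "C $$ (u, v) = r" unfolding r_def ..
  have r1: "r\<^sup>2 < 1" using pd_correlation_bound[OF pd uv] abs_square_less_1[of r] unfolding r_def by simp
  obtain c L where L: "0 < c" "inv_on (insert u {v}) (entries C) L" "\<forall>f \<in> borel_measurable (lebesgue_on_coords (insert u {v})).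
    (\<integral>\<^sup>+ x. f (restrict x (insert u {v})) \<partial>normal_dist p C) =
    ennreal c * (\<integral>\<^sup>+ x. f x * ennreal (gauss_kernel (insert u {v}) L x) \<partial>lebesgue_on_coords (insert u {v}))"
    by (rule normal_dist_marginal[OF pd sub])
  have eqs: "L u u + r * L v u = 1" "r * L u u + L v u = 0" "L u v + r * L v v = 0" "r * L u v + L v v = 1"
    using L(2) uv P(3) ruv vu unfolding inv_on_def by auto
  then have off: "L v u = - r * L u u" "L u v = - r * L v v" by linarith+
  then have "(1 - r\<^sup>2) * L u u = 1" "(1 - r\<^sup>2) * L v v = 1"
    using eqs(1,4) by (simp_all add: power2_eq_square algebra_simps)
  then have Lv: "L u u = 1 / (1 - r\<^sup>2)" "L v v = 1 / (1 - r\<^sup>2)" using r1 by (simp_all add: field_simps)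
  have ker: "gauss_kernel (insert u {v}) L x = bivariate_kernel r (x u) (x v)" for x
  proof -
    have "quad (insert u {v}) L x = L u u * ((x u)\<^sup>2 - 2 * r * x u * x v + (x v)\<^sup>2)"
      unfolding quad_def using uv(3) Lv by (simp add: off algebra_simps power2_eq_square)
    then have "quad (insert u {v}) L x = ((x u)\<^sup>2 - 2 * r * x u * x v + (x v)\<^sup>2) / (1 - r\<^sup>2)"
      unfolding Lv(1) by simp
    then show ?thesis unfolding gauss_kernel_def bivariate_kernel_def
      by (simp add: minus_divide_left mult.commute)
  qed
  have "(\<integral>\<^sup>+ x. f (x u, x v) \<partial>normal_dist p C) =
    ennreal c * (\<integral>\<^sup>+ y. \<integral>\<^sup>+ t. f (t, y) * ennreal (bivariate_kernel r t y) \<partial>lborel \<partial>lborel)"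
    if f: "f \<in> borel_measurable (borel :: (real \<times> real) measure)" for f
  proof -
    have [measurable]: "f \<in> borel_measurable (borel \<Otimes>\<^sub>M borel)" using f by (simp add: borel_prod)
    define g where "g x = f (x u, x v)" for x :: "nat \<Rightarrow> real"
    have g: "g \<in> borel_measurable (lebesgue_on_coords (insert u {v}))" unfolding g_def
      by (rule measurable_compose[OF borel_measurable_Pair f]) (intro measurable_coord, simp)+
    have "(\<integral>\<^sup>+ x. f (x u, x v) \<partial>normal_dist p C) = (\<integral>\<^sup>+ x. g (restrict x (insert u {v})) \<partial>normal_dist p C)"
      unfolding g_def by simp
    also have "\<dots> = ennreal c * (\<integral>\<^sup>+ x. g x * ennreal (gauss_kernel (insert u {v}) L x) \<partial>lebesgue_on_coords (insert u {v}))"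
      by (rule bspec[OF L(3) g])
    also have "(\<integral>\<^sup>+ x. g x * ennreal (gauss_kernel (insert u {v}) L x) \<partial>lebesgue_on_coords (insert u {v}))
      = (\<integral>\<^sup>+ x. \<integral>\<^sup>+ t. g (x(u := t)) * ennreal (gauss_kernel (insert u {v}) L (x(u := t))) \<partial>lborel \<partial>lebesgue_on_coords {v})"
      using uv(3)
      by (intro lborel_product.product_nn_integral_insert borel_measurable_times_ennreal g measurable_ennreal_gauss_kernel) auto
    also have "\<dots> = (\<integral>\<^sup>+ x. (\<lambda>y. \<integral>\<^sup>+ t. f (t, y) * ennreal (bivariate_kernel r t y) \<partial>lborel) (x v) \<partial>lebesgue_on_coords {v})"
      unfolding ker g_def using uv(3) by simp
    also have "\<dots> = (\<integral>\<^sup>+ y. \<integral>\<^sup>+ t. f (t, y) * ennreal (bivariate_kernel r t y) \<partial>lborel \<partial>lborel)"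
      by (rule lborel_product.product_nn_integral_singleton) (unfold bivariate_kernel_def, measurable)
    finally show ?thesis .
  qed
  then show ?thesis using that unfolding r_def by blast
qed

text \<open>Brings the bivariate model, in which the estimator is analysed, to every pair of
  coordinates of the large vector.\<close>

lemma normal_dist_pair_distr:
  assumes pd: "pd_correlation_matrix p C" "pd_correlation_matrix p' C'"
    and uv: "u < p" "v < p" "u \<noteq> v" and uv': "u' < p'" "v' < p'" "u' \<noteq> v'"
    and eq: "C $$ (u, v) = C' $$ (u', v')"
  shows "distr (normal_dist p C) borel (\<lambda>z. (z u, z v)) = distr (normal_dist p' C') borel (\<lambda>z. (z u', z v'))"
proof -
  have m: "(\<lambda>z. (z u, z v)) \<in> measurable (normal_dist p C) borel"
    if "u < p" "v < p" for p C u v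
    by (rule measurable_coord_pair[OF that sets_normal_dist])
  define B where "B f = (\<integral>\<^sup>+ y. \<integral>\<^sup>+ t. f (t, y) * ennreal (bivariate_kernel (C $$ (u, v)) t y) \<partial>lborel \<partial>lborel)" for f
  obtain c where c: "\<forall>f \<in> borel_measurable (borel :: (real \<times> real) measure).
    (\<integral>\<^sup>+ x. f (x u, x v) \<partial>normal_dist p C) = c * B f"
    unfolding B_def by (rule normal_dist_pair[OF pd(1) uv])
  obtain c' where c': "\<forall>f \<in> borel_measurable (borel :: (real \<times> real) measure).
    (\<integral>\<^sup>+ x. f (x u', x v') \<partial>normal_dist p' C') = c' * B f"
    unfolding B_def eq by (rule normal_dist_pair[OF pd(2) uv'])
  have "c * B (\<lambda>_. 1) = 1" using bspec[OF c, of "\<lambda>_. 1"] prob_space.emeasure_space_1[OF prob_space_normal_dist[OF pd(1)]] by simp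
  moreover have "c' * B (\<lambda>_. 1) = 1" using bspec[OF c', of "\<lambda>_. 1"] prob_space.emeasure_space_1[OF prob_space_normal_dist[OF pd(2)]] by simp
  \<comment> \<open>Both laws are multiples of the same functional \<open>B\<close> and have total
    mass 1.\<close>
  ultimately have cc: "c = c'" by (metis mult.commute mult.left_commute mult.right_neutral)
  show ?thesis
  proof (rule measure_eqI)
    fix X assume "X \<in> sets (distr (normal_dist p C) borel (\<lambda>z. (z u, z v)))"
    then have X: "X \<in> sets borel" by simp
    have e: "emeasure (distr (normal_dist p C) borel (\<lambda>z. (z u, z v))) X = (\<integral>\<^sup>+ z. indicator X (z u, z v) \<partial>normal_dist p C)"
      if "u < p" "v < p" for p C u v
      using X m[OF that] nn_integral_distr[OF m[OF that], of "indicator X"] by simp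
    have iX: "indicator X \<in> borel_measurable borel" using X by simp
    show "emeasure (distr (normal_dist p C) borel (\<lambda>z. (z u, z v))) X =
      emeasure (distr (normal_dist p' C') borel (\<lambda>z. (z u', z v'))) X"
      unfolding e[OF uv(1,2)] e[OF uv'(1,2)] bspec[OF c iX] bspec[OF c' iX] cc ..
  qed simp
qed

lemma npn_pair_distr:
  assumes h: "strict_marginals p h" and uv: "u < p" "v < p"
  shows "distr (npn p h C) borel (\<lambda>x. (x u, x v)) =
    distr (distr (normal_dist p C) borel (\<lambda>z. (z u, z v))) borel (\<lambda>(a, b). (h u a, h v b))"
proof -
  have c: "(\<lambda>x. (x u, x v)) \<in> measurable (PiM {..<p} (\<lambda>_. borel)) (borel :: (real \<times> real) measure)"
    by (rule measurable_coord_pair[OF uv refl])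
  have cn: "(\<lambda>x. (x u, x v)) \<in> measurable (normal_dist p C) (borel :: (real \<times> real) measure)"
    by (rule measurable_coord_pair[OF uv sets_normal_dist])
  have [measurable]: "h u \<in> borel_measurable borel" "h v \<in> borel_measurable borel"
    using h uv strict_mono_borel unfolding strict_marginals_def by auto
  have hm: "(\<lambda>(a, b). (h u a, h v b)) \<in> measurable (borel :: (real \<times> real) measure) borel"
    unfolding borel_prod[symmetric] by measurable
  show ?thesis
    unfolding npn_def distr_distr[OF c measurable_marginal_map[OF h]] distr_distr[OF hm cn]
    by (rule distr_cong) (use uv in \<open>auto simp: o_def\<close>)
qed

lemma npn_pair_bivariate:
  assumes pd: "pd_correlation_matrix p C" and h: "strict_marginals p h" and uv: "u < p" "v < p" "u \<noteq> v"
  shows "distr (npn p h C) borel (\<lambda>x. (x u, x v)) = bivariate_npn (\<lambda>i. if i = 0 then h u else h v) (C $$ (u, v))"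
    "strict_marginals 2 (\<lambda>i. if i = 0 then h u else h v)"
proof -
  show s: "strict_marginals 2 (\<lambda>i. if i = 0 then h u else h v)"
    using h uv unfolding strict_marginals_def by auto
  let ?R = "Matrix.mat 2 2 (\<lambda>(i, j). if i = j then 1 else C $$ (u, v))"
  have pd2: "pd_correlation_matrix 2 ?R" by (rule pd_correlation_two[OF pd_correlation_bound[OF pd uv]])
  show "distr (npn p h C) borel (\<lambda>x. (x u, x v)) = bivariate_npn (\<lambda>i. if i = 0 then h u else h v) (C $$ (u, v))"
    unfolding bivariate_npn_def npn_pair_distr[OF h uv(1,2)]
    by (subst npn_pair_distr[OF s]) (use normal_dist_pair_distr[OF pd pd2 uv, of 0 1] in auto)
qed

lemma npn_sample_pair:
  assumes pd: "pd_correlation_matrix p C" and h: "strict_marginals p h" and uv: "u < p" "v < p" "u \<noteq> v"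
  shows "(\<lambda>x. \<lambda>k\<in>{..<n}. (x k u, x k v)) \<in> measurable (npn_sample n p h C) (PiM {..<n} (\<lambda>_. borel :: (real \<times> real) measure))"
    "distr (npn_sample n p h C) (PiM {..<n} (\<lambda>_. borel)) (\<lambda>x. \<lambda>k\<in>{..<n}. (x k u, x k v))
     = PiM {..<n} (\<lambda>_. bivariate_npn (\<lambda>i. if i = 0 then h u else h v) (C $$ (u, v)))"
proof -
  have cn: "(\<lambda>x. (x u, x v)) \<in> measurable (npn p h C) (borel :: (real \<times> real) measure)"
    by (rule measurable_coord_pair[OF uv(1,2) sets_npn])
  show meas: "(\<lambda>x. \<lambda>k\<in>{..<n}. (x k u, x k v)) \<in> measurable (npn_sample n p h C) (PiM {..<n} (\<lambda>_. borel :: (real \<times> real) measure))"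
    unfolding npn_sample_def
  proof (rule measurable_restrict)
    fix k assume "k \<in> {..<n}"
    then have "(\<lambda>x. x k) \<in> measurable (PiM {..<n} (\<lambda>_. npn p h C)) (npn p h C)"
      by (rule measurable_component_singleton)
    from measurable_compose[OF this cn]
    show "(\<lambda>x. (x k u, x k v)) \<in> borel_measurable (PiM {..<n} (\<lambda>_. npn p h C))" .
  qed
  define N where "N = distr (npn p h C) borel (\<lambda>x. (x u, x v))"
  have pN: "prob_space N" unfolding N_def by (rule prob_space.prob_space_distr[OF prob_space_npn[OF pd h] cn])
  have cN: "(\<lambda>x. (x u, x v)) \<in> measurable (npn p h C) N" using cn unfolding N_def by simp
  have "distr (npn_sample n p h C) (PiM {..<n} (\<lambda>_. N)) (compose {..<n} (\<lambda>x. (x u, x v)))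
    = PiM {..<n} (\<lambda>_. distr (npn p h C) N (\<lambda>x. (x u, x v)))"
    unfolding npn_sample_def
    by (rule distr_PiM_finite_prob_space') (use prob_space_npn[OF pd h] pN cN in auto)
  also have "distr (npn p h C) N (\<lambda>x. (x u, x v)) = N" unfolding N_def by (rule distr_cong) auto
  also have "compose {..<n} (\<lambda>x. (x u, x v)) = (\<lambda>x. \<lambda>k\<in>{..<n}. (x k u, x k v))" by (simp add: FuncSet.compose_def fun_eq_iff)
  also have "distr (npn_sample n p h C) (PiM {..<n} (\<lambda>_. N)) (\<lambda>x. \<lambda>k\<in>{..<n}. (x k u, x k v))
    = distr (npn_sample n p h C) (PiM {..<n} (\<lambda>_. borel)) (\<lambda>x. \<lambda>k\<in>{..<n}. (x k u, x k v))"
    by (rule distr_cong) (auto intro!: sets_PiM_cong simp: N_def)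
  finally show "distr (npn_sample n p h C) (PiM {..<n} (\<lambda>_. borel)) (\<lambda>x. \<lambda>k\<in>{..<n}. (x k u, x k v))
     = PiM {..<n} (\<lambda>_. bivariate_npn (\<lambda>i. if i = 0 then h u else h v) (C $$ (u, v)))"
    unfolding N_def npn_pair_bivariate(1)[OF pd h uv] .
qed

lemma prob_space_npn_sample:
  assumes "pd_correlation_matrix p C" "strict_marginals p h"
  shows "prob_space (npn_sample n p h C)"
  unfolding npn_sample_def by (rule prob_space_PiM) (rule prob_space_npn[OF assms])

lemma estimator_deviation:
  assumes pd: "pd_correlation_matrix p C" and h: "strict_marginals p h" and uv: "u < p" "v < p" "u \<noteq> v"
    and est: "correlation_estimator A B est" and n: "1 \<le> n" and \<epsilon>: "0 < \<epsilon>"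
  shows "(\<lambda>x. est n (\<lambda>k\<in>{..<n}. (x k u, x k v))) \<in> borel_measurable (npn_sample n p h C)"
    "measure (npn_sample n p h C) {x \<in> space (npn_sample n p h C). \<bar>est n (\<lambda>k\<in>{..<n}. (x k u, x k v)) - C $$ (u, v)\<bar> > \<epsilon>}
      < A * exp (- B * real n * \<epsilon>\<^sup>2)"
proof -
  let ?M = "npn_sample n p h C" and ?e = "\<lambda>x. \<lambda>k\<in>{..<n}. (x k u, x k v)"
  let ?N = "PiM {..<n} (\<lambda>_. bivariate_npn (\<lambda>i. if i = 0 then h u else h v) (C $$ (u, v)))"
  note s = npn_sample_pair[OF pd h uv, of n]
  have em: "est n \<in> borel_measurable (PiM {..<n} (\<lambda>_. borel))" using est n unfolding correlation_estimator_def by blast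
  show "(\<lambda>x. est n (?e x)) \<in> borel_measurable ?M" by (rule measurable_compose[OF s(1) em])
  have sp: "space ?N = space (PiM {..<n} (\<lambda>_. borel :: (real \<times> real) measure))"
    unfolding s(2)[symmetric] by simp
  let ?X = "{y \<in> space ?N. \<bar>est n y - C $$ (u, v)\<bar> > \<epsilon>}"
  have X: "?X \<in> sets (PiM {..<n} (\<lambda>_. borel))" unfolding sp using em by measurable
  have "measure ?N ?X = measure ?M (?e -` ?X \<inter> space ?M)"
    using measure_distr[OF s(1) X] unfolding s(2) .
  also have "?e -` ?X \<inter> space ?M = {x \<in> space ?M. \<bar>est n (?e x) - C $$ (u, v)\<bar> > \<epsilon>}"
    using measurable_space[OF s(1)] unfolding sp by auto
  finally show "measure ?M {x \<in> space ?M. \<bar>est n (?e x) - C $$ (u, v)\<bar> > \<epsilon>} < A * exp (- B * real n * \<epsilon>\<^sup>2)"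
  proof -
    assume eq: "measure ?N ?X = measure ?M {x \<in> space ?M. \<bar>est n (?e x) - C $$ (u, v)\<bar> > \<epsilon>}"
    have "\<forall>h r \<epsilon>. strict_marginals 2 h \<longrightarrow> \<bar>r\<bar> < 1 \<longrightarrow> \<epsilon> > 0 \<longrightarrow>
          measure (PiM {..<n} (\<lambda>_. bivariate_npn h r))
            {y \<in> space (PiM {..<n} (\<lambda>_. bivariate_npn h r)). \<bar>est n y - r\<bar> > \<epsilon>}
          < A * exp (- B * real n * \<epsilon>\<^sup>2)"
      using est n unfolding correlation_estimator_def by blast
    from this[rule_format, OF npn_pair_bivariate(2)[OF pd h uv] pd_correlation_bound[OF pd uv] \<epsilon>]
    show ?thesis unfolding eq .
  qed
qed

section \<open>Measurability of the output\<close>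

lemma measurable_det:
  assumes "\<And>x. M x \<in> carrier_mat m m"
    and "\<And>i j. i < m \<Longrightarrow> j < m \<Longrightarrow> (\<lambda>x. M x $$ (i, j)) \<in> borel_measurable N"
  shows "(\<lambda>x. Determinant.det (M x) :: real) \<in> borel_measurable N"
proof -
  have "(\<lambda>x. \<Sum>\<pi> \<in> {\<pi>. \<pi> permutes {0..<m}}. signof \<pi> * (\<Prod>i = 0..<m. M x $$ (i, \<pi> i))) \<in> borel_measurable N"
    using assms(2) permutes_in_image
    by (intro borel_measurable_sum borel_measurable_times borel_measurable_const borel_measurable_prod) fastforce
  then show ?thesis unfolding det_def'[OF assms(1)] .
qed

lemma mat_inverse_eq_None_iff:
  assumes "M \<in> carrier_mat m m"
  shows "mat_inverse M = None \<longleftrightarrow> Determinant.det M = (0 :: real)"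
proof
  assume "mat_inverse M = None"
  then show "Determinant.det M = 0" using mat_inverse_of_det[OF assms] by fastforce
next
  assume d: "Determinant.det M = 0"
  show "mat_inverse M = None"
  proof (rule ccontr)
    assume "mat_inverse M \<noteq> None"
    then obtain B where "M * B = 1\<^sub>m m" "B \<in> carrier_mat m m" using mat_inverse(2)[OF assms] by blast
    then have "Determinant.det M * Determinant.det B = 1" using det_mult[OF assms, of B] by simp
    then show False using d by simp
  qed
qed

text \<open>Where the determinant is nonzero, the entries of the inverse are cofactors divided by
  it, hence measurable; where it vanishes, \<open>mat_inverse\<close> is \<open>None\<close> and the
  query falls back to the constant \<open>und u v S\<close>.\<close>

lemma measurable_rpc_query:
  assumes C: "\<And>x. C x \<in> carrier_mat p p"
    and m: "\<And>i j. i < p \<Longrightarrow> j < p \<Longrightarrow> (\<lambda>x. C x $$ (i, j)) \<in> borel_measurable N"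
  shows "{x \<in> space N. rpc_query und \<gamma> (C x) u v S} \<in> sets N"
proof (cases "u < p \<and> v < p \<and> u \<noteq> v \<and> S \<subseteq> {..<p} - {u, v}")
  case False
  then have "{x \<in> space N. rpc_query und \<gamma> (C x) u v S} = {}" unfolding rpc_query_def
    using carrier_matD(1)[OF C] by auto
  then show ?thesis by (simp only: sets.empty_sets)
next
  case True
  define I where "I = {u, v} \<union> S"
  have I: "I \<subseteq> {..<p}" using True unfolding I_def by auto
  then have fin: "finite I" by (auto intro: finite_subset)
  define k where "k = card I"
  define M where "M x = submatrix (C x) I I" for x
  have M: "M x \<in> carrier_mat k k" for x unfolding M_def k_def by (rule submatrix_carrier[OF C I])
  have Mm: "(\<lambda>x. M x $$ (i, j)) \<in> borel_measurable N" if ij: "i < k" "j < k" for i j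
  proof -
    obtain a where a: "a \<in> I" "rank_in I a = i" by (rule rank_in_surj[OF fin ij(1)[unfolded k_def]])
    obtain b where b: "b \<in> I" "rank_in I b = j" by (rule rank_in_surj[OF fin ij(2)[unfolded k_def]])
    have "M x $$ (i, j) = C x $$ (a, b)" for x
      using submatrix_rank_in[OF C I a(1) b(1)] unfolding M_def a(2) b(2) .
    then show ?thesis using m[of a b] a(1) b(1) I by auto
  qed
  define D where "D x = Determinant.det (M x)" for x
  have Dm: "D \<in> borel_measurable N" unfolding D_def by (rule measurable_det[OF M Mm])
  define g where "g a b x = cofactor (M x) b a / D x" for a b x
  have gm: "g a b \<in> borel_measurable N" for a b
  proof -
    have del: "mat_delete (M x) b a \<in> carrier_mat (k - 1) (k - 1)" for x
      unfolding mat_delete_def carrier_matD[OF M] by simp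
    have "(\<lambda>x. Determinant.det (mat_delete (M x) b a)) \<in> borel_measurable N"
    proof (rule measurable_det[OF del])
      fix i j assume ij: "i < k - 1" "j < k - 1"
      have "mat_delete (M x) b a $$ (i, j) = M x $$ (if i < b then i else Suc i, if j < a then j else Suc j)" for x
        unfolding mat_delete_def using M[of x] ij by simp
      then show "(\<lambda>x. mat_delete (M x) b a $$ (i, j)) \<in> borel_measurable N" using Mm ij by auto
    qed
    then show ?thesis using Dm unfolding g_def cofactor_def D_def
      by (intro borel_measurable_divide borel_measurable_times borel_measurable_const)
  qed
  let ?u = "rank_in I u" and ?v = "rank_in I v"
  have uv: "?u < k" "?v < k"
    using bij_rank_in[OF fin] unfolding bij_betw_def k_def I_def by auto
  have ie: "inv_entry (C x) I a b = g (rank_in I a) (rank_in I b) x"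
    if "D x \<noteq> 0" "rank_in I a < k" "rank_in I b < k" for x a b
  proof -
    have "Determinant.det (M x) \<noteq> 0" using that(1) unfolding D_def .
    from mat_inverse_of_det[OF M this]
    obtain B where B: "mat_inverse (M x) = Some B" "M x * B = 1\<^sub>m k" "B \<in> carrier_mat k k" by blast
    show ?thesis
      using mat_inverse_cofactor[OF M B(2,3) that(2,3)] that(1) B(1) unfolding inv_entry_def g_def D_def M_def by simp
  qed
  have rq: "rpc_query und \<gamma> (C x) u v S \<longleftrightarrow>
     \<bar>if D x \<noteq> 0 \<and> 0 < g ?u ?u x * g ?v ?v x then - g ?u ?v x / sqrt (g ?u ?u x * g ?v ?v x) else und u v S\<bar> \<le> \<gamma>" for x
  proof -
    have "mat_inverse (submatrix (C x) I I) \<noteq> None \<longleftrightarrow> D x \<noteq> 0"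
      using mat_inverse_eq_None_iff[OF M, of x] unfolding D_def M_def by simp
    then show ?thesis
      unfolding rpc_query_def pcor_estimate_def pcor_defined_def pcor_def Let_def I_def[symmetric]
      using True C[of x] ie[of x] uv by auto
  qed
  have "{x \<in> space N. \<bar>if D x \<noteq> 0 \<and> 0 < g ?u ?u x * g ?v ?v x
      then - g ?u ?v x / sqrt (g ?u ?u x * g ?v ?v x) else und u v S\<bar> \<le> \<gamma>} \<in> sets N"
    using Dm gm by measurable
  then show ?thesis unfolding rq .
qed

text \<open>A query supported on finitely many triples takes finitely many values, so the event is a
  finite union. \<open>R\<close> is arbitrary, which admits any procedure \<open>PC\<close>.\<close>

lemma measurable_query_output:
  fixes Q :: "'a \<Rightarrow> query" and p :: nat
  assumes Q: "\<And>u v S. {x \<in> space N. Q x u v S} \<in> sets N"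
    and supp: "\<And>x u v S. Q x u v S \<Longrightarrow> u < p \<and> v < p \<and> S \<subseteq> {..<p}"
  shows "{x \<in> space N. R (Q x)} \<in> sets N"
proof -
  define F where "F = {..<p} \<times> {..<p} \<times> Pow {..<p}"
  have fin: "finite F" unfolding F_def by auto
  have "{x \<in> space N. R (Q x)} = (\<Union>T \<in> {T. T \<subseteq> F \<and> R (\<lambda>u v S. (u, v, S) \<in> T)}.
      {x \<in> space N. \<forall>t\<in>F. (case t of (u, v, S) \<Rightarrow> Q x u v S \<longleftrightarrow> t \<in> T)})" (is "_ = (\<Union>T\<in>?\<T>. ?E T)")
  proof (intro equalityI subsetI)
    fix x assume x: "x \<in> {x \<in> space N. R (Q x)}"
    let ?T = "{(u, v, S). Q x u v S}"
    have "(u, v, S) \<in> F" if "Q x u v S" for u v S using supp[OF that] unfolding F_def by simp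
    then have "?T \<in> ?\<T>" using x by auto
    moreover have "x \<in> ?E ?T" using x by auto
    ultimately show "x \<in> (\<Union>T\<in>?\<T>. ?E T)" by blast
  next
    fix x assume "x \<in> (\<Union>T\<in>?\<T>. ?E T)"
    then obtain T where T: "T \<subseteq> F" "R (\<lambda>u v S. (u, v, S) \<in> T)" "x \<in> ?E T" by blast
    have "Q x u v S \<longleftrightarrow> (u, v, S) \<in> T" for u v S
    proof (cases "(u, v, S) \<in> F")
      case True
      then show ?thesis using T(3) by auto
    next
      case False
      then show ?thesis using T(1) supp[of x u v S] unfolding F_def by auto
    qed
    then have "Q x = (\<lambda>u v S. (u, v, S) \<in> T)" by (intro ext) auto
    then show "x \<in> {x \<in> space N. R (Q x)}" using T(2,3) by auto
  qed
  moreover have "?E T \<in> sets N" for T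
  proof (rule sets.sets_Collect_finite_All[OF _ fin])
    show "{x \<in> space N. case t of (u, v, S) \<Rightarrow> Q x u v S \<longleftrightarrow> t \<in> T} \<in> sets N" if "t \<in> F" for t
    proof (cases t)
      case (fields u v S)
      then show ?thesis using Q[of u v S] sets.sets_Collect_neg[OF Q[of u v S]] by (cases "t \<in> T") auto
    qed
  qed
  moreover have "finite ?\<T>" using fin by (auto intro: finite_subset[of _ "Pow F"])
  ultimately show ?thesis by auto
qed

section \<open>Error bound\<close>

lemma corr_estimate_carrier: "corr_estimate est p n x \<in> carrier_mat p p"
  unfolding corr_estimate_def by simp

lemma corr_estimate_entry:
  "u < v \<Longrightarrow> v < p \<Longrightarrow> corr_estimate est p n x $$ (u, v) = est n (\<lambda>k\<in>{..<n}. (x k u, x k v))"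
  "u < v \<Longrightarrow> v < p \<Longrightarrow> corr_estimate est p n x $$ (v, u) = est n (\<lambda>k\<in>{..<n}. (x k u, x k v))"
  "u < p \<Longrightarrow> corr_estimate est p n x $$ (u, u) = 1"
  unfolding corr_estimate_def by (auto simp: min_def max_def)

lemma rpc_success_probability:
  assumes p: "0 < p" and E: "dag p E" and pd: "pd_correlation_matrix p C" and fa: "faithful p E C"
    and est: "correlation_estimator A B est" and PC: "pc_procedure p PC" and n: "1 \<le> n"
    and h: "strict_marginals p h" and A: "0 < A"
    and q: "q = max_degree p E + 2" and c: "c = min 1 (c_min_order C q)" and lam: "lam = lambda_min_order C q"
    and \<epsilon>: "\<epsilon> = c * lam\<^sup>2 / (8 * real q)"
  shows "1 - (real p)\<^sup>2 * A * exp (- B * real n * \<epsilon>\<^sup>2) \<le> measure (npn_sample n p h C)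
    {x \<in> space (npn_sample n p h C). rpc PC und est (c / 4) p n x = cpdag p E}"
proof -
  define M where "M = npn_sample n p h C"
  interpret M: prob_space M unfolding M_def by (rule prob_space_npn_sample[OF pd h])
  note P = pd_correlation_matrixD[OF pd]
  have q0: "0 < q" using q by simp
  have \<epsilon>0: "0 < \<epsilon>"
    using c_min_order_bounds(1)[OF P(1)] lambda_min_order_bounds(1)[OF pd p q0] q0 unfolding \<epsilon> c lam by simp
  define \<Sigma>h where "\<Sigma>h x = corr_estimate est p n x" for x
  define Eg where "Eg = {x \<in> space M. rpc PC und est (c / 4) p n x = cpdag p E}"
  define bad where "bad u v = {x \<in> space M. \<bar>est n (\<lambda>k\<in>{..<n}. (x k u, x k v)) - C $$ (u, v)\<bar> > \<epsilon>}" for u v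
  have em: "(\<lambda>x. est n (\<lambda>k\<in>{..<n}. (x k u, x k v))) \<in> borel_measurable M" if "u < v" "v < p" for u v
    unfolding M_def using estimator_deviation(1)[OF pd h _ _ _ est n \<epsilon>0, of u v] that by simp
  have bm: "bad u v \<in> M.events" if "u < v" "v < p" for u v
    using em[OF that] unfolding bad_def by measurable
  have bp: "M.prob (bad u v) \<le> A * exp (- B * real n * \<epsilon>\<^sup>2)" if "u < v" "v < p" for u v
    unfolding M_def bad_def using estimator_deviation(2)[OF pd h _ _ _ est n \<epsilon>0, of u v] that by simp
  have ent: "(\<lambda>x. \<Sigma>h x $$ (i, j)) \<in> borel_measurable M" if "i < p" "j < p" for i j
    unfolding \<Sigma>h_def using that em[of i j] em[of j i]
    by (cases i j rule: linorder_cases) (simp_all add: corr_estimate_entry)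
  have carr: "\<Sigma>h x \<in> carrier_mat p p" for x unfolding \<Sigma>h_def by (rule corr_estimate_carrier)
  have Em: "Eg \<in> M.events" unfolding Eg_def rpc_def \<Sigma>h_def[symmetric]
  proof (rule measurable_query_output[where p = p and R = "\<lambda>Q. PC Q = cpdag p E"])
    show "{x \<in> space M. rpc_query und (c / 4) (\<Sigma>h x) u v S} \<in> M.events" for u v S
      by (rule measurable_rpc_query[OF carr ent])
    show "u < p \<and> v < p \<and> S \<subseteq> {..<p}" if "rpc_query und (c / 4) (\<Sigma>h x) u v S" for x u v S
      using that carr[of x] unfolding rpc_query_def by auto
  qed
  \<comment> \<open>The estimator is applied once to each unordered pair, in increasing order, so
    these deviation events cover all entries.\<close>
  define pairs where "pairs = {(u, v). u < v \<and> v < p}"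
  have pairs: "finite pairs" "card pairs \<le> p * p"
  proof -
    have sub: "pairs \<subseteq> {..<p} \<times> {..<p}" unfolding pairs_def by auto
    then show "finite pairs" by (rule finite_subset) simp
    show "card pairs \<le> p * p" using card_mono[OF _ sub] by (simp add: card_cartesian_product)
  qed
  define Bad where "Bad = (\<Union>(u, v)\<in>pairs. bad u v)"
  have Bm: "Bad \<in> M.events" unfolding Bad_def using bm pairs(1) by (intro sets.finite_UN) (auto simp: pairs_def)
  have "M.prob Bad \<le> (\<Sum>e\<in>pairs. M.prob (case e of (u, v) \<Rightarrow> bad u v))"
    unfolding Bad_def using bm pairs(1) by (intro M.finite_measure_subadditive_finite) (auto simp: pairs_def)
  also have "\<dots> \<le> (\<Sum>e\<in>pairs. A * exp (- B * real n * \<epsilon>\<^sup>2))"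
    using bp by (intro sum_mono) (auto simp: pairs_def)
  also have "\<dots> \<le> (real p)\<^sup>2 * (A * exp (- B * real n * \<epsilon>\<^sup>2))"
    using pairs(2) A by (simp add: power2_eq_square mult_right_mono flip: of_nat_mult)
  finally have pB: "M.prob Bad \<le> (real p)\<^sup>2 * A * exp (- B * real n * \<epsilon>\<^sup>2)" by (simp add: mult.assoc)
  have "space M - Bad \<subseteq> Eg"
  proof
    fix x assume x: "x \<in> space M - Bad"
    have off: "\<bar>est n (\<lambda>k\<in>{..<n}. (x k u, x k v)) - C $$ (u, v)\<bar> \<le> \<epsilon>" if "u < v" "v < p" for u v
      using x that unfolding Bad_def pairs_def bad_def by force
    have sC: "C $$ (i, j) = C $$ (j, i)" if "i < p" "j < p" for i j
      using sym_on_eq[OF P(2)[OF order_refl]] that by simp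
    have close: "\<bar>\<Sigma>h x $$ (i, j) - C $$ (i, j)\<bar> \<le> c * lam\<^sup>2 / (8 * real q)" if "i < p" "j < p" for i j
      unfolding \<Sigma>h_def \<epsilon>[symmetric] using that off[of i j] off[of j i] sC[of i j] \<epsilon>0 P(3)
      by (cases i j rule: linorder_cases) (simp_all add: corr_estimate_entry)
    have sy: "sym_on {..<p} (entries (\<Sigma>h x))" unfolding sym_on_def
    proof (intro ballI)
      fix i j assume "i \<in> {..<p}" "j \<in> {..<p}"
      then show "\<Sigma>h x $$ (i, j) = \<Sigma>h x $$ (j, i)" unfolding \<Sigma>h_def
        by (cases i j rule: linorder_cases) (simp_all add: corr_estimate_entry)
    qed
    have dg: "\<Sigma>h x $$ (i, i) = 1" if "i < p" for i unfolding \<Sigma>h_def using that by (rule corr_estimate_entry)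
    have "correct_query p E (rpc_query und (c / 4) (\<Sigma>h x)) (max_degree p E)"
      unfolding correct_query_def
    proof (intro allI impI)
      fix u v S assume uv: "u < p" "v < p" "u \<noteq> v" and S: "S \<subseteq> {..<p} - {u, v}" "card S \<le> max_degree p E"
      have "card S + 2 \<le> q" using S(2) q by simp
      from rpc_query_correct[OF pd p q0 c lam carr sy dg close uv S(1) this, of und]
      show "rpc_query und (c / 4) (\<Sigma>h x) u v S \<longleftrightarrow> d_separated E u v S"
        unfolding faithful_d_separated_iff[OF pd fa uv S(1)] .
    qed
    then have "PC (rpc_query und (c / 4) (\<Sigma>h x)) = cpdag p E"
      using pc_output_correct[OF E] PC unfolding pc_procedure_def by blast
    then show "x \<in> Eg" using x unfolding Eg_def rpc_def \<Sigma>h_def by simp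
  qed
  then have "M.prob (space M - Bad) \<le> M.prob Eg" using Em by (intro M.finite_measure_mono)
  moreover have "M.prob (space M - Bad) = 1 - M.prob Bad" by (rule M.prob_compl[OF Bm])
  ultimately show ?thesis using pB unfolding M_def Eg_def by linarith
qed

lemma eventually_pos_lower_bound:
  assumes "f \<in> \<Omega>(\<lambda>n. real n powr a)" "\<And>n. 0 < f n"
  obtains k where "0 < k" "eventually (\<lambda>n. k * real n powr a \<le> f n) sequentially"
proof -
  obtain k where "0 < k" "eventually (\<lambda>n. norm (f n) \<ge> k * norm (real n powr a)) sequentially"
    using assms(1) by (rule landau_omega.bigE)
  then show ?thesis using that assms(2) by (auto simp: abs_of_pos)
qed

text \<open>In the exponent the union bound contributes at most \<open>2 * K1 * n powr a\<close>,
  through \<open>p^2 = exp (2 * ln p)\<close>, and the deviation bound at most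
  \<open>- Dc * n powr e\<close>; the hypothesis on the rates says \<open>a < e\<close>.\<close>

lemma error_bound_tendsto_0:
  fixes p q :: "nat \<Rightarrow> nat" and c lam :: "nat \<Rightarrow> real"
  assumes p: "\<And>n. 0 < p n" and q: "\<And>n. 0 < q n" and c: "\<And>n. 0 < c n" and lam: "\<And>n. 0 < lam n"
    and AB: "0 < A" "0 < B" and d: "0 \<le> d"
    and Op: "(\<lambda>n. ln (real (p n))) \<in> O(\<lambda>n. real n powr a)"
    and Oq: "(\<lambda>n. real (q n)) \<in> O(\<lambda>n. real n powr b)"
    and Oc: "c \<in> \<Omega>(\<lambda>n. real n powr (- d))" and Ol: "lam \<in> \<Omega>(\<lambda>n. real n powr (- f))"
    and a: "0 \<le> a" and lt: "a + 2 * b + 2 * d + 4 * f < 1"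
  shows "(\<lambda>n. (real (p n))\<^sup>2 * A * exp (- B * real n * (min 1 (c n) * (lam n)\<^sup>2 / (8 * real (q n)))\<^sup>2)) \<longlonglongrightarrow> 0"
proof -
  obtain K1 where K1: "0 < K1" "eventually (\<lambda>n. norm (ln (real (p n))) \<le> K1 * norm (real n powr a)) sequentially"
    using Op by (rule landau_o.bigE)
  obtain K2 where K2: "0 < K2" "eventually (\<lambda>n. norm (real (q n)) \<le> K2 * norm (real n powr b)) sequentially"
    using Oq by (rule landau_o.bigE)
  obtain k3 where k3: "0 < k3" "eventually (\<lambda>n. k3 * real n powr (- d) \<le> c n) sequentially"
    using eventually_pos_lower_bound[OF Oc c] .
  obtain k4 where k4: "0 < k4" "eventually (\<lambda>n. k4 * real n powr (- f) \<le> lam n) sequentially"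
    using eventually_pos_lower_bound[OF Ol lam] .
  \<comment> \<open>Collects the constants: the admissible error is at least
    \<open>\<kappa> * n powr (- d - 2 * f - b)\<close>, and \<open>n\<close> times its square yields
    the exponent \<open>e\<close>.\<close>
  define \<kappa> where "\<kappa> = min 1 k3 * k4\<^sup>2 / (8 * K2)"
  have \<kappa>: "0 < \<kappa>" unfolding \<kappa>_def using k3 k4 K2 by simp
  define e where "e = 1 - 2 * b - 2 * d - 4 * f"
  have ae: "a < e" using lt unfolding e_def by simp
  define Dc where "Dc = B * \<kappa>\<^sup>2"
  have Dc: "0 < Dc" unfolding Dc_def using AB \<kappa> by simp
  have bound: "eventually (\<lambda>n. (real (p n))\<^sup>2 * A * exp (- B * real n * (min 1 (c n) * (lam n)\<^sup>2 / (8 * real (q n)))\<^sup>2)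
      \<le> A * exp (2 * K1 * real n powr a - Dc * real n powr e)) sequentially"
    using K1(2) K2(2) k3(2) k4(2) eventually_ge_at_top[of 1]
  proof eventually_elim
    case (elim n)
    define N where "N = real n"
    have N: "1 \<le> N" using elim unfolding N_def by simp
    have N0: "0 < N" using N by simp
    \<comment> \<open>Because \<open>0 \<le> d\<close>, the lower bound for \<open>c n\<close>
      survives truncation at 1, at the price of replacing \<open>k3\<close> by
      \<open>min 1 k3\<close>.\<close>
    have "N powr (- d) \<le> 1" using powr_mono[of "- d" 0 N] N d by simp
    then have "min 1 k3 * N powr (- d) \<le> 1 * 1" using k3(1) by (intro mult_mono) auto
    moreover have "min 1 k3 * N powr (- d) \<le> k3 * N powr (- d)" by (intro mult_right_mono) auto
    ultimately have c1: "min 1 k3 * N powr (- d) \<le> min 1 (c n)" using elim(3) unfolding N_def by simp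
    have l1: "(k4 * N powr (- f))\<^sup>2 \<le> (lam n)\<^sup>2" using elim(4) k4(1) unfolding N_def by (intro power_mono) auto
    have q1: "8 * real (q n) \<le> 8 * (K2 * N powr b)" using elim(2) unfolding N_def by simp
    have "\<kappa> * N powr (- d - 2 * f - b) = (min 1 k3 * N powr (- d)) * (k4 * N powr (- f))\<^sup>2 / (8 * (K2 * N powr b))"
      unfolding \<kappa>_def using N0
      by (simp add: powr_diff power_mult_distrib powr_power powr_minus powr_add field_simps)
    also have "\<dots> \<le> min 1 (c n) * (lam n)\<^sup>2 / (8 * real (q n))"
      using c1 l1 q1 q[of n] k3(1) k4(1) c[of n] by (intro frac_le mult_mono) auto
    finally have "(\<kappa> * N powr (- d - 2 * f - b))\<^sup>2 \<le> (min 1 (c n) * (lam n)\<^sup>2 / (8 * real (q n)))\<^sup>2"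
      using \<kappa> by (intro power_mono) auto
    then have "B * N * (\<kappa> * N powr (- d - 2 * f - b))\<^sup>2 \<le> B * N * (min 1 (c n) * (lam n)\<^sup>2 / (8 * real (q n)))\<^sup>2"
      using AB N0 by (intro mult_left_mono) auto
    moreover have "B * N * (\<kappa> * N powr (- d - 2 * f - b))\<^sup>2 = Dc * N powr e"
    proof -
      have "N powr e = N powr 1 * (N powr (- d - 2 * f - b) * N powr (- d - 2 * f - b))"
        unfolding powr_add[symmetric] e_def by (simp add: algebra_simps)
      then show ?thesis unfolding Dc_def using N0 by (simp add: power2_eq_square)
    qed
    ultimately have ex: "- B * N * (min 1 (c n) * (lam n)\<^sup>2 / (8 * real (q n)))\<^sup>2 \<le> - Dc * N powr e" by simp
    have "ln (real (p n)) \<le> K1 * N powr a" using elim(1) unfolding N_def by simp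
    moreover have "(real (p n))\<^sup>2 = exp (2 * ln (real (p n)))" using p[of n] by (simp add: exp_double)
    ultimately have "(real (p n))\<^sup>2 \<le> exp (2 * K1 * N powr a)" by simp
    then have "(real (p n))\<^sup>2 * exp (- B * N * (min 1 (c n) * (lam n)\<^sup>2 / (8 * real (q n)))\<^sup>2) \<le> exp (2 * K1 * N powr a) * exp (- Dc * N powr e)"
      using ex by (intro mult_mono) auto
    also have "\<dots> = exp (2 * K1 * N powr a - Dc * N powr e)" by (simp add: exp_add[symmetric])
    finally have "A * ((real (p n))\<^sup>2 * exp (- B * N * (min 1 (c n) * (lam n)\<^sup>2 / (8 * real (q n)))\<^sup>2)) \<le> A * exp (2 * K1 * N powr a - Dc * N powr e)"
      using AB by (intro mult_left_mono) auto
    then show ?case unfolding N_def by (simp add: mult_ac)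
  qed
  have lim: "(\<lambda>n. A * exp (2 * K1 * real n powr a - Dc * real n powr e)) \<longlonglongrightarrow> 0"
    using ae a Dc K1(1) by real_asymp
  show ?thesis by (rule tendsto_sandwich[OF _ bound tendsto_const lim]) (use AB in auto)
qed

theorem corollary1:
  fixes p :: "nat \<Rightarrow> nat"
    and E :: "nat \<Rightarrow> (nat \<times> nat) set"
    and \<Sigma> :: "nat \<Rightarrow> real mat"
    and a b d f A B :: real
    and est :: "nat \<Rightarrow> (nat \<Rightarrow> real \<times> real) \<Rightarrow> real"
    and und :: "nat \<Rightarrow> nat \<Rightarrow> nat \<Rightarrow> nat set \<Rightarrow> real"
    and PC :: "nat \<Rightarrow> query \<Rightarrow> (nat \<times> nat) set"
  assumes "\<And>n. 0 < p n"
    and "\<And>n. dag (p n) (E n)"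
    and "\<And>n. pd_correlation_matrix (p n) (\<Sigma> n)"
    and "\<And>n. faithful (p n) (E n) (\<Sigma> n)"
    and "0 < A" and "0 < B" and "correlation_estimator A B est"
    and "\<And>n. pc_procedure (p n) (PC n)"
    and "0 \<le> a" "a < 1" and "0 \<le> b" "b < 1" and "0 \<le> d" "d < 1" and "0 \<le> f" "f < 1"
    and "(\<lambda>n. ln (real (p n))) \<in> O(\<lambda>n. real n powr a)"
    and "(\<lambda>n. real (max_degree (p n) (E n) + 2)) \<in> O(\<lambda>n. real n powr b)"
    and "(\<lambda>n. c_min_order (\<Sigma> n) (max_degree (p n) (E n) + 2)) \<in> \<Omega>(\<lambda>n. real n powr (- d))"
    and "(\<lambda>n. lambda_min_order (\<Sigma> n) (max_degree (p n) (E n) + 2)) \<in> \<Omega>(\<lambda>n. real n powr (- f))"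
    and "a + 2 * b + 2 * d + 4 * f < 1"
  shows "\<exists>\<gamma> :: nat \<Rightarrow> real. (\<forall>n. \<gamma> n \<in> {0..1}) \<and>
    (\<forall>h :: nat \<Rightarrow> nat \<Rightarrow> real \<Rightarrow> real. (\<forall>n. strict_marginals (p n) (h n)) \<longrightarrow>
      (\<lambda>n. measure (npn_sample n (p n) (h n) (\<Sigma> n))
         {x \<in> space (npn_sample n (p n) (h n) (\<Sigma> n)).
            rpc (PC n) (und n) est (\<gamma> n) (p n) n x = cpdag (p n) (E n)})
      \<longlonglongrightarrow> 1)"
proof -
  define q where "q n = max_degree (p n) (E n) + 2" for n
  define c where "c n = c_min_order (\<Sigma> n) (q n)" for n
  define lam where "lam n = lambda_min_order (\<Sigma> n) (q n)" for n
  define err where "err n = (real (p n))\<^sup>2 * A * exp (- B * real n * (min 1 (c n) * (lam n)\<^sup>2 / (8 * real (q n)))\<^sup>2)" for n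
  have q0: "0 < q n" for n unfolding q_def by simp
  have c0: "0 < c n" for n
    unfolding c_def by (rule c_min_order_bounds(1)[OF pd_correlation_matrixD(1)[OF assms(3)]])
  have lam0: "0 < lam n" for n unfolding lam_def by (rule lambda_min_order_bounds(1)[OF assms(3,1) q0])
  have err0: "err \<longlonglongrightarrow> 0"
    unfolding err_def
    by (rule error_bound_tendsto_0[OF assms(1) q0 c0 lam0 assms(5,6) \<open>0 \<le> d\<close> _ _ _ _ \<open>0 \<le> a\<close> assms(21)])
      (use assms(17-20) in \<open>simp_all add: q_def c_def lam_def\<close>)
  \<comment> \<open>The threshold depends on the correlation matrix but not on \<open>h\<close>, as
    the order of the quantifiers demands. Truncation places it in the unit interval without a proof
    that partial correlations are at most 1 in modulus.\<close>
  define \<gamma> where "\<gamma> n = min 1 (c n) / 4" for n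
  have "\<gamma> n \<in> {0..1}" for n using c0[of n] unfolding \<gamma>_def by (auto simp: min_def)
  moreover have "(\<lambda>n. measure (npn_sample n (p n) (h n) (\<Sigma> n))
         {x \<in> space (npn_sample n (p n) (h n) (\<Sigma> n)).
            rpc (PC n) (und n) est (\<gamma> n) (p n) n x = cpdag (p n) (E n)}) \<longlonglongrightarrow> 1"
    if h: "\<forall>n. strict_marginals (p n) (h n)" for h :: "nat \<Rightarrow> nat \<Rightarrow> real \<Rightarrow> real"
  proof (rule tendsto_sandwich[OF _ _ _ tendsto_const])
    show "(\<lambda>n. 1 - err n) \<longlonglongrightarrow> 1" using tendsto_diff[OF tendsto_const err0, of 1] by simp
    show "eventually (\<lambda>n. 1 - err n \<le> measure (npn_sample n (p n) (h n) (\<Sigma> n))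
         {x \<in> space (npn_sample n (p n) (h n) (\<Sigma> n)).
            rpc (PC n) (und n) est (\<gamma> n) (p n) n x = cpdag (p n) (E n)}) sequentially"
      \<comment> \<open>\<open>correlation_estimator\<close> promises nothing for an empty
        sample.\<close>
      using eventually_ge_at_top[of 1]
    proof eventually_elim
      case (elim n)
      show ?case unfolding err_def \<gamma>_def
        by (rule rpc_success_probability[OF assms(1-4) assms(7,8) elim spec[OF h] assms(5) q_def _ lam_def refl])
          (simp add: c_def)
    qed
    show "eventually (\<lambda>n. measure (npn_sample n (p n) (h n) (\<Sigma> n))
         {x \<in> space (npn_sample n (p n) (h n) (\<Sigma> n)).
            rpc (PC n) (und n) est (\<gamma> n) (p n) n x = cpdag (p n) (E n)} \<le> 1) sequentially"
      using h prob_space_npn_sample[OF assms(3)] by (intro always_eventually allI prob_space.prob_le_1) blast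
  qed
  ultimately show ?thesis by blast
qed

end
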